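(* Let $\boldsymbol\beta$ be a non-increasing weight sequence, let $\mathcal X,\mathcal Y,\mathcal U$ be Hilbert spaces, and let $T\in\mathcal L(\mathcal X)$, $E\in\mathcal L(\mathcal X,\mathcal Y)$, $N\in\mathcal L(\mathcal X,\mathcal U)$ be such that $(E,T)$ is $\boldsymbol\beta$-output stable and $(N,T)$ is $\mathbf 1$-output stable. Assume that $P:=\mathcal G_{\boldsymbol\beta,E,T}-\mathcal G_{\mathbf 1,N,T}$ is strictly positive definite (positive and boundedly invertible). Let $J=\begin{bmatrix} I_{\ell_2(\mathcal Y)} & 0 \\ 0 & -I_{\mathcal U} \end{bmatrix}$ and let $$\Theta(z)=\begin{bmatrix} A(z) & B(z) \\ C(z) & D(z) \end{bmatrix}$$ be an $\mathcal L(\ell_2(\mathcal Y)\oplus\mathcal U)$-valued function such that for all $z,\zeta\in\mathbb D$ $$\frac{J-\Theta(z)J\Theta(\zeta)^*}{1-z\overline\zeta}=\begin{bmatrix} \widetilde{\mathcal O}_{\boldsymbol\beta,E,T} \\ N \end{bmatrix}(I-zT)^{-1}P^{-1}(I-\overline\zeta T^* )^{-1}\begin{bmatrix} \widetilde{\mathcal O}_{\boldsymbol\beta,E,T}^* & N^* \end{bmatrix}.$$ Then all functions $S\in\mathcal S_{\boldsymbol\beta}(\mathcal U,\mathcal Y)$ satisfying the interpolation condition $$\mathcal O_{\boldsymbol\beta,E,T}^*\,M_S|_{\mathcal U}=N^*$$ are parametrized by the formula $$S=\Psi_{\boldsymbol\beta}\,(A\mathcal E+B)(C\mathcal E+D)^{-1},$$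 where $\mathcal E$ is a free parameter from the Schur class $\mathcal S(\mathcal U,\ell_2(\mathcal Y))$.
   Context: $\mathbb D$ is the open unit disk; $\mathcal L(\cdot,\cdot)$ denotes bounded linear operators, and $\mathcal L(\mathcal X)=\mathcal L(\mathcal X,\mathcal X)$. A weight sequence is a sequence $\boldsymbol\beta=\{\beta_j\}_{j\ge0}$ of positive numbers with $\beta_0=1$ and $\liminf_j\beta_j^{1/j}\ge 1$; $\mathbf 1$ is the sequence of all ones. $H^2_{\boldsymbol\beta}(\mathcal Y)$ is the Hilbert space of $\mathcal Y$-valued power series $f(z)=\sum_{k\ge0}f_kz^k$ with $\|f\|^2=\sum_{k\ge0}\beta_k\|f_k\|_{\mathcal Y}^2<\infty$; $H^2(\mathcal U)=H^2_{\mathbf 1}(\mathcal U)$. $\mathcal S_{\boldsymbol\beta}(\mathcal U,\mathcal Y)$ is the set of $\mathcal L(\mathcal U,\mathcal Y)$-valued functions $S$ on $\mathbb D$ such that $M_S:f\mapsto Sf$ is a contraction from $H^2(\mathcal U)$ to $H^2_{\boldsymbol\beta}(\mathcal Y)$; $M_S|_{\mathcal U}$ is its restriction to the constant functions, identified with $\mathcal U$. The Schur class $\mathcal S(\mathcal U,\mathcal G)$ is the set of analytic functions on $\mathbb D$ whose values are contractive operators from $\mathcal U$ to $\mathcal G$. A pair $(E,T)$ with $T\in\mathcal L(\mathcal X)$, $E\in\mathcal L(\mathcal X,\mathcal Y)$ is $\boldsymbol\beta$-output stable if the observability operator $\mathcal O_{\boldsymbol\beta,E,T}:x\mapsto\sum_{j=0}^\infty(\beta_j^{-1}ET^jx)z^j$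 maps $\mathcal X$ into $H^2_{\boldsymbol\beta}(\mathcal Y)$ and is bounded; then $\mathcal G_{\boldsymbol\beta,E,T}=\mathcal O_{\boldsymbol\beta,E,T}^*\mathcal O_{\boldsymbol\beta,E,T}$. The same definitions with $\boldsymbol\beta=\mathbf 1$ and $(N,T)$ give $\mathbf 1$-output stability, $\mathcal O_{\mathbf 1,N,T}:\mathcal X\to H^2(\mathcal U)$ and $\mathcal G_{\mathbf 1,N,T}$. For non-increasing $\boldsymbol\beta$, set $\gamma_0^{-1}=1$ and $\gamma_j^{-1}=\beta_j^{-1}-\beta_{j-1}^{-1}\ge0$ for $j\ge1$. Define $\Psi_{\boldsymbol\beta}(z)\in\mathcal L(\ell_2(\mathcal Y),\mathcal Y)$, $z\in\mathbb D$, by $\Psi_{\boldsymbol\beta}(z)\{y_j\}_{j\ge0}=\sum_{j\ge0}\gamma_j^{-1/2}y_jz^j$, and the bounded operator $\widetilde{\mathcal O}_{\boldsymbol\beta,E,T}:\mathcal X\to\ell_2(\mathcal Y)$ by $\widetilde{\mathcal O}_{\boldsymbol\beta,E,T}x=\{\gamma_j^{-1/2}ET^jx\}_{j\ge0}$.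
   Formalization: If U is infinite-dimensional, it is also assumed that D(z) is injective for some z in the disk; without this CE+D need not be invertible (e.g. X=0, U=l_2, Theta=diag(I,W* ) with W the unilateral shift), so the formula would be undefined. *)

theory Defs
  imports "HOL-Analysis.Analysis"
begin

section \<open>Complex Hilbert spaces\<close>

text \<open>
  The inner product \<open>cinner\<close> is linear in its first argument. Definiteness comes from
  class \<^class>\<open>real_inner\<close>, whose real inner product is the real part of \<open>cinner\<close>;
  hence \<^const>\<open>norm\<close> is the norm induced by \<open>cinner\<close>.
\<close>

class complex_inner = real_inner +
  fixes scaleC :: "complex \<Rightarrow> 'a \<Rightarrow> 'a"  (infixr "*\<^sub>C" 75)
    and cinner :: "'a \<Rightarrow> 'a \<Rightarrow> complex"
  assumes scaleC_add_right: "c *\<^sub>C (x + y) = c *\<^sub>C x + c *\<^sub>C y"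
    and scaleC_add_left: "(c + d) *\<^sub>C x = c *\<^sub>C x + d *\<^sub>C x"
    and scaleC_scaleC: "c *\<^sub>C d *\<^sub>C x = (c * d) *\<^sub>C x"
    and scaleR_scaleC: "r *\<^sub>R x = complex_of_real r *\<^sub>C x"
    and cinner_commute: "cinner x y = cnj (cinner y x)"
    and cinner_add_left: "cinner (x + y) z = cinner x z + cinner y z"
    and cinner_scaleC_left: "cinner (c *\<^sub>C x) y = c * cinner x y"
    and inner_eq_Re_cinner: "inner x y = Re (cinner x y)"

class complex_hilbert = complex_inner + complete_space

instantiation complex :: complex_inner
begin
definition scaleC_complex :: "complex \<Rightarrow> complex \<Rightarrow> complex"
  where "scaleC_complex c x = c * x"
definition cinner_complex :: "complex \<Rightarrow> complex \<Rightarrow> complex"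
  where "cinner_complex x y = x * cnj y"
instance
  by standard
    (auto simp: scaleC_complex_def cinner_complex_def algebra_simps scaleR_conv_of_real
      inner_complex_def)
end

instance complex :: complex_hilbert ..

instantiation prod :: (complex_inner, complex_inner) complex_inner
begin
definition scaleC_prod :: "complex \<Rightarrow> 'a \<times> 'b \<Rightarrow> 'a \<times> 'b"
  where "scaleC_prod c x = (c *\<^sub>C fst x, c *\<^sub>C snd x)"
definition cinner_prod :: "'a \<times> 'b \<Rightarrow> 'a \<times> 'b \<Rightarrow> complex"
  where "cinner_prod x y = cinner (fst x) (fst y) + cinner (snd x) (snd y)"
instance
proof
  fix x y z :: "'a \<times> 'b" and c d :: complex and r :: real
  show "c *\<^sub>C (x + y) = c *\<^sub>C x + c *\<^sub>C y"
    by (simp add: scaleC_prod_def scaleC_add_right)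
  show "(c + d) *\<^sub>C x = c *\<^sub>C x + d *\<^sub>C x"
    by (simp add: scaleC_prod_def scaleC_add_left)
  show "c *\<^sub>C d *\<^sub>C x = (c * d) *\<^sub>C x"
    by (simp add: scaleC_prod_def scaleC_scaleC)
  show "r *\<^sub>R x = complex_of_real r *\<^sub>C x"
    by (simp add: scaleC_prod_def scaleR_scaleC scaleR_prod_def)
  show "cinner x y = cnj (cinner y x)"
    using cinner_commute[of "fst x" "fst y"] cinner_commute[of "snd x" "snd y"]
    by (simp add: cinner_prod_def)
  show "cinner (x + y) z = cinner x z + cinner y z"
    by (simp add: cinner_prod_def cinner_add_left)
  show "cinner (c *\<^sub>C x) y = c * cinner x y"
    by (simp add: cinner_prod_def scaleC_prod_def cinner_scaleC_left distrib_left)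
  show "inner x y = Re (cinner x y)"
    by (simp add: cinner_prod_def inner_prod_def inner_eq_Re_cinner)
qed
end

instance prod :: (complex_hilbert, complex_hilbert) complex_hilbert ..


section \<open>The Hilbert space of square summable sequences\<close>

typedef (overloaded) 'a ell2 = "{f :: nat \<Rightarrow> 'a::real_inner. summable (\<lambda>k. (norm (f k))\<^sup>2)}"
  morphisms ell2_nth Abs_ell2
  by (rule exI[of _ "\<lambda>_. 0"]) simp

lemma summable_ell2: "summable (\<lambda>k. (norm (ell2_nth x k))\<^sup>2)"
  using ell2_nth[of x] by simp

lemma ell2_eqI: "(\<And>k. ell2_nth x k = ell2_nth y k) \<Longrightarrow> x = y"
  by (metis ell2_nth_inject ext)

lemma ell2_nth_Abs:
  "summable (\<lambda>k. (norm (f k))\<^sup>2) \<Longrightarrow> ell2_nth (Abs_ell2 f) = f"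
  by (simp add: Abs_ell2_inverse)

lemma summable_norm_add_square:
  fixes f g :: "nat \<Rightarrow> 'a::real_inner"
  assumes "summable (\<lambda>k. (norm (f k))\<^sup>2)" "summable (\<lambda>k. (norm (g k))\<^sup>2)"
  shows "summable (\<lambda>k. (norm (f k + g k))\<^sup>2)"
proof (rule summable_comparison_test')
  show "summable (\<lambda>k. 2 * (norm (f k))\<^sup>2 + 2 * (norm (g k))\<^sup>2)"
    using assms by (intro summable_add summable_mult)
  fix k :: nat
  have "(norm (f k + g k))\<^sup>2 + (norm (f k - g k))\<^sup>2 = 2 * (norm (f k))\<^sup>2 + 2 * (norm (g k))\<^sup>2"
    by (simp add: power2_norm_eq_inner inner_diff inner_add inner_commute)
  then show "norm ((norm (f k + g k))\<^sup>2) \<le> 2 * (norm (f k))\<^sup>2 + 2 * (norm (g k))\<^sup>2"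
    by (smt (verit) real_norm_def zero_le_power2)
qed

lemma summable_norm_product:
  fixes f g :: "nat \<Rightarrow> 'a::real_inner"
  assumes "summable (\<lambda>k. (norm (f k))\<^sup>2)" "summable (\<lambda>k. (norm (g k))\<^sup>2)"
  shows "summable (\<lambda>k. norm (f k) * norm (g k))"
proof (rule summable_comparison_test')
  show "summable (\<lambda>k. (norm (f k))\<^sup>2 + (norm (g k))\<^sup>2)"
    using assms by (intro summable_add)
  fix k :: nat
  show "norm (norm (f k) * norm (g k)) \<le> (norm (f k))\<^sup>2 + (norm (g k))\<^sup>2"
    using sum_squares_bound[of "norm (f k)" "norm (g k)"]
      zero_le_power2[of "norm (f k)"] zero_le_power2[of "norm (g k)"]
      mult_nonneg_nonneg[OF norm_ge_zero[of "f k"] norm_ge_zero[of "g k"]]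
    unfolding real_norm_def abs_mult abs_norm_cancel by linarith
qed

lemma summable_inner_ell2: "summable (\<lambda>k. inner (ell2_nth x k) (ell2_nth y k))"
  by (rule summable_comparison_test'[OF summable_norm_product[OF summable_ell2[of x] summable_ell2[of y]]])
    (simp add: Cauchy_Schwarz_ineq2)

instantiation ell2 :: (real_inner) real_inner
begin

definition zero_ell2 :: "'a ell2" where "0 = Abs_ell2 (\<lambda>_. 0)"
definition plus_ell2 :: "'a ell2 \<Rightarrow> 'a ell2 \<Rightarrow> 'a ell2"
  where "x + y = Abs_ell2 (\<lambda>k. ell2_nth x k + ell2_nth y k)"
definition scaleR_ell2 :: "real \<Rightarrow> 'a ell2 \<Rightarrow> 'a ell2"
  where "r *\<^sub>R x = Abs_ell2 (\<lambda>k. r *\<^sub>R ell2_nth x k)"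
definition uminus_ell2 :: "'a ell2 \<Rightarrow> 'a ell2" where "- x = (-1) *\<^sub>R x" for x :: "'a ell2"
definition minus_ell2 :: "'a ell2 \<Rightarrow> 'a ell2 \<Rightarrow> 'a ell2"
  where "x - y = x + - y" for x y :: "'a ell2"
definition inner_ell2 :: "'a ell2 \<Rightarrow> 'a ell2 \<Rightarrow> real"
  where "inner x y = (\<Sum>k. inner (ell2_nth x k) (ell2_nth y k))"
definition norm_ell2 :: "'a ell2 \<Rightarrow> real" where "norm x = sqrt (inner x x)" for x :: "'a ell2"
definition dist_ell2 :: "'a ell2 \<Rightarrow> 'a ell2 \<Rightarrow> real" where "dist x y = norm (x - y)" for x y :: "'a ell2"
definition sgn_ell2 :: "'a ell2 \<Rightarrow> 'a ell2" where "sgn x = inverse (norm x) *\<^sub>R x" for x :: "'a ell2"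
definition uniformity_ell2 :: "('a ell2 \<times> 'a ell2) filter"
  where "uniformity_ell2 = (INF e\<in>{0<..}. principal {(x, y). dist x y < e})"
definition open_ell2 :: "'a ell2 set \<Rightarrow> bool"
  where "open_ell2 U \<longleftrightarrow> (\<forall>x\<in>U. \<forall>\<^sub>F (x', y) in uniformity. x' = x \<longrightarrow> y \<in> U)"

lemma nth_plus: "ell2_nth (x + y) k = ell2_nth x k + ell2_nth y k"
  unfolding plus_ell2_def by (simp add: ell2_nth_Abs summable_norm_add_square summable_ell2)

lemma nth_zero: "ell2_nth 0 k = 0"
  unfolding zero_ell2_def by (simp add: ell2_nth_Abs)

lemma nth_scaleR: "ell2_nth (r *\<^sub>R x) k = r *\<^sub>R ell2_nth x k"
proof -
  have "summable (\<lambda>k. (norm (r *\<^sub>R ell2_nth x k))\<^sup>2)"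
    using summable_mult[OF summable_ell2[of x], of "r\<^sup>2"] by (simp add: power_mult_distrib)
  then show ?thesis unfolding scaleR_ell2_def by (simp add: ell2_nth_Abs)
qed

lemma nth_uminus: "ell2_nth (- x) k = - ell2_nth x k"
  unfolding uminus_ell2_def by (simp add: nth_scaleR)

lemma nth_minus: "ell2_nth (x - y) k = ell2_nth x k - ell2_nth y k"
  unfolding minus_ell2_def by (simp add: nth_plus nth_uminus)

instance
proof
  fix x y z :: "'a ell2" and r s :: real
  note nth = nth_plus nth_zero nth_scaleR nth_uminus nth_minus
  show "x + y + z = x + (y + z)" by (rule ell2_eqI) (simp add: nth)
  show "x + y = y + x" by (rule ell2_eqI) (simp add: nth)
  show "0 + x = x" by (rule ell2_eqI) (simp add: nth)
  show "- x + x = 0" by (rule ell2_eqI) (simp add: nth)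
  show "x - y = x + - y" by (rule ell2_eqI) (simp add: nth)
  show "r *\<^sub>R (x + y) = r *\<^sub>R x + r *\<^sub>R y" by (rule ell2_eqI) (simp add: nth algebra_simps)
  show "(r + s) *\<^sub>R x = r *\<^sub>R x + s *\<^sub>R x" by (rule ell2_eqI) (simp add: nth algebra_simps)
  show "r *\<^sub>R s *\<^sub>R x = (r * s) *\<^sub>R x" by (rule ell2_eqI) (simp add: nth)
  show "1 *\<^sub>R x = x" by (rule ell2_eqI) (simp add: nth)
  show "dist x y = norm (x - y)" by (rule dist_ell2_def)
  show "sgn x = inverse (norm x) *\<^sub>R x" by (rule sgn_ell2_def)
  show "uniformity = (INF e\<in>{0<..}. principal {(x, y::'a ell2). dist x y < e})"
    by (rule uniformity_ell2_def)
  show "open U \<longleftrightarrow> (\<forall>x\<in>U. \<forall>\<^sub>F (x', y) in uniformity. x' = x \<longrightarrow> y \<in> U)" for U :: "'a ell2 set"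
    by (rule open_ell2_def)
  show "inner x y = inner y x" by (simp add: inner_ell2_def inner_commute)
  show "inner (x + y) z = inner x z + inner y z"
    by (simp add: inner_ell2_def nth inner_add_left suminf_add summable_inner_ell2)
  show "inner (r *\<^sub>R x) y = r * inner x y"
    by (simp add: inner_ell2_def nth suminf_mult summable_inner_ell2)
  show "0 \<le> inner x x"
    unfolding inner_ell2_def by (rule suminf_nonneg[OF summable_inner_ell2]) simp
  show "inner x x = 0 \<longleftrightarrow> x = 0"
  proof
    assume "inner x x = 0"
    then have "\<forall>k. inner (ell2_nth x k) (ell2_nth x k) = 0"
      unfolding inner_ell2_def by (subst (asm) suminf_eq_zero_iff[OF summable_inner_ell2]) auto
    then show "x = 0" by (intro ell2_eqI) (simp add: nth)
  qed (simp add: inner_ell2_def nth)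
  show "norm x = sqrt (inner x x)" by (rule norm_ell2_def)
qed

end

lemma norm_ell2_square: "(norm x)\<^sup>2 = (\<Sum>k. (norm (ell2_nth x k))\<^sup>2)"
  by (simp add: power2_norm_eq_inner inner_ell2_def)

lemma sum_nth_le_norm_ell2: "(\<Sum>k<n. (norm (ell2_nth x k))\<^sup>2) \<le> (norm x)\<^sup>2"
  unfolding norm_ell2_square by (rule sum_le_suminf[OF summable_ell2]) auto

lemma norm_nth_le_norm_ell2: "norm (ell2_nth x k) \<le> norm x"
proof (rule power2_le_imp_le)
  have "(norm (ell2_nth x k))\<^sup>2 \<le> (\<Sum>j<Suc k. (norm (ell2_nth x j))\<^sup>2)"
    by (rule member_le_sum) auto
  then show "(norm (ell2_nth x k))\<^sup>2 \<le> (norm x)\<^sup>2"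
    using sum_nth_le_norm_ell2[of x "Suc k"] by (rule order_trans)
qed simp

instance ell2 :: ("{real_inner, complete_space}") complete_space
proof
  fix X :: "nat \<Rightarrow> 'a ell2"
  assume X: "Cauchy X"
  have "Cauchy (\<lambda>n. ell2_nth (X n) k)" for k
  proof (rule metric_CauchyI)
    fix e :: real assume "0 < e"
    then obtain M where "\<forall>m\<ge>M. \<forall>n\<ge>M. dist (X m) (X n) < e"
      using metric_CauchyD[OF X] by blast
    moreover have "dist (ell2_nth (X m) k) (ell2_nth (X n) k) \<le> dist (X m) (X n)" for m n
      using norm_nth_le_norm_ell2[of "X m - X n" k] by (simp only: dist_norm nth_minus)
    ultimately show "\<exists>M. \<forall>m\<ge>M. \<forall>n\<ge>M. dist (ell2_nth (X m) k) (ell2_nth (X n) k) < e"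
      using order_le_less_trans by blast
  qed
  then have lim: "\<forall>k. \<exists>l. (\<lambda>n. ell2_nth (X n) k) \<longlonglongrightarrow> l"
    using Cauchy_convergent unfolding convergent_def by blast
  from choice[OF lim] obtain L where L: "\<And>k. (\<lambda>n. ell2_nth (X n) k) \<longlonglongrightarrow> L k"
    by (elim exE) auto
  have bound: "(\<Sum>k<K. (norm (L k - ell2_nth (X n) k))\<^sup>2) \<le> e\<^sup>2"
    if "\<forall>m\<ge>M. \<forall>n\<ge>M. dist (X m) (X n) < e" "M \<le> n" for e :: real and M n K
  proof (rule tendsto_upperbound)
    show "(\<lambda>m. \<Sum>k<K. (norm (ell2_nth (X m) k - ell2_nth (X n) k))\<^sup>2)
            \<longlonglongrightarrow> (\<Sum>k<K. (norm (L k - ell2_nth (X n) k))\<^sup>2)"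
      by (intro tendsto_sum tendsto_power tendsto_norm tendsto_diff tendsto_const L)
    show "\<forall>\<^sub>F m in sequentially. (\<Sum>k<K. (norm (ell2_nth (X m) k - ell2_nth (X n) k))\<^sup>2) \<le> e\<^sup>2"
    proof (rule eventually_sequentiallyI)
      fix m assume "M \<le> m"
      then have "norm (X m - X n) \<le> e"
        using that by (simp add: dist_norm[symmetric] less_imp_le)
      then have "(norm (X m - X n))\<^sup>2 \<le> e\<^sup>2"
        by (simp add: power_mono)
      then show "(\<Sum>k<K. (norm (ell2_nth (X m) k - ell2_nth (X n) k))\<^sup>2) \<le> e\<^sup>2"
        using sum_nth_le_norm_ell2[of "X m - X n" K] by (simp add: nth_minus)
    qed
  qed simp
  have diff: "summable (\<lambda>k. (norm (L k - ell2_nth (X n) k))\<^sup>2)"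
      "(\<Sum>k. (norm (L k - ell2_nth (X n) k))\<^sup>2) \<le> e\<^sup>2"
    if "\<forall>m\<ge>M. \<forall>n\<ge>M. dist (X m) (X n) < e" "M \<le> n" for e :: real and M n
  proof -
    show s: "summable (\<lambda>k. (norm (L k - ell2_nth (X n) k))\<^sup>2)"
    proof (rule bounded_imp_summable)
      show "(\<Sum>k\<le>K. (norm (L k - ell2_nth (X n) k))\<^sup>2) \<le> e\<^sup>2" for K
        using bound[OF that, of "Suc K"] unfolding lessThan_Suc_atMost .
    qed simp
    show "(\<Sum>k. (norm (L k - ell2_nth (X n) k))\<^sup>2) \<le> e\<^sup>2"
      by (rule suminf_le_const[OF s bound[OF that]])
  qed
  obtain M where M: "\<forall>m\<ge>M. \<forall>n\<ge>M. dist (X m) (X n) < 1"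
    using metric_CauchyD[OF X zero_less_one] by blast
  have nth_L: "ell2_nth (Abs_ell2 L) = L"
    using summable_norm_add_square[OF diff(1)[OF M order_refl] summable_ell2[of "X M"]]
    by (intro ell2_nth_Abs) simp
  have "X \<longlonglongrightarrow> Abs_ell2 L"
  proof (rule metric_LIMSEQ_I)
    fix e :: real assume "0 < e"
    then obtain M where M: "\<forall>m\<ge>M. \<forall>n\<ge>M. dist (X m) (X n) < e / 2"
      using metric_CauchyD[OF X half_gt_zero[OF \<open>0 < e\<close>]] by blast
    have "dist (X n) (Abs_ell2 L) < e" if "M \<le> n" for n
    proof -
      have "(norm (Abs_ell2 L - X n))\<^sup>2 \<le> (e / 2)\<^sup>2"
        using diff(2)[OF M that] unfolding norm_ell2_square nth_minus nth_L .
      then have "norm (Abs_ell2 L - X n) \<le> e / 2"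
        by (rule power2_le_imp_le) (use \<open>0 < e\<close> in simp)
      then show ?thesis
        using \<open>0 < e\<close> unfolding dist_norm norm_minus_commute[of "X n"] by linarith
    qed
    then show "\<exists>no. \<forall>n\<ge>no. dist (X n) (Abs_ell2 L) < e" by blast
  qed
  then show "convergent X" by (rule convergentI)
qed

lemma cinner_self_eq: "cinner x x = complex_of_real ((norm x)\<^sup>2)"
proof -
  have "Im (cinner x x) = 0"
    using cinner_commute[of x x] by (simp add: complex_eq_iff)
  then show ?thesis
    by (simp add: complex_eq_iff power2_norm_eq_inner inner_eq_Re_cinner)
qed

lemma norm_scaleC: "norm (c *\<^sub>C x) = cmod c * norm x"
proof -
  have "cinner (c *\<^sub>C x) (c *\<^sub>C x) = c * cnj (c * cinner x x)"
    by (metis cinner_scaleC_left cinner_commute)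
  also have "\<dots> = complex_of_real ((cmod c)\<^sup>2 * (norm x)\<^sup>2)"
    using complex_norm_square[of c] by (simp add: cinner_self_eq mult_ac)
  finally have "(norm (c *\<^sub>C x))\<^sup>2 = (cmod c * norm x)\<^sup>2"
    by (simp only: cinner_self_eq of_real_eq_iff power_mult_distrib)
  then show ?thesis by simp
qed

lemma Re_cinner_scaleC_i: "Re (cinner (\<i> *\<^sub>C x) y) = - Im (cinner x y)"
  by (simp add: cinner_scaleC_left)

lemma summable_cinner_ell2:
  fixes x y :: "'a::complex_inner ell2"
  shows "summable (\<lambda>k. cinner (ell2_nth x k) (ell2_nth y k))"
proof -
  have "summable (\<lambda>k. Re (cinner (ell2_nth x k) (ell2_nth y k)))"
    using summable_inner_ell2[of x y] by (simp add: inner_eq_Re_cinner)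
  moreover have "summable (\<lambda>k. Im (cinner (ell2_nth x k) (ell2_nth y k)))"
  proof (rule summable_comparison_test'[OF summable_norm_product[OF summable_ell2[of x] summable_ell2[of y]]])
    fix k :: nat
    have "\<bar>inner (\<i> *\<^sub>C ell2_nth x k) (ell2_nth y k)\<bar> \<le> norm (ell2_nth x k) * norm (ell2_nth y k)"
      using Cauchy_Schwarz_ineq2[of "\<i> *\<^sub>C ell2_nth x k" "ell2_nth y k"] by (simp add: norm_scaleC)
    then show "norm (Im (cinner (ell2_nth x k) (ell2_nth y k))) \<le> norm (ell2_nth x k) * norm (ell2_nth y k)"
      by (simp add: inner_eq_Re_cinner Re_cinner_scaleC_i)
  qed
  ultimately show ?thesis by (simp add: summable_complex_iff)
qed

instantiation ell2 :: (complex_inner) complex_inner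
begin

definition scaleC_ell2 :: "complex \<Rightarrow> 'a ell2 \<Rightarrow> 'a ell2"
  where "c *\<^sub>C x = Abs_ell2 (\<lambda>k. c *\<^sub>C ell2_nth x k)"
definition cinner_ell2 :: "'a ell2 \<Rightarrow> 'a ell2 \<Rightarrow> complex"
  where "cinner x y = (\<Sum>k. cinner (ell2_nth x k) (ell2_nth y k))"

lemma nth_scaleC: "ell2_nth (c *\<^sub>C x) k = c *\<^sub>C ell2_nth x k"
proof -
  have "summable (\<lambda>k. (norm (c *\<^sub>C ell2_nth x k))\<^sup>2)"
    using summable_mult[OF summable_ell2[of x], of "(cmod c)\<^sup>2"]
    by (simp add: norm_scaleC power_mult_distrib)
  then show ?thesis unfolding scaleC_ell2_def by (simp add: ell2_nth_Abs)
qed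

instance
proof
  fix x y z :: "'a ell2" and c d :: complex and r :: real
  note nth = nth_plus nth_scaleR nth_scaleC
  show "c *\<^sub>C (x + y) = c *\<^sub>C x + c *\<^sub>C y"
    by (rule ell2_eqI) (simp add: nth scaleC_add_right)
  show "(c + d) *\<^sub>C x = c *\<^sub>C x + d *\<^sub>C x"
    by (rule ell2_eqI) (simp add: nth scaleC_add_left)
  show "c *\<^sub>C d *\<^sub>C x = (c * d) *\<^sub>C x"
    by (rule ell2_eqI) (simp add: nth scaleC_scaleC)
  show "r *\<^sub>R x = complex_of_real r *\<^sub>C x"
    by (rule ell2_eqI) (simp add: nth scaleR_scaleC)
  show "cinner x y = cnj (cinner y x)"
    unfolding cinner_ell2_def
    using summable_sums[OF summable_cinner_ell2[of y x], THEN sums_cnj[THEN iffD2]]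
    by (simp add: cinner_commute[symmetric] sums_iff)
  show "cinner (x + y) z = cinner x z + cinner y z"
    by (simp add: cinner_ell2_def nth cinner_add_left suminf_add summable_cinner_ell2)
  show "cinner (c *\<^sub>C x) y = c * cinner x y"
    by (simp add: cinner_ell2_def nth cinner_scaleC_left suminf_mult summable_cinner_ell2)
  show "inner x y = Re (cinner x y)"
    using bounded_linear.suminf[OF bounded_linear_Re summable_cinner_ell2[of x y]]
    by (simp add: cinner_ell2_def inner_ell2_def inner_eq_Re_cinner)
qed

end

instance ell2 :: (complex_hilbert) complex_hilbert ..


section \<open>Bounded operators\<close>

definition bounded_clinear :: "('a::complex_inner \<Rightarrow> 'b::complex_inner) \<Rightarrow> bool"
  where "bounded_clinear A \<longleftrightarrow> bounded_linear A \<and> (\<forall>c x. A (c *\<^sub>C x) = c *\<^sub>C A x)"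

definition cadjoint :: "('a::complex_inner \<Rightarrow> 'b::complex_inner) \<Rightarrow> 'b \<Rightarrow> 'a"
  where "cadjoint A = (THE B. \<forall>x y. cinner (A x) y = cinner x (B y))"

definition boundedly_invertible :: "('a::complex_inner \<Rightarrow> 'b::complex_inner) \<Rightarrow> bool"
  where "boundedly_invertible A \<longleftrightarrow>
    bounded_clinear A \<and> (\<exists>B. bounded_clinear B \<and> A \<circ> B = id \<and> B \<circ> A = id)"

definition strictly_positive :: "('a::complex_inner \<Rightarrow> 'a) \<Rightarrow> bool"
  where "strictly_positive A \<longleftrightarrow>
    (\<forall>x. Im (cinner (A x) x) = 0 \<and> 0 \<le> Re (cinner (A x) x)) \<and> boundedly_invertible A"

abbreviation unit_disk :: "complex set"  (\<open>\<bbbD>\<close>)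
  where "\<bbbD> \<equiv> ball 0 1"

text \<open>The derivative is taken with respect to the operator norm.\<close>

definition op_analytic :: "(complex \<Rightarrow> 'a::complex_inner \<Rightarrow> 'b::complex_inner) \<Rightarrow> bool"
  where "op_analytic F \<longleftrightarrow>
    (\<forall>z\<in>\<bbbD>. \<exists>F'. bounded_clinear F' \<and>
      ((\<lambda>w. onorm (\<lambda>x. inverse (w - z) *\<^sub>C (F w x - F z x) - F' x)) \<longlongrightarrow> 0) (at z))"

definition schur_class :: "(complex \<Rightarrow> 'a::complex_inner \<Rightarrow> 'b::complex_inner) set"
  where "schur_class = {F. op_analytic F \<and>
    (\<forall>z\<in>\<bbbD>. bounded_clinear (F z) \<and> (\<forall>x. norm (F z x) \<le> norm x))}"


section \<open>Weighted Hardy spaces\<close>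

definition weight_sequence :: "(nat \<Rightarrow> real) \<Rightarrow> bool"
  where "weight_sequence \<beta> \<longleftrightarrow>
    (\<forall>j. 0 < \<beta> j) \<and> \<beta> 0 = 1 \<and> 1 \<le> liminf (\<lambda>j. ereal (root j (\<beta> j)))"

abbreviation one_weight :: "nat \<Rightarrow> real"
  where "one_weight \<equiv> \<lambda>_. 1"

text \<open>A power series is represented by its sequence of coefficients; \<open>ps_eval\<close> is its sum.\<close>

definition ps_eval :: "(nat \<Rightarrow> 'a::complex_inner) \<Rightarrow> complex \<Rightarrow> 'a"
  where "ps_eval f z = (\<Sum>k. z ^ k *\<^sub>C f k)"

definition H2 :: "(nat \<Rightarrow> real) \<Rightarrow> (nat \<Rightarrow> 'a::complex_inner) set"
  where "H2 \<beta> = {f. summable (\<lambda>k. \<beta> k * (norm (f k))\<^sup>2)}"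

definition H2_norm :: "(nat \<Rightarrow> real) \<Rightarrow> (nat \<Rightarrow> 'a::complex_inner) \<Rightarrow> real"
  where "H2_norm \<beta> f = sqrt (\<Sum>k. \<beta> k * (norm (f k))\<^sup>2)"

definition H2_cinner ::
    "(nat \<Rightarrow> real) \<Rightarrow> (nat \<Rightarrow> 'a::complex_inner) \<Rightarrow> (nat \<Rightarrow> 'a) \<Rightarrow> complex"
  where "H2_cinner \<beta> f g = (\<Sum>k. complex_of_real (\<beta> k) * cinner (f k) (g k))"

definition H2_const :: "'a::complex_inner \<Rightarrow> nat \<Rightarrow> 'a"
  where "H2_const u = (\<lambda>k. if k = 0 then u else 0)"

text \<open>The adjoint of a bounded operator from a Hilbert space into \<open>H2 \<beta>\<close>, for arguments in
  \<open>H2 \<beta>\<close>.\<close>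

definition H2_adjoint ::
    "(nat \<Rightarrow> real) \<Rightarrow> ('x::complex_inner \<Rightarrow> nat \<Rightarrow> 'y::complex_inner) \<Rightarrow> (nat \<Rightarrow> 'y) \<Rightarrow> 'x"
  where "H2_adjoint \<beta> A f = (THE x'. \<forall>x. H2_cinner \<beta> (A x) f = cinner x x')"

definition mult_op ::
    "(nat \<Rightarrow> real) \<Rightarrow> (complex \<Rightarrow> 'u::complex_inner \<Rightarrow> 'y::complex_inner) \<Rightarrow> (nat \<Rightarrow> 'u) \<Rightarrow> nat \<Rightarrow> 'y"
  where "mult_op \<beta> S f = (THE g. g \<in> H2 \<beta> \<and> (\<forall>z\<in>\<bbbD>. ps_eval g z = S z (ps_eval f z)))"

definition schur_multipliers ::
    "(nat \<Rightarrow> real) \<Rightarrow> (complex \<Rightarrow> 'u::complex_inner \<Rightarrow> 'y::complex_inner) set"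
  where "schur_multipliers \<beta> = {S. (\<forall>z\<in>\<bbbD>. bounded_clinear (S z)) \<and>
    (\<forall>f\<in>H2 one_weight. \<exists>g\<in>H2 \<beta>. (\<forall>z\<in>\<bbbD>. ps_eval g z = S z (ps_eval f z)) \<and>
      H2_norm \<beta> g \<le> H2_norm one_weight f)}"


section \<open>Observability operators\<close>

definition obs ::
    "(nat \<Rightarrow> real) \<Rightarrow> ('x::complex_inner \<Rightarrow> 'y::complex_inner) \<Rightarrow> ('x \<Rightarrow> 'x) \<Rightarrow> 'x \<Rightarrow> nat \<Rightarrow> 'y"
  where "obs \<beta> E T x = (\<lambda>j. inverse (\<beta> j) *\<^sub>R E ((T ^^ j) x))"

definition output_stable ::
    "(nat \<Rightarrow> real) \<Rightarrow> ('x::complex_inner \<Rightarrow> 'y::complex_inner) \<Rightarrow> ('x \<Rightarrow> 'x) \<Rightarrow> bool"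
  where "output_stable \<beta> E T \<longleftrightarrow> (\<forall>x. obs \<beta> E T x \<in> H2 \<beta>) \<and>
    (\<exists>c. \<forall>x. H2_norm \<beta> (obs \<beta> E T x) \<le> c * norm x)"

definition gramian ::
    "(nat \<Rightarrow> real) \<Rightarrow> ('x::complex_inner \<Rightarrow> 'y::complex_inner) \<Rightarrow> ('x \<Rightarrow> 'x) \<Rightarrow> 'x \<Rightarrow> 'x"
  where "gramian \<beta> E T x = H2_adjoint \<beta> (obs \<beta> E T) (obs \<beta> E T x)"

text \<open>\<open>gamma_inv \<beta> j\<close> is the number \<open>\<gamma>\<^sub>j\<close> to the power \<open>-1\<close>; it may vanish, in which case
  \<open>\<gamma>\<^sub>j\<close> itself is infinite.\<close>

definition gamma_inv :: "(nat \<Rightarrow> real) \<Rightarrow> nat \<Rightarrow> real"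
  where "gamma_inv \<beta> j = (if j = 0 then 1 else inverse (\<beta> j) - inverse (\<beta> (j - 1)))"

definition Psi :: "(nat \<Rightarrow> real) \<Rightarrow> complex \<Rightarrow> 'y::complex_inner ell2 \<Rightarrow> 'y"
  where "Psi \<beta> z y = (\<Sum>j. (complex_of_real (sqrt (gamma_inv \<beta> j)) * z ^ j) *\<^sub>C ell2_nth y j)"

definition obs_tilde ::
    "(nat \<Rightarrow> real) \<Rightarrow> ('x::complex_inner \<Rightarrow> 'y::complex_inner) \<Rightarrow> ('x \<Rightarrow> 'x) \<Rightarrow> 'x \<Rightarrow> 'y ell2"
  where "obs_tilde \<beta> E T x = Abs_ell2 (\<lambda>j. sqrt (gamma_inv \<beta> j) *\<^sub>R E ((T ^^ j) x))"


section \<open>Block operators\<close>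

definition block_op ::
    "('a \<Rightarrow> 'c) \<Rightarrow> ('b \<Rightarrow> 'c) \<Rightarrow> ('a \<Rightarrow> 'd) \<Rightarrow> ('b \<Rightarrow> 'd) \<Rightarrow> 'a \<times> 'b \<Rightarrow> 'c::plus \<times> 'd::plus"
  where "block_op A B C D = (\<lambda>(a, b). (A a + B b, C a + D b))"

definition col_op :: "('x \<Rightarrow> 'a) \<Rightarrow> ('x \<Rightarrow> 'b) \<Rightarrow> 'x \<Rightarrow> 'a \<times> 'b"
  where "col_op A B = (\<lambda>x. (A x, B x))"

definition row_op :: "('a \<Rightarrow> 'x) \<Rightarrow> ('b \<Rightarrow> 'x) \<Rightarrow> 'a \<times> 'b \<Rightarrow> 'x::plus"
  where "row_op A B = (\<lambda>(a, b). A a + B b)"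

definition signature_op :: "'a \<times> 'b \<Rightarrow> 'a \<times> 'b::uminus"
  where "signature_op = (\<lambda>(a, b). (a, - b))"

end

theory Submission
  imports Defs "HOL-Complex_Analysis.Cauchy_Integral_Formula"
begin

text \<open>
  Write \<open>U = \<Psi> A - S C\<close> and \<open>V = S D - \<Psi> B\<close>, so that the formula for \<open>S\<close> is \<open>V = U \<E>\<close>. The identity
  for \<open>\<Theta>\<close> says that \<open>(U(z) U(\<zeta>)\<^sup>* - V(z) V(\<zeta>)\<^sup>*) / (1 - z cnj \<zeta>)\<close> is the kernel \<open>K\<close> of
  \<open>I - M\<^sub>S M\<^sub>S\<^sup>* - F P\<^sup>-\<^sup>1 F\<^sup>*\<close>, where \<open>F\<^sup>* = O\<^sub>\<beta>\<^sup>* - O\<^sub>1\<^sup>* M\<^sub>S\<^sup>*\<close>, \<open>O\<^sub>\<beta>\<close> is the observability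
  operator of \<open>(E, T)\<close> and \<open>O\<^sub>1\<close> that of \<open>(N, T)\<close>. The interpolation condition is equivalent to
  \<open>M\<^sub>S\<^sup>* O\<^sub>\<beta> = O\<^sub>1\<close>. If it holds, then \<open>K\<close> is positive and, as in Leech's theorem, \<open>V = U \<E>\<close> with
  \<open>\<E>\<close> the transfer function of a contraction extending a lurking isometry. Conversely a Schur function
  \<open>\<E>\<close> with \<open>V = U \<E>\<close> makes \<open>K\<close> positive, since multiplication by \<open>\<E>\<close> is a contraction between
  Hardy spaces; positivity of \<open>K\<close> yields the contraction \<open>M\<^sub>S\<^sup>*\<close>, and, tested on the range of
  \<open>O\<^sub>\<beta>\<close>, it forces \<open>M\<^sub>S\<^sup>* O\<^sub>\<beta> = O\<^sub>1\<close>.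
\<close>

section \<open>Complex Hilbert spaces\<close>

text \<open>Two obstacles shape the proof. The hypothesis on \<open>\<Theta>\<close> is an identity
  of kernels and does not speak of continuity in \<open>z\<close>; regularity is recovered from
  transfer functions of contractions, which are analytic in operator norm. Moreover, at
  \<open>z = \<zeta>\<close> the lower right corner says that \<open>D D^*\<close> is
  \<open>I + C C^*\<close> plus a positive operator, hence only that \<open>D(z)\<close> is onto.
  Injectivity at one point, which follows from surjectivity in finite dimension, is carried over the
  disk by connectedness; then \<open>D^(-1) C\<close> is a strict contraction and
  \<open>C \<E> + D\<close> is invertible for every parameter. The weight enters through one
  telescoping: since \<open>gamma_inv\<close> is the difference of consecutive reciprocals of
  \<open>\<beta>\<close>, the weighted kernel times \<open>1 - z cnj \<zeta>\<close> becomes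
  \<open>\<Psi>(z) \<Psi>(\<zeta>)^*\<close>, and the observability function of
  \<open>(I - z T) x\<close> at \<open>z\<close> becomes \<open>\<Psi>(z)\<close> applied to
  \<open>obs_tilde\<close>.\<close>

instance complex_hilbert \<subseteq> banach ..

lemma cinner_add_right: "cinner x (y + z) = cinner x y + cinner x z"
  by (metis cinner_add_left cinner_commute complex_cnj_add)

lemma cinner_scaleC_right: "cinner x (c *\<^sub>C y) = cnj c * cinner x y"
  by (metis cinner_commute cinner_scaleC_left complex_cnj_mult)

lemma norm_cinner_le: "cmod (cinner x y) \<le> norm x * norm y"
proof (cases "cinner x y = 0")
  case False
  \<comment> \<open>\<open>c\<close> is the unimodular factor turning \<open>cinner x y\<close> into
    its modulus, so the real Cauchy-Schwarz inequality applies.\<close>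
  define c where "c = cnj (cinner x y) / cmod (cinner x y)"
  have c: "cmod c = 1" using False by (simp add: c_def norm_divide)
  have "c * cinner x y = cmod (cinner x y)"
    using False complex_norm_square[of "cinner x y"]
    by (simp add: c_def power2_eq_square mult.commute nonzero_divide_eq_eq)
  then have "cmod (cinner x y) = inner (c *\<^sub>C x) y"
    by (simp add: inner_eq_Re_cinner cinner_scaleC_left)
  also have "\<dots> \<le> norm (c *\<^sub>C x) * norm y" by (rule norm_cauchy_schwarz)
  finally show ?thesis by (simp add: norm_scaleC c)
qed simp

interpretation cinner: bounded_bilinear cinner
proof (rule bounded_bilinear.intro)
  show "\<exists>K. \<forall>a b. norm (cinner a b) \<le> norm a * norm b * K"
    by (rule exI[of _ 1]) (simp add: norm_cinner_le)
qed (simp_all add: cinner_add_left cinner_add_right scaleR_scaleC cinner_scaleC_left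
      cinner_scaleC_right scaleC_complex_def)

interpretation scaleC: bounded_bilinear scaleC
proof (rule bounded_bilinear.intro)
  show "\<exists>K. \<forall>a b. norm (scaleC a b) \<le> norm a * norm b * K"
    by (rule exI[of _ 1]) (simp add: norm_scaleC)
qed (simp_all add: scaleC_add_left scaleC_add_right scaleR_scaleC scaleC_scaleC mult.commute
    scaleC_complex_def)

declare cinner.zero_left [simp] cinner.zero_right [simp]
  scaleC.zero_left [simp] scaleC.zero_right [simp]

lemma scaleC_one [simp]: "1 *\<^sub>C x = x"
  using scaleR_scaleC[of 1 x] by simp

lemma scaleC_minus_one [simp]: "(- 1) *\<^sub>C x = - x"
  using scaleC.minus_left[of 1 x] by simp

lemma cinner_ext: "(\<And>y. cinner x y = cinner x' y) \<Longrightarrow> x = x'"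
  by (metis cinner.diff_left cinner_self_eq norm_eq_zero of_real_eq_0_iff power_eq_0_iff
      right_minus_eq)

lemma cinner_ext_right: "(\<And>y. cinner y x = cinner y x') \<Longrightarrow> x = x'"
  by (metis cinner_commute cinner_ext)

section \<open>Algebra of bounded operators\<close>

lemma bounded_clinear_imp_bounded_linear: "bounded_clinear A \<Longrightarrow> bounded_linear A"
  by (simp add: bounded_clinear_def)

lemma bounded_clinear_scaleC: "bounded_clinear A \<Longrightarrow> A (c *\<^sub>C x) = c *\<^sub>C A x"
  by (simp add: bounded_clinear_def)

lemma bounded_clinear_add: "bounded_clinear A \<Longrightarrow> A (x + y) = A x + A y"
  by (simp add: bounded_clinear_def linear_simps)

lemma bounded_clinear_diff: "bounded_clinear A \<Longrightarrow> A (x - y) = A x - A y"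
  by (simp add: bounded_clinear_def linear_simps)

lemma bounded_clinear_minus: "bounded_clinear A \<Longrightarrow> A (- x) = - A x"
  by (simp add: bounded_clinear_def linear_simps)

lemma bounded_clinear_zero: "bounded_clinear A \<Longrightarrow> A 0 = 0"
  by (simp add: bounded_clinear_def linear_simps)

lemma bounded_clinear_sum: "bounded_clinear A \<Longrightarrow> A (sum f I) = (\<Sum>i\<in>I. A (f i))"
  using linear_sum bounded_clinear_imp_bounded_linear bounded_linear.linear by blast

lemmas bounded_clinear_simps = bounded_clinear_scaleC bounded_clinear_add bounded_clinear_diff
  bounded_clinear_minus bounded_clinear_zero bounded_clinear_sum

lemma bounded_clinearI:
  assumes "\<And>x y. A (x + y) = A x + A y" "\<And>c x. A (c *\<^sub>C x) = c *\<^sub>C A x"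
    "\<And>x. norm (A x) \<le> K * norm x"
  shows "bounded_clinear A"
  unfolding bounded_clinear_def
proof (intro conjI allI)
  show "bounded_linear A"
    by (rule bounded_linear_intro[of A K])
      (simp_all add: assms scaleR_scaleC mult.commute[of _ K])
qed (rule assms)

lemma bounded_clinear_bound:
  assumes "bounded_clinear A" obtains K where "K > 0" "\<And>x. norm (A x) \<le> K * norm x"
  using bounded_linear.pos_bounded[OF bounded_clinear_imp_bounded_linear[OF assms]]
  by (metis mult.commute)

lemma bounded_clinear_compose:
  "bounded_clinear A \<Longrightarrow> bounded_clinear B \<Longrightarrow> bounded_clinear (\<lambda>x. A (B x))"
  unfolding bounded_clinear_def using bounded_linear_compose by auto

lemma bounded_clinear_plus:
  "bounded_clinear A \<Longrightarrow> bounded_clinear B \<Longrightarrow> bounded_clinear (\<lambda>x. A x + B x)"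
  unfolding bounded_clinear_def by (auto simp: bounded_linear_add scaleC_add_right)

lemma bounded_clinear_minus_fun:
  "bounded_clinear A \<Longrightarrow> bounded_clinear B \<Longrightarrow> bounded_clinear (\<lambda>x. A x - B x)"
  unfolding bounded_clinear_def by (auto simp: bounded_linear_sub scaleC.diff_right)

lemma bounded_clinear_scale_fun:
  "bounded_clinear A \<Longrightarrow> bounded_clinear (\<lambda>x. c *\<^sub>C A x)"
  unfolding bounded_clinear_def
  using bounded_linear_compose[OF scaleC.bounded_linear_right]
  by (auto simp: scaleC_scaleC mult.commute)

lemma bounded_clinear_ident: "bounded_clinear (\<lambda>x. x)"
  unfolding bounded_clinear_def by simp

lemma bounded_clinear_fst: "bounded_clinear fst"
  unfolding bounded_clinear_def by (simp add: bounded_linear_fst scaleC_prod_def)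

lemma bounded_clinear_snd: "bounded_clinear snd"
  unfolding bounded_clinear_def by (simp add: bounded_linear_snd scaleC_prod_def)

lemma bounded_clinear_Pair:
  "bounded_clinear A \<Longrightarrow> bounded_clinear B \<Longrightarrow> bounded_clinear (\<lambda>x. (A x, B x))"
  unfolding bounded_clinear_def by (simp add: bounded_linear_Pair scaleC_prod_def)

lemma bounded_clinear_zero_fun: "bounded_clinear (\<lambda>x. 0)"
  unfolding bounded_clinear_def by (simp add: scaleC.zero_right)

lemmas bounded_clinear_intros = bounded_clinear_plus
  bounded_clinear_minus_fun bounded_clinear_scale_fun bounded_clinear_ident
  bounded_clinear_zero_fun bounded_clinear_Pair
  bounded_clinear_compose[OF bounded_clinear_fst] bounded_clinear_compose[OF bounded_clinear_snd]

lemma boundedly_invertible_inv: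
  assumes "boundedly_invertible K"
  shows "bounded_clinear (inv K)" "inv K (K u) = u" "K (inv K v) = v"
proof -
  obtain L where L: "bounded_clinear L" "K \<circ> L = id" "L \<circ> K = id"
    using assms by (auto simp: boundedly_invertible_def)
  have KL: "K (L v) = v" "L (K u) = u" for u v using L by (metis comp_apply id_apply)+
  then have "inv K = L" by (intro inv_equality) auto
  then show "bounded_clinear (inv K)" "inv K (K u) = u" "K (inv K v) = v" using L(1) KL by auto
qed

section \<open>Closed subspaces and orthogonal projections\<close>

definition csubspace :: "'a::complex_inner set \<Rightarrow> bool"
  where "csubspace M \<longleftrightarrow> 0 \<in> M \<and> (\<forall>x\<in>M. \<forall>y\<in>M. x + y \<in> M) \<and> (\<forall>c. \<forall>x\<in>M. c *\<^sub>C x \<in> M)"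

lemma csubspace_diff: "csubspace M \<Longrightarrow> x \<in> M \<Longrightarrow> y \<in> M \<Longrightarrow> x - y \<in> M"
  unfolding csubspace_def by (metis diff_conv_add_uminus scaleC_minus_one)

lemma csubspace_closure:
  assumes "csubspace M" shows "csubspace (closure M)"
  unfolding csubspace_def
proof (intro conjI ballI allI)
  show "0 \<in> closure M" using assms closure_subset unfolding csubspace_def by blast
next
  fix x y assume "x \<in> closure M" "y \<in> closure M"
  then obtain f g where "\<forall>n. f n \<in> M" "f \<longlonglongrightarrow> x" "\<forall>n. g n \<in> M" "g \<longlonglongrightarrow> y"
    unfolding closure_sequential by auto
  then have "\<forall>n. f n + g n \<in> M" "(\<lambda>n. f n + g n) \<longlonglongrightarrow> x + y"
    using assms unfolding csubspace_def by (auto intro: tendsto_add)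
  then show "x + y \<in> closure M" unfolding closure_sequential
    by (intro exI[of _ "\<lambda>n. f n + g n"]) auto
next
  fix c x assume "x \<in> closure M"
  then obtain f where "\<forall>n. f n \<in> M" "f \<longlonglongrightarrow> x"
    unfolding closure_sequential by auto
  then have "\<forall>n. c *\<^sub>C f n \<in> M" "(\<lambda>n. c *\<^sub>C f n) \<longlonglongrightarrow> c *\<^sub>C x"
    using assms unfolding csubspace_def by (auto intro: scaleC.tendsto tendsto_const)
  then show "c *\<^sub>C x \<in> closure M" unfolding closure_sequential
    by (intro exI[of _ "\<lambda>n. c *\<^sub>C f n"]) auto
qed

text \<open>\<open>m\<close> is the point of \<open>M\<close> nearest to \<open>x\<close>, the limit
  of a minimising sequence; perturbing it along \<open>M\<close> gives orthogonality.\<close>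

lemma orthogonal_decomposition:
  fixes M :: "'a::complex_hilbert set"
  assumes M: "csubspace M" "closed M"
  obtains m where "m \<in> M" "\<And>v. v \<in> M \<Longrightarrow> cinner (x - m) v = 0"
proof -
  have M0: "0 \<in> M" and Madd: "\<And>x y. x \<in> M \<Longrightarrow> y \<in> M \<Longrightarrow> x + y \<in> M"
    and Msc: "\<And>c x. x \<in> M \<Longrightarrow> c *\<^sub>C x \<in> M"
    using M unfolding csubspace_def by auto
  define d where "d = infdist x M"
  have d0: "0 \<le> d" by (simp add: d_def infdist_nonneg)
  have d_le: "d \<le> norm (x - v)" if "v \<in> M" for v
    using infdist_le[OF that, of x] by (simp add: d_def dist_norm)
  have "\<exists>m\<in>M. norm (x - m) < d + 1 / Suc n" for n
  proof -
    have "\<exists>m\<in>M. dist x m < d + 1 / Suc n"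
    proof (rule ccontr)
      assume "\<not> (\<exists>m\<in>M. dist x m < d + 1 / Suc n)"
      then have "d + 1 / Suc n \<le> (INF m\<in>M. dist x m)"
        using M0 by (intro cINF_greatest) (auto simp: not_less)
      moreover have "(INF m\<in>M. dist x m) = d" using M0 by (auto simp: d_def infdist_def)
      ultimately show False by simp
    qed
    then show ?thesis by (simp add: dist_norm)
  qed
  then obtain m where m: "\<And>n. m n \<in> M" "\<And>n. norm (x - m n) < d + 1 / Suc n" by metis
  \<comment> \<open>Parallelogram law for \<open>x - a\<close> and \<open>x - b\<close>: the
    midpoint of \<open>a\<close> and \<open>b\<close> lies in \<open>M\<close>, so the sum has norm
    at least \<open>2 * d\<close>.\<close>
  have key: "(norm (a - b))\<^sup>2 \<le> 2 * (norm (x - a))\<^sup>2 + 2 * (norm (x - b))\<^sup>2 - 4 * d\<^sup>2"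
    if "a \<in> M" "b \<in> M" for a b
  proof -
    have h: "(1/2) *\<^sub>C (a + b) \<in> M" using that Madd Msc by blast
    have "complex_of_real (1/2) *\<^sub>C (a + b) = (1/2) *\<^sub>R (a + b)"
      by (rule scaleR_scaleC[symmetric])
    then have "d \<le> norm (x - (1/2) *\<^sub>R (a + b))" using d_le[OF h] by simp
    moreover have "(x - a) + (x - b) = 2 *\<^sub>R (x - (1/2) *\<^sub>R (a + b))"
      by (simp add: algebra_simps scaleR_2)
    ultimately have "2 * d \<le> norm ((x - a) + (x - b))" by simp
    then have "(2 * d)\<^sup>2 \<le> (norm ((x - a) + (x - b)))\<^sup>2" using d0 by (intro power_mono) auto
    moreover have "(norm ((x - a) + (x - b)))\<^sup>2 + (norm ((x - a) - (x - b)))\<^sup>2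
        = 2 * (norm (x - a))\<^sup>2 + 2 * (norm (x - b))\<^sup>2"
      by (simp only: power2_norm_eq_inner inner_diff inner_add inner_commute) (simp add: algebra_simps inner_commute)
    ultimately show ?thesis by (simp add: norm_minus_commute power_mult_distrib)
  qed
  have lim: "(\<lambda>n. d + 1 / Suc n) \<longlonglongrightarrow> d"
    using tendsto_add[OF tendsto_const[of d] LIMSEQ_inverse_real_of_nat] by (simp add: field_simps)
  have lim2: "(\<lambda>n. 4 * (d + 1 / Suc n)\<^sup>2 - 4 * d\<^sup>2) \<longlonglongrightarrow> 0"
    using tendsto_diff[OF tendsto_mult[OF tendsto_const[of 4] tendsto_power[OF lim, of 2]] tendsto_const[of "4 * d\<^sup>2"]]
    by simp
  have "Cauchy m"
  proof (rule metric_CauchyI)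
    fix e :: real assume "e > 0"
    then have "\<forall>\<^sub>F n in sequentially. 4 * (d + 1 / Suc n)\<^sup>2 - 4 * d\<^sup>2 < e\<^sup>2"
      using order_tendstoD(2)[OF lim2, of "e\<^sup>2"] by simp
    then obtain K where K: "4 * (d + 1 / Suc K)\<^sup>2 - 4 * d\<^sup>2 < e\<^sup>2"
      unfolding eventually_sequentially by auto
    have *: "(norm (x - m n))\<^sup>2 \<le> (d + 1 / Suc K)\<^sup>2" if "n \<ge> K" for n
    proof (intro power_mono order_trans[OF less_imp_le[OF m(2)]])
      show "d + 1 / Suc n \<le> d + 1 / Suc K" using that by (simp add: frac_le)
    qed simp
    have "dist (m i) (m j) < e" if "i \<ge> K" "j \<ge> K" for i j
    proof -
      have "(norm (m i - m j))\<^sup>2 < e\<^sup>2"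
        using key[OF m(1) m(1), of i j] *[OF that(1)] *[OF that(2)] K by linarith
      then show ?thesis using \<open>e > 0\<close> by (simp add: dist_norm power_less_imp_less_base)
    qed
    then show "\<exists>M. \<forall>i\<ge>M. \<forall>j\<ge>M. dist (m i) (m j) < e" by blast
  qed
  then obtain l where l: "m \<longlonglongrightarrow> l" using Cauchy_convergent unfolding convergent_def by blast
  have lM: "l \<in> M" using closed_sequentially[OF M(2) _ l] m(1) by blast
  have "norm (x - l) \<le> d"
    by (rule LIMSEQ_le[OF tendsto_norm[OF tendsto_diff[OF tendsto_const l]] lim])
      (use m(2) less_imp_le in blast)
  then have nl: "norm (x - l) = d" using d_le[OF lM] by simp
  have re: "inner (x - l) v = 0" if v: "v \<in> M" for v
  proof (rule ccontr)
    assume ne: "inner (x - l) v \<noteq> 0"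
    then have v0: "v \<noteq> 0" by auto
    \<comment> \<open>The value of \<open>t\<close> that minimises the distance from
      \<open>x\<close> to \<open>l + t *\<^sub>R v\<close>.\<close>
    define t where "t = inner (x - l) v / inner v v"
    have "l + complex_of_real t *\<^sub>C v \<in> M" using lM v Madd Msc by blast
    then have "d \<le> norm (x - (l + t *\<^sub>R v))" using d_le by (simp add: scaleR_scaleC)
    then have "(norm (x - l))\<^sup>2 \<le> (norm ((x - l) - t *\<^sub>R v))\<^sup>2"
      using d0 nl by (simp add: algebra_simps)
    also have "\<dots> = (norm (x - l))\<^sup>2 - 2 * t * inner (x - l) v + t\<^sup>2 * inner v v"
      unfolding power2_norm_eq_inner
      by (simp add: inner_diff_left inner_diff_right inner_commute algebra_simps power2_eq_square)
    also have "\<dots> = (norm (x - l))\<^sup>2 - (inner (x - l) v)\<^sup>2 / inner v v"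
      using v0 by (simp add: t_def power2_eq_square field_simps)
    finally have "(inner (x - l) v)\<^sup>2 / inner v v \<le> 0" by simp
    moreover have "(inner (x - l) v)\<^sup>2 / inner v v > 0" using ne v0 by simp
    ultimately show False by simp
  qed
  \<comment> \<open>Real orthogonality to both \<open>v\<close> and \<open>\<i> *\<^sub>C v\<close>
    kills the real and the imaginary part.\<close>
  have "cinner (x - l) v = 0" if v: "v \<in> M" for v
  proof -
    have "Re (cinner (x - l) v) = 0" using re[OF v] by (simp add: inner_eq_Re_cinner)
    moreover have "Re (cinner (x - l) (\<i> *\<^sub>C v)) = 0"
      using re[OF Msc[OF v]] by (simp add: inner_eq_Re_cinner)
    ultimately show ?thesis by (simp add: cinner_scaleC_right complex_eq_iff)
  qed
  then show ?thesis using lM that by blast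
qed

lemma orthogonal_projection:
  fixes M :: "'a::complex_hilbert set"
  assumes M: "csubspace M" "closed M"
  obtains p where "bounded_clinear p" "\<And>x. norm (p x) \<le> norm x" "\<And>x. p x \<in> M"
    "\<And>x. x \<in> M \<Longrightarrow> p x = x"
proof -
  have "\<forall>x. \<exists>m. m \<in> M \<and> (\<forall>v\<in>M. cinner (x - m) v = 0)"
    using orthogonal_decomposition[OF M] by metis
  then obtain p where p: "\<And>x. p x \<in> M" "\<And>x v. v \<in> M \<Longrightarrow> cinner (x - p x) v = 0" by metis
  have uniq: "p x = m" if "m \<in> M" "\<And>v. v \<in> M \<Longrightarrow> cinner (x - m) v = 0" for x m
  proof -
    have "cinner (p x - m) (p x - m) = cinner (x - m) (p x - m) - cinner (x - p x) (p x - m)"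
      by (simp add: cinner.diff_left)
    also have "\<dots> = 0" using that p csubspace_diff[OF M(1)] by simp
    finally show ?thesis by (simp add: cinner_self_eq)
  qed
  have nrm: "norm (p x) \<le> norm x" for x
  proof -
    have "inner (x - p x) (p x) = 0" using p by (simp add: inner_eq_Re_cinner)
    then have "(norm x)\<^sup>2 = (norm (p x))\<^sup>2 + (norm (x - p x))\<^sup>2"
      unfolding power2_norm_eq_inner by (simp add: inner_diff_left inner_diff_right inner_commute)
    then have "(norm (p x))\<^sup>2 \<le> (norm x)\<^sup>2" by simp
    then show ?thesis by (rule power2_le_imp_le) simp
  qed
  have "bounded_clinear p"
  proof (rule bounded_clinearI[of _ 1])
    show "p (x + y) = p x + p y" for x y
    proof (rule uniq)
      show "p x + p y \<in> M" using p(1) M(1) by (simp add: csubspace_def)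
      have "x + y - (p x + p y) = (x - p x) + (y - p y)" by simp
      then show "cinner (x + y - (p x + p y)) v = 0" if "v \<in> M" for v
        using p(2)[OF that] by (simp only: cinner.add_left add_0)
    qed
    show "p (c *\<^sub>C x) = c *\<^sub>C p x" for c x
    proof (rule uniq)
      show "c *\<^sub>C p x \<in> M" using p(1) M(1) by (simp add: csubspace_def)
      show "cinner (c *\<^sub>C x - c *\<^sub>C p x) v = 0" if "v \<in> M" for v
        using p(2)[OF that] by (simp add: scaleC.diff_right[symmetric] cinner_scaleC_left)
    qed
  qed (simp add: nrm)
  moreover have "p x = x" if "x \<in> M" for x using that by (intro uniq) auto
  ultimately show ?thesis using that[of p] nrm p(1) by blast
qed

lemma closure_eq_UNIV_if_orthogonal_zero:
  fixes M :: "'a::complex_hilbert set"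
  assumes "csubspace M" "\<And>x. (\<And>v. v \<in> M \<Longrightarrow> cinner x v = 0) \<Longrightarrow> x = 0"
  shows "closure M = UNIV"
proof -
  have "x \<in> closure M" for x
  proof -
    obtain m where m: "m \<in> closure M" "\<And>v. v \<in> closure M \<Longrightarrow> cinner (x - m) v = 0"
      using orthogonal_decomposition[OF csubspace_closure[OF assms(1)] closed_closure, of x] by blast
    have "x - m = 0" using assms(2) m(2) closure_subset by (metis subsetD)
    then show ?thesis using m(1) by simp
  qed
  then show ?thesis by auto
qed

section \<open>Riesz representation and adjoints\<close>

theorem riesz_representation:
  fixes f :: "'a::complex_hilbert \<Rightarrow> complex"
  assumes f: "bounded_clinear f"
  shows "\<exists>y. \<forall>x. f x = cinner x y"
proof (cases "\<forall>x. f x = 0")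
  case True then show ?thesis by (intro exI[of _ 0]) (simp add: cinner.zero_right)
next
  case False
  then obtain a where a: "f a \<noteq> 0" by blast
  define M where "M = {x. f x = 0}"
  have M: "csubspace M" "closed M"
    using f continuous_closed_preimage_constant[OF linear_continuous_on[OF bounded_clinear_imp_bounded_linear[OF f], of UNIV] closed_UNIV, of 0]
    by (auto simp: M_def csubspace_def bounded_clinear_simps scaleC_complex_def)
  obtain m where m: "m \<in> M" "\<And>v. v \<in> M \<Longrightarrow> cinner (a - m) v = 0"
    using orthogonal_decomposition[OF M, of a] by blast
  \<comment> \<open>\<open>b\<close> spans the orthogonal complement of the kernel \<open>M\<close>:
    each \<open>f b *\<^sub>C x - f x *\<^sub>C b\<close> lies in \<open>M\<close> and so is
    orthogonal to \<open>b\<close>.\<close>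
  define b where "b = a - m"
  have fb: "f b \<noteq> 0" using a m(1) f by (simp add: b_def M_def bounded_clinear_simps)
  then have b0: "b \<noteq> 0" using f bounded_clinear_zero by blast
  have "f x = cinner x ((cnj (f b) / cinner b b) *\<^sub>C b)" for x
  proof -
    have "f b *\<^sub>C x - f x *\<^sub>C b \<in> M" using f
      by (simp add: M_def bounded_clinear_simps scaleC_complex_def)
    then have "cinner (f b *\<^sub>C x - f x *\<^sub>C b) b = 0"
      using m(2) unfolding b_def[symmetric] by (metis cinner_commute complex_cnj_zero)
    then have "f b * cinner x b = f x * cinner b b"
      by (simp add: cinner.diff_left cinner_scaleC_left)
    moreover have "cnj (cinner b b) = cinner b b" by (simp add: cinner_commute[of b b, symmetric])
    ultimately show ?thesis using b0
      by (simp add: cinner_scaleC_right cinner_self_eq field_simps)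
  qed
  then show ?thesis by blast
qed

lemma cinner_cadjoint:
  fixes A :: "'a::complex_hilbert \<Rightarrow> 'b::complex_inner"
  assumes A: "bounded_clinear A"
  shows "cinner (A x) y = cinner x (cadjoint A y)"
proof -
  have "bounded_clinear (\<lambda>x. cinner (A x) y)" for y
    using bounded_linear_compose[OF cinner.bounded_linear_left bounded_clinear_imp_bounded_linear[OF A]] A
    by (auto simp: bounded_clinear_def cinner_scaleC_left scaleC_complex_def)
  then have "\<forall>y. \<exists>b. \<forall>x. cinner (A x) y = cinner x b"
    using riesz_representation by blast
  then obtain B where B: "\<forall>x y. cinner (A x) y = cinner x (B y)" by metis
  have "\<exists>!B. \<forall>x y. cinner (A x) y = cinner x (B y)"
    using B by (metis cinner_ext_right ext)
  from theI'[OF this] show ?thesis unfolding cadjoint_def by blast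
qed

lemma cinner_cadjoint_left:
  fixes A :: "'a::complex_hilbert \<Rightarrow> 'b::complex_inner"
  assumes A: "bounded_clinear A"
  shows "cinner (cadjoint A y) x = cinner y (A x)"
  by (metis cinner_cadjoint[OF A] cinner_commute)

lemma cadjoint_eqI:
  fixes A :: "'a::complex_hilbert \<Rightarrow> 'b::complex_inner"
  assumes A: "bounded_clinear A" and "\<And>x. cinner (A x) y = cinner x b"
  shows "cadjoint A y = b"
  using assms cinner_cadjoint[OF A] by (metis cinner_ext_right)

lemma norm_cadjoint_le:
  fixes A :: "'a::complex_hilbert \<Rightarrow> 'b::complex_inner"
  assumes A: "bounded_clinear A" and "0 \<le> K" and K: "\<And>x. norm (A x) \<le> K * norm x"
  shows "norm (cadjoint A y) \<le> K * norm y"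
proof -
  have "(norm (cadjoint A y))\<^sup>2 = cmod (cinner (A (cadjoint A y)) y)"
    by (simp add: cinner_cadjoint[OF A] cinner_self_eq norm_power)
  also have "\<dots> \<le> norm (A (cadjoint A y)) * norm y" by (rule norm_cinner_le)
  also have "\<dots> \<le> (K * norm (cadjoint A y)) * norm y" by (intro mult_right_mono K) auto
  finally have "norm (cadjoint A y) * norm (cadjoint A y) \<le> norm (cadjoint A y) * (K * norm y)"
    by (simp add: power2_eq_square mult_ac)
  then show ?thesis using assms(2)
    by (metis mult_le_cancel_left_pos norm_ge_zero order_le_less zero_le_mult_iff)
qed

lemma bounded_clinear_cadjoint:
  fixes A :: "'a::complex_hilbert \<Rightarrow> 'b::complex_inner"
  assumes A: "bounded_clinear A"
  shows "bounded_clinear (cadjoint A)"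
proof -
  obtain K where K: "K > 0" "\<And>x. norm (A x) \<le> K * norm x"
    using bounded_clinear_bound[OF A] by blast
  show ?thesis
  proof (rule bounded_clinearI[of _ K])
    show "norm (cadjoint A y) \<le> K * norm y" for y
      using norm_cadjoint_le[OF A _ K(2)] K(1) by simp
  qed (auto intro!: cadjoint_eqI[OF A]
      simp: cinner.add_right cinner_scaleC_right cinner_cadjoint[OF A])
qed

text \<open>No isometry is needed: a closed contractive graph has a closed domain, so the contraction
  it defines extends by zero on the orthogonal complement.\<close>

lemma contraction_extension:
  fixes V :: "('a::complex_hilbert \<times> 'b::complex_hilbert) set"
  assumes V: "csubspace V" and le: "\<And>v. v \<in> V \<Longrightarrow> norm (snd v) \<le> norm (fst v)"
  obtains W where "bounded_clinear W" "\<And>x. norm (W x) \<le> norm x" "\<And>v. v \<in> V \<Longrightarrow> W (fst v) = snd v"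
proof -
  define L where "L = closure V"
  have L: "csubspace L" "closed L" "V \<subseteq> L"
    by (auto simp: L_def csubspace_closure[OF V] closure_subset[THEN subsetD])
  have leL: "norm (snd v) \<le> norm (fst v)" if "v \<in> L" for v
  proof -
    obtain f where "\<forall>n. f n \<in> V" "f \<longlonglongrightarrow> v" using \<open>v \<in> L\<close> unfolding L_def closure_sequential by auto
    then show ?thesis using le
      by (intro LIMSEQ_le[OF tendsto_norm[OF tendsto_snd] tendsto_norm[OF tendsto_fst]]) auto
  qed
  have csM: "csubspace (fst ` L)"
    unfolding csubspace_def
  proof (intro conjI ballI allI)
    show "0 \<in> fst ` L" using L(1) by (auto simp: csubspace_def image_iff intro!: bexI[of _ 0])
  next
    fix x y assume "x \<in> fst ` L" "y \<in> fst ` L"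
    then obtain v w where "v \<in> L" "w \<in> L" "x = fst v" "y = fst w" by blast
    then show "x + y \<in> fst ` L" using L(1) by (auto simp: csubspace_def image_iff intro!: bexI[of _ "v + w"])
  next
    fix c x assume "x \<in> fst ` L"
    then obtain v where "v \<in> L" "x = fst v" by blast
    then show "c *\<^sub>C x \<in> fst ` L" using L(1)
      by (auto simp: csubspace_def image_iff scaleC_prod_def intro!: bexI[of _ "c *\<^sub>C v"])
  qed
  have clM: "closed (fst ` L)"
    unfolding closed_sequential_limits
  proof (intro allI impI, elim conjE)
    fix x l assume x: "\<forall>n. x n \<in> fst ` L" and lim: "x \<longlonglongrightarrow> l"
    then obtain v where v: "\<And>n. v n \<in> L" "\<And>n. x n = fst (v n)"
      unfolding image_iff by metis
    \<comment> \<open>Contractivity on differences makes the second components converge along with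
      the first.\<close>
    have "Cauchy (\<lambda>n. snd (v n))"
    proof (rule metric_CauchyI)
      fix e :: real assume "0 < e"
      then obtain K where K: "\<forall>m\<ge>K. \<forall>n\<ge>K. dist (x m) (x n) < e"
        using metric_CauchyD[OF LIMSEQ_imp_Cauchy[OF lim]] by blast
      have "dist (snd (v m)) (snd (v n)) \<le> dist (x m) (x n)" for m n
        using leL[OF csubspace_diff[OF L(1) v(1)[of m] v(1)[of n]]] by (simp add: dist_norm v(2))
      then show "\<exists>K. \<forall>m\<ge>K. \<forall>n\<ge>K. dist (snd (v m)) (snd (v n)) < e"
        using K order_le_less_trans by blast
    qed
    then obtain k where "(\<lambda>n. snd (v n)) \<longlonglongrightarrow> k" using Cauchy_convergent unfolding convergent_def by blast
    then have "v \<longlonglongrightarrow> (l, k)"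
      using tendsto_Pair[OF lim, of "\<lambda>n. snd (v n)" k] by (simp add: v(2))
    then have "(l, k) \<in> L" using closed_sequentially[OF L(2)] v(1) by blast
    then show "l \<in> fst ` L" by (force simp: image_iff)
  qed
  obtain p where p: "bounded_clinear p" "\<And>x. norm (p x) \<le> norm x" "\<And>x. p x \<in> fst ` L"
      "\<And>x. x \<in> fst ` L \<Longrightarrow> p x = x"
    using orthogonal_projection[OF csM clM] by blast
  have "\<forall>x. \<exists>y. (p x, y) \<in> L" using p(3) by (force simp: image_iff)
  then obtain W where W: "\<And>x. (p x, W x) \<in> L" by metis
  have uniq: "y = y'" if "(x, y) \<in> L" "(x, y') \<in> L" for x y y'
    using leL[OF csubspace_diff[OF L(1) that]] by simp
  have "bounded_clinear W"
  proof (rule bounded_clinearI[of _ 1])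
    show "W (x + y) = W x + W y" for x y
    proof (rule uniq[OF W])
      have "(p x, W x) + (p y, W y) \<in> L" using L(1) W unfolding csubspace_def by blast
      then show "(p (x + y), W x + W y) \<in> L" by (simp add: bounded_clinear_simps[OF p(1)])
    qed
    show "W (c *\<^sub>C x) = c *\<^sub>C W x" for c x
    proof (rule uniq[OF W])
      have "c *\<^sub>C (p x, W x) \<in> L" using L(1) W unfolding csubspace_def by blast
      then show "(p (c *\<^sub>C x), c *\<^sub>C W x) \<in> L"
        by (simp add: bounded_clinear_simps[OF p(1)] scaleC_prod_def)
    qed
    show "norm (W x) \<le> 1 * norm x" for x
      using leL[OF W[of x]] p(2)[of x] by simp
  qed
  moreover have "norm (W x) \<le> norm x" for x
    using leL[OF W[of x]] p(2)[of x] by simp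
  moreover have "W (fst v) = snd v" if "v \<in> V" for v
  proof (rule uniq[OF W])
    have "v \<in> L" using that L(3) by blast
    then show "(p (fst v), snd v) \<in> L" using p(4) by (metis imageI prod.collapse)
  qed
  ultimately show ?thesis using that by blast
qed

section \<open>Contractions prescribed on spanning families\<close>

lemma csubspace_finite_sums:
  assumes sc: "\<And>c g. g \<in> G \<Longrightarrow> c *\<^sub>C g \<in> G"
  shows "csubspace {sum f {..<n} | f n. \<forall>k<n::nat. f k \<in> G}" (is "csubspace ?V")
  unfolding csubspace_def
proof (intro conjI ballI allI)
  show "0 \<in> ?V" by (auto intro!: exI[of _ 0])
next
  fix x y assume "x \<in> ?V" "y \<in> ?V"
  then obtain f n g m where *: "x = sum f {..<n::nat}" "\<forall>k<n. f k \<in> G" "y = sum g {..<m::nat}" "\<forall>k<m. g k \<in> G"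
    by blast
  \<comment> \<open>Concatenation of the two lists of summands. No coefficients occur because
    \<open>G\<close> absorbs scalars.\<close>
  define h where "h k = (if k < n then f k else g (k - n))" for k
  have "{..<n + m} = {..<n} \<union> {n..<n + m}" by auto
  then have "sum h {..<n + m} = sum h {..<n} + sum h {n..<n + m}"
    by (simp add: sum.union_disjoint ivl_disj_int)
  also have "sum h {n..<n + m} = sum g {..<m}"
    by (rule sum.reindex_bij_witness[of _ "\<lambda>k. k + n" "\<lambda>k. k - n"]) (auto simp: h_def)
  also have "sum h {..<n} = sum f {..<n}" by (simp add: h_def)
  finally have "x + y = sum h {..<n + m}" using * by simp
  moreover have "\<forall>k<n + m. h k \<in> G" using * by (auto simp: h_def)
  ultimately show "x + y \<in> ?V" by blast
next
  fix c x assume "x \<in> ?V"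
  then obtain f n where *: "x = sum f {..<n::nat}" "\<forall>k<n. f k \<in> G" by blast
  then have "c *\<^sub>C x = sum (\<lambda>k. c *\<^sub>C f k) {..<n}" "\<forall>k<n. c *\<^sub>C f k \<in> G"
    using sc by (auto simp: scaleC.sum_right)
  then show "c *\<^sub>C x \<in> ?V" by (auto intro!: exI[of _ "\<lambda>k. c *\<^sub>C f k"] exI[of _ n])
qed

text \<open>The inequality for all finite sums makes the graph spanned by the pairs
  \<open>(p i v, q i v)\<close> contractive, so the prescribed values are consistent even when the
  vectors \<open>p i v\<close> are linearly dependent.\<close>

lemma contraction_extension_family:
  fixes p :: "'i \<Rightarrow> 'v::complex_inner \<Rightarrow> 'a::complex_hilbert"
    and q :: "'i \<Rightarrow> 'v \<Rightarrow> 'b::complex_hilbert"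
  assumes p: "\<And>i c v. i \<in> I \<Longrightarrow> p i (c *\<^sub>C v) = c *\<^sub>C p i v"
    and q: "\<And>i c v. i \<in> I \<Longrightarrow> q i (c *\<^sub>C v) = c *\<^sub>C q i v"
    and le: "\<And>n (\<zeta> :: nat \<Rightarrow> 'i) v. (\<And>k. \<zeta> k \<in> I) \<Longrightarrow>
      norm (\<Sum>k<n::nat. q (\<zeta> k) (v k)) \<le> norm (\<Sum>k<n. p (\<zeta> k) (v k))"
  obtains W where "bounded_clinear W" "\<And>x. norm (W x) \<le> norm x"
    "\<And>i v. i \<in> I \<Longrightarrow> W (p i v) = q i v"
proof -
  define G where "G = {(p i v, q i v) | i v. i \<in> I}"
  define V where "V = {sum f {..<n} | f n. \<forall>k<n::nat. f k \<in> G}"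
  have "csubspace V" unfolding V_def
  proof (rule csubspace_finite_sums)
    fix c g assume "g \<in> G"
    then obtain i v where "i \<in> I" "g = (p i v, q i v)" unfolding G_def by blast
    then show "c *\<^sub>C g \<in> G" unfolding G_def
      by (auto simp: scaleC_prod_def p q intro!: exI[of _ i] exI[of _ "c *\<^sub>C v"])
  qed
  moreover have "norm (snd w) \<le> norm (fst w)" if w: "w \<in> V" for w
  proof -
    obtain f n where f: "w = sum f {..<n::nat}" "\<forall>k<n. f k \<in> G" using w unfolding V_def by blast
    show ?thesis
    proof (cases "n = 0")
      case True then show ?thesis using f by simp
    next
      case False
      have "\<forall>k. \<exists>i v. k < n \<longrightarrow> i \<in> I \<and> f k = (p i v, q i v)" using f(2) unfolding G_def by blast
      then obtain \<zeta> v where z: "\<And>k. k < n \<Longrightarrow> \<zeta> k \<in> I \<and> f k = (p (\<zeta> k) (v k), q (\<zeta> k) (v k))"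
        by metis
      \<comment> \<open>\<open>le\<close> asks for an index in \<open>I\<close> at every
        \<open>k\<close>, so the choice is continued beyond \<open>n\<close> by the valid index
        \<open>\<zeta> 0\<close>; hence the separate case \<open>n = 0\<close>.\<close>
      define \<zeta>' where "\<zeta>' k = (if k < n then \<zeta> k else \<zeta> 0)" for k
      have "norm (\<Sum>k<n. q (\<zeta>' k) (v k)) \<le> norm (\<Sum>k<n. p (\<zeta>' k) (v k))"
        using z False by (intro le) (auto simp: \<zeta>'_def)
      moreover have "fst w = (\<Sum>k<n. p (\<zeta>' k) (v k))" "snd w = (\<Sum>k<n. q (\<zeta>' k) (v k))"
        unfolding f(1) fst_sum snd_sum using z by (auto simp: \<zeta>'_def intro!: sum.cong)
      ultimately show ?thesis by simp
    qed
  qed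
  ultimately obtain W where W: "bounded_clinear W" "\<And>x. norm (W x) \<le> norm x"
      "\<And>v. v \<in> V \<Longrightarrow> W (fst v) = snd v"
    using contraction_extension[of V] by blast
  have "W (p i v) = q i v" if "i \<in> I" for i v
  proof -
    have "(p i v, q i v) \<in> V" unfolding V_def G_def using that
      by (auto intro!: exI[of _ "\<lambda>_. (p i v, q i v)"] exI[of _ 1])
    then show ?thesis using W(3) by fastforce
  qed
  then show ?thesis using W that by blast
qed

lemma norm_square_sum_cinner:
  "complex_of_real ((norm (\<Sum>k<n. f k))\<^sup>2) = (\<Sum>k<n. \<Sum>l<n. cinner (f k) (f l))"
  unfolding cinner_self_eq[symmetric] cinner.sum_left cinner.sum_right by (rule sum.swap)

text \<open>Equal Gram matrices give equal norms of all finite sums. \<open>W\<close> is isometric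
  on the span of the vectors \<open>p i v\<close> and a contraction on the whole space.\<close>

lemma lurking_isometry:
  fixes p :: "'i \<Rightarrow> 'v::complex_inner \<Rightarrow> 'a::complex_hilbert"
    and q :: "'i \<Rightarrow> 'v \<Rightarrow> 'b::complex_hilbert"
  assumes p: "\<And>i c v. i \<in> I \<Longrightarrow> p i (c *\<^sub>C v) = c *\<^sub>C p i v"
    and q: "\<And>i c v. i \<in> I \<Longrightarrow> q i (c *\<^sub>C v) = c *\<^sub>C q i v"
    and eq: "\<And>i j v w. i \<in> I \<Longrightarrow> j \<in> I \<Longrightarrow> cinner (q i v) (q j w) = cinner (p i v) (p j w)"
  obtains W where "bounded_clinear W" "\<And>x. norm (W x) \<le> norm x"
    "\<And>i v. i \<in> I \<Longrightarrow> W (p i v) = q i v"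
proof -
  have le: "norm (\<Sum>k<n. q (\<zeta> k) (v k)) \<le> norm (\<Sum>k<n. p (\<zeta> k) (v k))"
    if "\<And>k. \<zeta> k \<in> I" for n :: nat and \<zeta> :: "nat \<Rightarrow> 'i" and v :: "nat \<Rightarrow> 'v"
  proof -
    from that have "complex_of_real ((norm (\<Sum>k<n. q (\<zeta> k) (v k)))\<^sup>2) = complex_of_real ((norm (\<Sum>k<n. p (\<zeta> k) (v k)))\<^sup>2)"
      unfolding norm_square_sum_cinner by (simp add: eq)
    then show ?thesis
      by (simp only: of_real_eq_iff power2_eq_iff_nonneg norm_ge_zero order_refl)
  qed
  obtain W where "bounded_clinear W" "\<And>x. norm (W x) \<le> norm x" "\<And>i v. i \<in> I \<Longrightarrow> W (p i v) = q i v"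
    using contraction_extension_family[of I p q, OF p q le] by metis
  then show ?thesis by (rule that)
qed

text \<open>The bound on powers with a constant \<open>M\<close> is meant for
  \<open>K x = z *\<^sub>C T x\<close> with \<open>T\<close> power bounded, where a single
  application of \<open>K\<close> may increase the norm.\<close>

lemma neumann_series:
  fixes K :: "'a::complex_hilbert \<Rightarrow> 'a"
  assumes K: "bounded_clinear K" and r: "0 \<le> r" "r < 1"
    and bd: "\<And>k x. norm ((K ^^ k) x) \<le> M * r ^ k * norm x"
  obtains R where "bounded_clinear R" "\<And>x. R x - K (R x) = x" "\<And>x. R (x - K x) = x"
    "\<And>x. norm (R x) \<le> M / (1 - r) * norm x"
proof -
  define R where "R x = (\<Sum>k. (K ^^ k) x)" for x
  have clin: "bounded_clinear (K ^^ k)" for k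
  proof (induction k)
    case (Suc k) then show ?case using bounded_clinear_compose[OF K Suc] by (simp add: o_def)
  qed (simp add: bounded_clinear_ident id_def)
  have sm: "summable (\<lambda>k. M * r ^ k * norm x)" for x
    using r by (intro summable_mult2 summable_mult summable_geometric) auto
  have sK: "summable (\<lambda>k. (K ^^ k) x)" for x
    by (rule summable_comparison_test'[OF sm[of x], where N=0]) (simp add: bd)
  have sn: "summable (\<lambda>k. norm ((K ^^ k) x))" for x
    by (rule summable_comparison_test'[OF sm[of x], where N=0]) (simp add: bd)
  have bdR: "norm (R x) \<le> M / (1 - r) * norm x" for x
  proof -
    have "norm (R x) \<le> (\<Sum>k. norm ((K ^^ k) x))" unfolding R_def by (rule summable_norm[OF sn])
    also have "\<dots> \<le> (\<Sum>k. M * r ^ k * norm x)" by (rule suminf_le[OF bd sn sm])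
    also have "\<dots> = M / (1 - r) * norm x"
      using r by (subst suminf_mult2[symmetric]) (auto simp: suminf_mult suminf_geometric intro!: summable_mult summable_geometric)
    finally show ?thesis .
  qed
  have R: "bounded_clinear R"
  proof (rule bounded_clinearI[OF _ _ bdR])
    show "R (x + y) = R x + R y" for x y
      unfolding R_def by (simp add: bounded_clinear_add[OF clin] suminf_add[OF sK sK])
    show "R (c *\<^sub>C x) = c *\<^sub>C R x" for c x
      unfolding R_def
      by (simp add: bounded_clinear_scaleC[OF clin] bounded_linear.suminf[OF scaleC.bounded_linear_right sK])
  qed
  have split: "R x = x + (\<Sum>k. (K ^^ Suc k) x)" for x
    unfolding R_def using suminf_split_head[OF sK, of x] by simp
  have 2: "R x - K (R x) = x" for x
  proof -
    have "K (R x) = (\<Sum>k. K ((K ^^ k) x))"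
      unfolding R_def by (rule bounded_linear.suminf[OF bounded_clinear_imp_bounded_linear[OF K] sK])
    then show ?thesis by (simp add: split[of x])
  qed
  have 3: "R (x - K x) = x" for x
  proof -
    have "R (K x) = (\<Sum>k. (K ^^ Suc k) x)" unfolding R_def by (simp add: funpow_swap1)
    then show ?thesis using R split[of x] by (simp add: bounded_clinear_diff)
  qed
  show ?thesis by (rule that[OF R 2 3 bdR])
qed

lemma neumann_series_contraction:
  fixes K :: "'a::complex_hilbert \<Rightarrow> 'a"
  assumes K: "bounded_clinear K" and r: "0 \<le> r" "r < 1" and bd: "\<And>x. norm (K x) \<le> r * norm x"
  obtains R where "bounded_clinear R" "\<And>x. R x - K (R x) = x" "\<And>x. R (x - K x) = x"
    "\<And>x. norm (R x) \<le> 1 / (1 - r) * norm x"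
proof -
  have "norm ((K ^^ k) x) \<le> 1 * r ^ k * norm x" for k x
  proof (induction k)
    case (Suc k)
    have "norm (K ((K ^^ k) x)) \<le> r * (r ^ k * norm x)"
      using bd[of "(K ^^ k) x"] mult_left_mono[OF Suc r(1)] by simp
    then show ?case by (simp add: mult_ac)
  qed simp
  from neumann_series[OF K r this] show ?thesis using that by metis
qed

subsection \<open>Square roots of positive operators\<close>

text \<open>Cauchy product summed along diagonals. With \<open>v n = (K ^^ n) x\<close> it squares
  an absolutely convergent power series in \<open>K\<close>.\<close>

lemma suminf_diagonal:
  fixes a :: "nat \<Rightarrow> real" and v :: "nat \<Rightarrow> 'b::banach"
  assumes a: "summable (\<lambda>k. \<bar>a k\<bar>)" and v: "\<And>n. norm (v n) \<le> M"
  shows "(\<Sum>i. a i *\<^sub>R (\<Sum>j. a j *\<^sub>R v (i + j))) = (\<Sum>n. (\<Sum>i\<le>n. a i * a (n - i)) *\<^sub>R v n)"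
proof -
  define f where "f = (\<lambda>(i, j). (a i * a j) *\<^sub>R v (i + j))"
  have M: "0 \<le> M" using v[of 0] norm_ge_zero order_trans by blast
  have suma: "((\<lambda>j. \<bar>a j\<bar>) has_sum (\<Sum>j. \<bar>a j\<bar>)) UNIV"
    using norm_summable_imp_has_sum[of "\<lambda>j. \<bar>a j\<bar>"] a by (simp add: summable_sums)
  have "(\<lambda>(i, j). \<bar>a i\<bar> * (M * \<bar>a j\<bar>)) summable_on UNIV \<times> UNIV"
  proof (rule summable_on_SigmaI)
    show "((\<lambda>j. case (i, j) of (i, j) \<Rightarrow> \<bar>a i\<bar> * (M * \<bar>a j\<bar>)) has_sum (\<bar>a i\<bar> * (M * (\<Sum>j. \<bar>a j\<bar>)))) UNIV" for i
      using has_sum_cmult_right[OF has_sum_cmult_right[OF suma]] by simp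
    show "(\<lambda>i. \<bar>a i\<bar> * (M * (\<Sum>j. \<bar>a j\<bar>))) summable_on UNIV"
      using has_sum_cmult_left[OF suma] has_sum_imp_summable by blast
  qed (use M in auto)
  then have "(\<lambda>x. norm (f x)) summable_on UNIV \<times> UNIV"
    by (rule Infinite_Sum.abs_summable_on_comparison_test')
      (auto simp: f_def abs_mult mult.assoc v mult.commute[of M] intro!: mult_left_mono)
  then have "f summable_on UNIV \<times> UNIV" by (rule abs_summable_summable)
  then obtain S where S: "(f has_sum S) (UNIV \<times> UNIV)" by (auto simp: summable_on_def)
  have v_abs: "summable (\<lambda>j. norm (a j *\<^sub>R v (i + j)))" for i
    using summable_mult2[OF a, of M]
    by (rule summable_comparison_test') (simp add: v mult_left_mono)
  have inner: "((\<lambda>j. f (i, j)) has_sum (a i *\<^sub>R (\<Sum>j. a j *\<^sub>R v (i + j)))) UNIV" for i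
  proof -
    have "((\<lambda>j. a j *\<^sub>R v (i + j)) has_sum (\<Sum>j. a j *\<^sub>R v (i + j))) UNIV"
      by (intro norm_summable_imp_has_sum v_abs summable_sums summable_norm_cancel)
    from has_sum_bounded_linear[OF bounded_linear_scaleR_right this] show ?thesis
      by (simp add: f_def o_def)
  qed
  have "((\<lambda>i. a i *\<^sub>R (\<Sum>j. a j *\<^sub>R v (i + j))) has_sum S) UNIV"
    using has_sum_SigmaD[OF S inner] by simp
  then have 1: "(\<lambda>i. a i *\<^sub>R (\<Sum>j. a j *\<^sub>R v (i + j))) sums S" by (rule has_sum_imp_sums)
  \<comment> \<open>Change of variables \<open>n = i + j\<close>, which turns the quadrant into the
    region \<open>i \<le> n\<close>.\<close>
  have "((\<lambda>(n, i). (a i * a (n - i)) *\<^sub>R v n) has_sum S) (Sigma UNIV (\<lambda>n. {..n}))"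
    using S by (subst (asm) has_sum_reindex_bij_witness[where j = "\<lambda>(i, j). (i + j, i)" and i = "\<lambda>(n, i). (i, n - i)"
        and T = "Sigma UNIV (\<lambda>n. {..n})" and h = "\<lambda>(n, i). (a i * a (n - i)) *\<^sub>R v n"])
      (auto simp: f_def)
  then have "((\<lambda>n. \<Sum>i\<le>n. (a i * a (n - i)) *\<^sub>R v n) has_sum S) UNIV"
    by (rule has_sum_SigmaD) (auto intro!: has_sum_finite)
  then have 2: "(\<lambda>n. (\<Sum>i\<le>n. a i * a (n - i)) *\<^sub>R v n) sums S"
    using has_sum_imp_sums by (simp add: scaleR_sum_left) blast
  from 1 2 show "(\<Sum>i. a i *\<^sub>R (\<Sum>j. a j *\<^sub>R v (i + j))) = (\<Sum>n. (\<Sum>i\<le>n. a i * a (n - i)) *\<^sub>R v n)"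
    by (simp add: sums_iff)
qed

text \<open>The Taylor coefficients of \<open>sqrt (1 - t)\<close> at \<open>t = 0\<close>.\<close>

definition sqrt_coeff :: "nat \<Rightarrow> real"
  where "sqrt_coeff k = ((1 / 2) gchoose k) * (- 1) ^ k"

lemma sqrt_coeff_nonpos: "sqrt_coeff (Suc k) \<le> 0"
proof -
  have "sqrt_coeff (Suc k) = pochhammer (- (1 / 2)) (Suc k) / fact (Suc k)"
    unfolding sqrt_coeff_def gbinomial_pochhammer
    by (simp add: power_mult_distrib[symmetric] flip: power_Suc)
  also have "pochhammer (- (1 / 2) :: real) (Suc k) = - (1 / 2) * pochhammer (1 / 2) k"
    unfolding pochhammer_rec by simp
  finally show ?thesis
    using pochhammer_pos[of "1 / 2 :: real" k] by (simp add: divide_nonpos_pos)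
qed

text \<open>Only the coefficient of index 0 is positive, so the absolute values add up to 2 minus
  the signed partial sum, which has a nonnegative closed form. Convergence up to
  \<open>t = 1\<close> is what admits operators of norm exactly 1.\<close>

lemma summable_sqrt_coeff: "summable (\<lambda>k. \<bar>sqrt_coeff k\<bar>)"
proof (rule bounded_imp_summable)
  fix n
  have "(\<Sum>k\<le>n. \<bar>sqrt_coeff k\<bar>) = 2 - (\<Sum>k\<le>n. sqrt_coeff k)"
    by (induction n) (use sqrt_coeff_nonpos in \<open>auto simp: sqrt_coeff_def abs_of_nonpos\<close>)
  moreover have "(\<Sum>k\<le>n. sqrt_coeff k) = pochhammer (1 / 2) n / fact n"
    unfolding sqrt_coeff_def gbinomial_sum_lower_neg
    by (simp add: gbinomial_pochhammer power_mult_distrib[symmetric])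
  moreover have "pochhammer (1 / 2 :: real) n / fact n \<ge> 0"
    by (simp add: pochhammer_nonneg)
  ultimately show "(\<Sum>k\<le>n. \<bar>sqrt_coeff k\<bar>) \<le> 2" by linarith
qed simp

text \<open>These are the coefficients of the square of \<open>sqrt (1 - t)\<close>; they follow
  from Vandermonde's identity with exponents \<open>1 / 2\<close> and \<open>1 / 2\<close>.\<close>

lemma sqrt_coeff_convolution:
  "(\<Sum>i\<le>n. sqrt_coeff i * sqrt_coeff (n - i)) = (if n = 0 then 1 else if n = 1 then - 1 else 0)"
proof -
  have "(\<Sum>i\<le>n. sqrt_coeff i * sqrt_coeff (n - i))
      = (\<Sum>i\<le>n. (((1 / 2) gchoose i) * ((1 / 2) gchoose (n - i))) * (- 1) ^ n)"
  proof (rule sum.cong)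
    fix i assume "i \<in> {..n}"
    then have "(- 1 :: real) ^ n = (- 1) ^ i * (- 1) ^ (n - i)" by (simp flip: power_add)
    then show "sqrt_coeff i * sqrt_coeff (n - i)
        = (((1 / 2) gchoose i) * ((1 / 2) gchoose (n - i))) * (- 1) ^ n"
      by (simp add: sqrt_coeff_def mult_ac)
  qed simp
  also have "\<dots> = ((1 :: real) gchoose n) * (- 1) ^ n"
    using gbinomial_Vandermonde[of "1 / 2 :: real" "1 / 2" n]
    by (simp add: sum_distrib_right[symmetric] atLeast0AtMost)
  also have "(1 :: real) gchoose n = of_nat (1 choose n)"
    using binomial_gbinomial[of 1 n, where 'a = real] by simp
  also have "of_nat (1 choose n) * (- 1 :: real) ^ n = (if n = 0 then 1 else if n = 1 then - 1 else 0)"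
    by (auto simp: not_less)
  finally show ?thesis .
qed

text \<open>\<open>R\<close> is the series of \<open>sqrt (1 - t)\<close> at \<open>t = K\<close>;
  the convolution identity computes its square.\<close>

lemma selfadjoint_contraction_sqrt:
  fixes K :: "'a::complex_hilbert \<Rightarrow> 'a"
  assumes K: "bounded_clinear K" and sa: "\<And>x y. cinner (K x) y = cinner x (K y)"
    and le: "\<And>x. norm (K x) \<le> norm x"
  obtains R where "bounded_clinear R" "\<And>x y. cinner (R x) y = cinner x (R y)"
    "\<And>x. R (R x) = x - K x"
proof -
  define R where "R x = (\<Sum>k. sqrt_coeff k *\<^sub>R (K ^^ k) x)" for x
  have clin: "bounded_clinear (K ^^ k)" for k
  proof (induction k)
    case (Suc k) then show ?case using bounded_clinear_compose[OF K Suc] by (simp add: o_def)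
  qed (simp add: bounded_clinear_ident id_def)
  have nK: "norm ((K ^^ k) x) \<le> norm x" for k x
    by (induction k) (auto intro: order_trans[OF le])
  have saK: "cinner ((K ^^ k) x) y = cinner x ((K ^^ k) y)" for k x y
    by (induction k arbitrary: x y) (simp_all add: sa funpow_swap1)
  have sb: "summable (\<lambda>k. \<bar>sqrt_coeff k\<bar> * norm x)" for x
    by (intro summable_mult2 summable_sqrt_coeff)
  have sn: "summable (\<lambda>k. norm (sqrt_coeff k *\<^sub>R (K ^^ k) x))" for x
    by (rule summable_comparison_test'[OF sb[of x], where N=0]) (simp add: nK mult_left_mono)
  note sK = summable_norm_cancel[OF sn]
  have R: "bounded_clinear R"
  proof (rule bounded_clinearI[of _ "\<Sum>k. \<bar>sqrt_coeff k\<bar>"])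
    show "R (x + y) = R x + R y" for x y
      unfolding R_def by (simp add: bounded_clinear_add[OF clin] scaleR_add_right suminf_add[OF sK sK])
    have "sqrt_coeff k *\<^sub>R c *\<^sub>C x = c *\<^sub>C sqrt_coeff k *\<^sub>R x" for k c and x :: 'a
      by (simp add: scaleR_scaleC scaleC_scaleC mult.commute)
    then show "R (c *\<^sub>C x) = c *\<^sub>C R x" for c x
      unfolding R_def
      by (simp add: bounded_clinear_scaleC[OF clin] bounded_linear.suminf[OF scaleC.bounded_linear_right sK])
    show "norm (R x) \<le> (\<Sum>k. \<bar>sqrt_coeff k\<bar>) * norm x" for x
    proof -
      have "norm (R x) \<le> (\<Sum>k. norm (sqrt_coeff k *\<^sub>R (K ^^ k) x))" unfolding R_def by (rule summable_norm[OF sn])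
      also have "\<dots> \<le> (\<Sum>k. \<bar>sqrt_coeff k\<bar> * norm x)"
        by (rule suminf_le[OF _ sn sb]) (simp add: nK mult_left_mono)
      also have "\<dots> = (\<Sum>k. \<bar>sqrt_coeff k\<bar>) * norm x"
        by (rule suminf_mult2[OF summable_sqrt_coeff, symmetric])
      finally show ?thesis .
    qed
  qed
  have 2: "cinner (R x) y = cinner x (R y)" for x y
    unfolding R_def bounded_linear.suminf[OF cinner.bounded_linear_left sK]
      bounded_linear.suminf[OF cinner.bounded_linear_right sK]
    by (simp add: cinner.scaleR_left cinner.scaleR_right saK)
  have 3: "R (R x) = x - K x" for x
  proof -
    have "(K ^^ i) (R x) = (\<Sum>j. sqrt_coeff j *\<^sub>R (K ^^ (i + j)) x)" for i
      unfolding R_def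
      using bounded_linear.suminf[OF bounded_clinear_imp_bounded_linear[OF clin[of i]] sK[of x], symmetric]
        linear_cmul[OF bounded_linear.linear[OF bounded_clinear_imp_bounded_linear[OF clin[of i]]]]
      by (simp add: funpow_add)
    then have "R (R x) = (\<Sum>i. sqrt_coeff i *\<^sub>R (\<Sum>j. sqrt_coeff j *\<^sub>R (K ^^ (i + j)) x))"
      by (simp add: R_def)
    also have "\<dots> = (\<Sum>n. (\<Sum>i\<le>n. sqrt_coeff i * sqrt_coeff (n - i)) *\<^sub>R (K ^^ n) x)"
      by (rule suminf_diagonal[OF summable_sqrt_coeff nK])
    also have "\<dots> = (\<Sum>n\<in>{0, 1}. (\<Sum>i\<le>n. sqrt_coeff i * sqrt_coeff (n - i)) *\<^sub>R (K ^^ n) x)"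
      by (rule suminf_finite) (auto simp: sqrt_coeff_convolution)
    also have "\<dots> = x - K x"
      unfolding sqrt_coeff_convolution by simp
    finally show ?thesis .
  qed
  show ?thesis by (rule that[OF R 2 3])
qed

text \<open>This is the operator inequality \<open>Q^2 \<le> c Q\<close>, obtained from positivity
  of \<open>Q\<close> at the vector \<open>x - Q x / c\<close>.\<close>

lemma positive_operator_Cauchy_Schwarz:
  fixes Q :: "'a::complex_hilbert \<Rightarrow> 'a"
  assumes Q: "bounded_clinear Q" and sa: "\<And>x y. cinner (Q x) y = cinner x (Q y)"
    and pos: "\<And>x. 0 \<le> Re (cinner (Q x) x)" and c: "c > 0" "\<And>x. norm (Q x) \<le> c * norm x"
  shows "(norm (Q x))\<^sup>2 \<le> c * Re (cinner (Q x) x)"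
proof -
  define y where "y = x - (1 / c) *\<^sub>R Q x"
  have lin: "Q (r *\<^sub>R v) = r *\<^sub>R Q v" for r v
    by (simp add: scaleR_scaleC bounded_clinear_scaleC[OF Q])
  have Re2: "Re (cinner (Q x) (Q x)) = (norm (Q x))\<^sup>2" by (simp add: cinner_self_eq)
  have "Re (cinner (Q (Q x)) (Q x)) \<le> norm (Q (Q x)) * norm (Q x)"
    using norm_cinner_le[of "Q (Q x)" "Q x"] complex_Re_le_cmod order_trans by blast
  also have "\<dots> \<le> c * (norm (Q x))\<^sup>2"
    using mult_right_mono[OF c(2)[of "Q x"], of "norm (Q x)"] by (simp add: power2_eq_square mult.assoc)
  finally have q: "Re (cinner (Q (Q x)) (Q x)) \<le> c * (norm (Q x))\<^sup>2" .
  have "0 \<le> Re (cinner (Q y) y)" by (rule pos)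
  also have "cinner (Q y) y = cinner (Q x) x - (2 / c) *\<^sub>R cinner (Q x) (Q x)
      + (1 / c\<^sup>2) *\<^sub>R cinner (Q (Q x)) (Q x)"
    unfolding y_def bounded_clinear_diff[OF Q] lin
    by (simp add: cinner.diff_left cinner.diff_right cinner.scaleR_left cinner.scaleR_right
        sa[of "Q x" x] power2_eq_square scaleR_2[symmetric])
      (simp add: scaleR_conv_of_real field_simps diff_divide_distrib)
  also have "Re \<dots> = Re (cinner (Q x) x) - (2 / c) * (norm (Q x))\<^sup>2
      + (1 / c\<^sup>2) * Re (cinner (Q (Q x)) (Q x))"
    by (simp add: Re2)
  also have "\<dots> \<le> Re (cinner (Q x) x) - (2 / c) * (norm (Q x))\<^sup>2 + (1 / c\<^sup>2) * (c * (norm (Q x))\<^sup>2)"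
    using q by (simp add: divide_right_mono)
  also have "\<dots> = Re (cinner (Q x) x) - (norm (Q x))\<^sup>2 / c"
    using c(1) by (simp add: field_simps power2_eq_square)
  finally show ?thesis using c(1) by (simp add: field_simps)
qed

text \<open>By \<open>Q^2 \<le> c Q\<close> the operator \<open>K = I - Q / c\<close> is a
  self-adjoint contraction; a root of \<open>I - K = Q / c\<close> is then multiplied by
  \<open>sqrt c\<close>.\<close>

theorem positive_operator_sqrt:
  fixes Q :: "'a::complex_hilbert \<Rightarrow> 'a"
  assumes Q: "bounded_clinear Q" and sa: "\<And>x y. cinner (Q x) y = cinner x (Q y)"
    and pos: "\<And>x. 0 \<le> Re (cinner (Q x) x)"
  obtains R where "bounded_clinear R" "\<And>x y. cinner (R x) y = cinner x (R y)"
    "\<And>x. R (R x) = Q x"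
proof -
  obtain c where c: "c > 0" "\<And>x. norm (Q x) \<le> c * norm x" using bounded_clinear_bound[OF Q] by blast
  define K where "K x = x - complex_of_real (1 / c) *\<^sub>C Q x" for x
  have K: "bounded_clinear K" unfolding K_def by (intro bounded_clinear_intros Q)
  have saK: "cinner (K x) y = cinner x (K y)" for x y
    by (simp add: K_def cinner.diff_left cinner.diff_right cinner_scaleC_left cinner_scaleC_right sa)
  have "norm (K x) \<le> norm x" for x
  proof (rule power2_le_imp_le)
    have "complex_of_real ((norm (K x))\<^sup>2) = cinner x x - (2 / c) *\<^sub>R cinner (Q x) x + (1 / c\<^sup>2) *\<^sub>R cinner (Q x) (Q x)"
      unfolding cinner_self_eq[symmetric] K_def
      by (simp add: cinner.diff_left cinner.diff_right cinner_scaleC_left cinner_scaleC_right sa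
          scaleR_conv_of_real power2_eq_square) (simp add: diff_divide_distrib)
    from arg_cong[OF this, of Re] have "(norm (K x))\<^sup>2 = (norm x)\<^sup>2 - (2 / c) * Re (cinner (Q x) x) + (1 / c\<^sup>2) * (norm (Q x))\<^sup>2"
      by (simp add: cinner_self_eq)
    also have "\<dots> \<le> (norm x)\<^sup>2 - (2 / c) * Re (cinner (Q x) x) + (1 / c\<^sup>2) * (c * Re (cinner (Q x) x))"
      using positive_operator_Cauchy_Schwarz[OF Q sa pos c, of x] by (simp add: divide_right_mono)
    also have "\<dots> = (norm x)\<^sup>2 - Re (cinner (Q x) x) / c"
      using c(1) by (simp add: field_simps power2_eq_square)
    also have "\<dots> \<le> (norm x)\<^sup>2" using pos[of x] c(1) by simp
    finally show "(norm (K x))\<^sup>2 \<le> (norm x)\<^sup>2" .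
  qed simp
  then obtain S where S: "bounded_clinear S" "\<And>x y. cinner (S x) y = cinner x (S y)"
      "\<And>x. S (S x) = x - K x"
    using selfadjoint_contraction_sqrt[OF K saK] by blast
  define R where "R x = complex_of_real (sqrt c) *\<^sub>C S x" for x
  have R: "bounded_clinear R" unfolding R_def by (intro bounded_clinear_intros S(1))
  have 2: "cinner (R x) y = cinner x (R y)" for x y
    by (simp add: R_def cinner_scaleC_left cinner_scaleC_right S(2))
  have "complex_of_real (sqrt c) * complex_of_real (sqrt c) = complex_of_real c"
    using c(1) by (simp flip: of_real_mult)
  then have 3: "R (R x) = Q x" for x
    using c(1) by (simp add: R_def bounded_clinear_scaleC[OF S(1)] S(3) scaleC_scaleC K_def)
  show ?thesis by (rule that[OF R 2 3])
qed

section \<open>Transfer functions\<close>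

text \<open>Near \<open>z\<close> the difference quotient is within operator norm 1 of the
  derivative, so increments have norm at most \<open>(1 + K) * cmod (w - z)\<close>. This explains
  the radius \<open>e / (1 + K)\<close>.\<close>

lemma op_analyticD_continuous:
  assumes F: "op_analytic F" and bc: "\<And>z. z \<in> \<bbbD> \<Longrightarrow> bounded_clinear (F z)" and z: "z \<in> \<bbbD>" and e: "e > 0"
  obtains d where "d > 0" "\<And>w u. w \<in> \<bbbD> \<Longrightarrow> dist w z < d \<Longrightarrow> norm (F w u - F z u) \<le> e * norm u"
proof -
  obtain F' where F': "bounded_clinear F'"
      "((\<lambda>w. onorm (\<lambda>x. inverse (w - z) *\<^sub>C (F w x - F z x) - F' x)) \<longlongrightarrow> 0) (at z)"
    using F z unfolding op_analytic_def by blast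
  obtain K where K: "K > 0" "\<And>x. norm (F' x) \<le> K * norm x" using bounded_clinear_bound[OF F'(1)] by blast
  have "\<forall>\<^sub>F w in at z. onorm (\<lambda>x. inverse (w - z) *\<^sub>C (F w x - F z x) - F' x) < 1"
    using order_tendstoD(2)[OF F'(2)] by simp
  then obtain d where d: "d > 0" "\<And>w. w \<noteq> z \<Longrightarrow> dist w z < d \<Longrightarrow>
      onorm (\<lambda>x. inverse (w - z) *\<^sub>C (F w x - F z x) - F' x) < 1"
    unfolding eventually_at by blast
  have "norm (F w u - F z u) \<le> e * norm u" if w: "w \<in> \<bbbD>" "dist w z < min d (e / (1 + K))" for w u
  proof (cases "w = z")
    case False
    let ?q = "\<lambda>x. inverse (w - z) *\<^sub>C (F w x - F z x) - F' x"
    have "bounded_clinear ?q" by (intro bounded_clinear_intros bc w z F'(1))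
    then have "norm (?q u) \<le> onorm ?q * norm u"
      by (intro onorm bounded_clinear_imp_bounded_linear)
    also have "\<dots> \<le> 1 * norm u" using d(2)[OF False] w by (intro mult_right_mono) auto
    finally have q: "norm (?q u) \<le> norm u" by simp
    have "F w u - F z u = (w - z) *\<^sub>C (?q u + F' u)"
      using False by (simp add: scaleC_scaleC)
    then have "norm (F w u - F z u) = cmod (w - z) * norm (?q u + F' u)" by (metis norm_scaleC)
    also have "\<dots> \<le> cmod (w - z) * ((1 + K) * norm u)"
      using q K(2)[of u] norm_triangle_ineq[of "?q u" "F' u"]
      by (intro mult_left_mono) (auto simp: distrib_right)
    also have "\<dots> \<le> e / (1 + K) * ((1 + K) * norm u)"
      using w(2) K(1) by (intro mult_right_mono) (auto simp: dist_norm)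
    also have "\<dots> = e * norm u" using K(1) by simp
    finally show ?thesis .
  qed (use e in simp)
  moreover have "min d (e / (1 + K)) > 0" using d(1) e K(1) by simp
  ultimately show ?thesis using that by blast
qed

text \<open>The value at \<open>z\<close> of the transfer function of the colligation \<open>L\<close> is obtained from
  \<open>u\<close> by closing the feedback loop \<open>h = fst (L (z h, u))\<close>.\<close>

theorem transfer_function:
  fixes L :: "'x::complex_hilbert \<times> 'u::complex_hilbert \<Rightarrow> 'x \<times> 'y::complex_hilbert"
  assumes L: "bounded_clinear L" and le: "\<And>v. norm (L v) \<le> norm v"
  obtains F where "F \<in> schur_class"
    "\<And>z h u y. z \<in> \<bbbD> \<Longrightarrow> L (z *\<^sub>C h, u) = (h, y) \<Longrightarrow> y = F z u"
    "\<And>z u. z \<in> \<bbbD> \<Longrightarrow> \<exists>h. L (z *\<^sub>C h, u) = (h, F z u)"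
proof -
  \<comment> \<open>Blocks of the colligation; the transfer function is
    \<open>F(z) = d + z c (I - z a)^(-1) b\<close>.\<close>
  define a where "a x = fst (L (x, 0))" for x
  define b where "b u = fst (L (0, u))" for u
  define c where "c x = snd (L (x, 0))" for x
  define d where "d u = snd (L (0, u))" for u
  have bc: "bounded_clinear a" "bounded_clinear b" "bounded_clinear c" "bounded_clinear d"
    unfolding a_def b_def c_def d_def
    by (intro bounded_clinear_intros bounded_clinear_compose[OF L] | rule bounded_clinear_ident)+
  have Lsplit: "L (x, u) = (a x + b u, c x + d u)" for x u
  proof -
    have "L (x, u) = L (x, 0) + L (0, u)" by (simp flip: bounded_clinear_add[OF L])
    then show ?thesis by (simp add: a_def b_def c_def d_def prod_eq_iff)
  qed
  have na: "norm (a x) \<le> norm x" and nc: "norm (c x) \<le> norm x" for x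
    using le[of "(x, 0)"] norm_fst_le[of "fst (L (x, 0))" "snd (L (x, 0))"]
      norm_snd_le[of "snd (L (x, 0))" "fst (L (x, 0))"]
    by (simp_all add: a_def c_def)
  have nb: "norm (b u) \<le> norm u" for u
    using le[of "(0, u)"] norm_fst_le[of "fst (L (0, u))" "snd (L (0, u))"] by (simp add: b_def)
  have "\<exists>R. bounded_clinear R \<and> (\<forall>x. R x - z *\<^sub>C a (R x) = x) \<and> (\<forall>x. R (x - z *\<^sub>C a x) = x)
      \<and> (\<forall>x. norm (R x) \<le> 1 / (1 - cmod z) * norm x)" if z: "z \<in> \<bbbD>" for z
  proof -
    have "bounded_clinear (\<lambda>x. z *\<^sub>C a x)" by (intro bounded_clinear_intros bc)
    moreover have "norm (z *\<^sub>C a x) \<le> cmod z * norm x" for x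
      by (simp add: norm_scaleC na mult_left_mono)
    ultimately show ?thesis using z neumann_series_contraction[of "\<lambda>x. z *\<^sub>C a x" "cmod z"]
      by (metis mem_ball_0 norm_ge_zero)
  qed
  then obtain R where R: "\<And>z. z \<in> \<bbbD> \<Longrightarrow> bounded_clinear (R z)"
      "\<And>z x. z \<in> \<bbbD> \<Longrightarrow> R z x - z *\<^sub>C a (R z x) = x" "\<And>z x. z \<in> \<bbbD> \<Longrightarrow> R z (x - z *\<^sub>C a x) = x"
      "\<And>z x. z \<in> \<bbbD> \<Longrightarrow> norm (R z x) \<le> 1 / (1 - cmod z) * norm x"
    by metis
  define F where "F z u = c (z *\<^sub>C R z (b u)) + d u" for z u
  have ex: "L (z *\<^sub>C R z (b u), u) = (R z (b u), F z u)" if "z \<in> \<bbbD>" for z u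
  proof -
    have "a (z *\<^sub>C R z (b u)) + b u = R z (b u)"
      using R(2)[OF that, of "b u"] by (simp add: bounded_clinear_scaleC[OF bc(1)] diff_eq_eq add.commute)
    then show ?thesis by (simp add: Lsplit F_def)
  qed
  have uniq: "y = F z u" if z: "z \<in> \<bbbD>" and eq: "L (z *\<^sub>C h, u) = (h, y)" for z h u y
  proof -
    have "z *\<^sub>C a h + b u = h" using eq by (auto simp: Lsplit bounded_clinear_scaleC[OF bc(1)])
    then have "h - z *\<^sub>C a h = b u" by (metis add_diff_cancel_left')
    then have "R z (b u) = h" using R(3)[OF z, of h] by simp
    then show ?thesis using eq by (auto simp: Lsplit F_def)
  qed
  have bF: "bounded_clinear (F z)" if "z \<in> \<bbbD>" for z
    unfolding F_def by (intro bounded_clinear_plus bounded_clinear_compose[OF bc(3)]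
        bounded_clinear_scale_fun bounded_clinear_compose[OF R(1)[OF that]] bc)
  have nF: "norm (F z u) \<le> norm u" if z: "z \<in> \<bbbD>" for z u
  proof -
    let ?h = "R z (b u)"
    have "(norm (?h, F z u))\<^sup>2 \<le> (norm (z *\<^sub>C ?h, u))\<^sup>2"
      using le[of "(z *\<^sub>C ?h, u)"] ex[OF z, of u] by (intro power_mono) auto
    then have "(norm ?h)\<^sup>2 + (norm (F z u))\<^sup>2 \<le> (cmod z * norm ?h)\<^sup>2 + (norm u)\<^sup>2"
      by (simp add: norm_Pair norm_scaleC)
    \<comment> \<open>Since \<open>cmod z < 1\<close>, the state drops out of the energy
      balance.\<close>
    moreover have "(cmod z * norm ?h)\<^sup>2 \<le> (norm ?h)\<^sup>2"
      using z by (intro power_mono) (auto simp: mult_left_le_one_le)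
    ultimately have "(norm (F z u))\<^sup>2 \<le> (norm u)\<^sup>2" by linarith
    then show ?thesis by (rule power2_le_imp_le) simp
  qed
  \<comment> \<open>The resolvent identity for \<open>R z = (I - z a)^(-1)\<close>.\<close>
  have Rdiff: "R w v - R z v = (w - z) *\<^sub>C R w (a (R z v))" if "w \<in> \<bbbD>" "z \<in> \<bbbD>" for w z v
  proof -
    have "R z v = R w (R z v - w *\<^sub>C a (R z v))" by (rule R(3)[OF that(1), symmetric])
    also have "R z v - w *\<^sub>C a (R z v) = v - (w - z) *\<^sub>C a (R z v)"
      using R(2)[OF that(2), of v] by (simp add: scaleC.diff_left algebra_simps)
    finally have "R z v = R w v - (w - z) *\<^sub>C R w (a (R z v))"
      by (simp add: bounded_clinear_simps[OF R(1)[OF that(1)]])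
    moreover have "q - p = r" if "p = q - r" for p q r :: 'x using that by simp
    ultimately show ?thesis by blast
  qed
  have "op_analytic F"
    unfolding op_analytic_def
  proof
    fix z :: complex assume z: "z \<in> \<bbbD>"
    \<comment> \<open>The derivative of \<open>z R(z)\<close> is the square of \<open>R(z)\<close>,
      because \<open>R(z) = I + z a R(z)\<close>.\<close>
    define F' where "F' u = c (R z (R z (b u)))" for u
    have bF': "bounded_clinear F'"
      unfolding F'_def by (intro bounded_clinear_compose[OF bc(3)] bounded_clinear_compose[OF R(1)[OF z]] bc)
    \<comment> \<open>A radius strictly between \<open>cmod z\<close> and 1, so that
      \<open>R w\<close> is bounded uniformly for \<open>w\<close> near \<open>z\<close>.\<close>
    define r where "r = (1 + cmod z) / 2"
    have r: "cmod z < r" "r < 1" "0 < r" using z norm_ge_zero[of z] by (auto simp: r_def simp del: norm_ge_zero)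
    define M where "M = 1 / (1 - r) * (1 / (1 - cmod z) * (1 / (1 - cmod z)))"
    have M: "0 \<le> M" using r by (simp add: M_def)
    have quot: "inverse (w - z) *\<^sub>C (F w u - F z u) - F' u = (w - z) *\<^sub>C c (R w (a (R z (R z (b u)))))"
      if w: "w \<in> \<bbbD>" "w \<noteq> z" for w u
    proof -
      have *: "w *\<^sub>C R w v - z *\<^sub>C R z v = (w - z) *\<^sub>C R w (R z v)" for v
      proof -
        have "w *\<^sub>C R w v - z *\<^sub>C R z v = w *\<^sub>C (R w v - R z v) + (w - z) *\<^sub>C R z v"
          by (simp add: scaleC.diff_left scaleC.diff_right)
        also have "\<dots> = (w - z) *\<^sub>C (w *\<^sub>C R w (a (R z v)) + R z v)"
          by (simp add: Rdiff[OF w(1) z] scaleC_add_right scaleC_scaleC mult.commute)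
        also have "w *\<^sub>C R w (a (R z v)) + R z v = R w (R z v)"
          using R(3)[OF w(1), of "R z v"]
          by (simp add: bounded_clinear_simps[OF R(1)[OF w(1)]] diff_eq_eq add.commute)
        finally show ?thesis .
      qed
      have "F w u - F z u = (w - z) *\<^sub>C c (R w (R z (b u)))"
        unfolding F_def using arg_cong[OF *[of "b u"], of c] by (simp add: bounded_clinear_simps[OF bc(3)])
      then have "inverse (w - z) *\<^sub>C (F w u - F z u) - F' u = c (R w (R z (b u)) - R z (R z (b u)))"
        using w(2) by (simp add: scaleC_scaleC F'_def bounded_clinear_simps[OF bc(3)])
      then show ?thesis by (simp add: Rdiff[OF w(1) z] bounded_clinear_simps[OF bc(3)])
    qed
    have bd: "norm (onorm (\<lambda>u. inverse (w - z) *\<^sub>C (F w u - F z u) - F' u)) \<le> cmod (w - z) * M"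
      if w: "w \<noteq> z" "cmod w < r" for w
    proof -
      have wD: "w \<in> \<bbbD>" using w r by simp
      have "bounded_clinear (\<lambda>u. inverse (w - z) *\<^sub>C (F w u - F z u) - F' u)"
        by (intro bounded_clinear_intros bF wD z bF')
      then have "0 \<le> onorm (\<lambda>u. inverse (w - z) *\<^sub>C (F w u - F z u) - F' u)"
        by (intro onorm_pos_le bounded_clinear_imp_bounded_linear)
      moreover have "onorm (\<lambda>u. inverse (w - z) *\<^sub>C (F w u - F z u) - F' u) \<le> cmod (w - z) * M"
      proof (rule onorm_bound)
        fix u
        have "norm (R w (a (R z (R z (b u))))) \<le> 1 / (1 - cmod w) * norm (a (R z (R z (b u))))" by (rule R(4)[OF wD])
        also have "\<dots> \<le> 1 / (1 - r) * norm (a (R z (R z (b u))))"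
          using w(2) r by (intro mult_right_mono) (auto intro!: divide_left_mono)
        also have "\<dots> \<le> 1 / (1 - r) * (1 / (1 - cmod z) * (1 / (1 - cmod z) * norm u))"
        proof (intro mult_left_mono)
          have "norm (a (R z (R z (b u)))) \<le> norm (R z (R z (b u)))" by (rule na)
          also have "\<dots> \<le> 1 / (1 - cmod z) * norm (R z (b u))" by (rule R(4)[OF z])
          also have "\<dots> \<le> 1 / (1 - cmod z) * (1 / (1 - cmod z) * norm (b u))"
            using z by (intro mult_left_mono R(4)[OF z]) auto
          also have "\<dots> \<le> 1 / (1 - cmod z) * (1 / (1 - cmod z) * norm u)"
            using z by (intro mult_left_mono nb) auto
          finally show "norm (a (R z (R z (b u)))) \<le> 1 / (1 - cmod z) * (1 / (1 - cmod z) * norm u)" .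
        qed (use r in auto)
        finally have "norm (R w (a (R z (R z (b u))))) \<le> M * norm u" by (simp add: M_def)
        then have "norm (c (R w (a (R z (R z (b u)))))) \<le> M * norm u" using nc order_trans by blast
        then show "norm (inverse (w - z) *\<^sub>C (F w u - F z u) - F' u) \<le> cmod (w - z) * M * norm u"
          unfolding quot[OF wD w(1)] norm_scaleC by (simp add: mult.assoc mult_left_mono)
      qed (use M in simp)
      ultimately show ?thesis by simp
    qed
    have "((\<lambda>w. onorm (\<lambda>u. inverse (w - z) *\<^sub>C (F w u - F z u) - F' u)) \<longlongrightarrow> 0) (at z)"
    proof (rule Lim_null_comparison)
      show "\<forall>\<^sub>F w in at z. norm (onorm (\<lambda>u. inverse (w - z) *\<^sub>C (F w u - F z u) - F' u)) \<le> cmod (w - z) * M"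
      proof -
        have "\<forall>\<^sub>F w in at z. cmod w < r"
          using r by (intro order_tendstoD(2)[OF tendsto_norm[OF tendsto_ident_at]])
        moreover have "\<forall>\<^sub>F w in at z. w \<noteq> z" by (simp add: eventually_at_filter)
        ultimately show ?thesis by eventually_elim (rule bd)
      qed
      have "((\<lambda>w. cmod (w - z) * M) \<longlongrightarrow> cmod (z - z) * M) (at z)"
        by (intro tendsto_intros)
      then show "((\<lambda>w. cmod (w - z) * M) \<longlongrightarrow> 0) (at z)" by simp
    qed
    then show "\<exists>F'. bounded_clinear F' \<and>
        ((\<lambda>w. onorm (\<lambda>x. inverse (w - z) *\<^sub>C (F w x - F z x) - F' x)) \<longlongrightarrow> 0) (at z)"
      using bF' by blast
  qed
  then have "F \<in> schur_class" using bF nF by (auto simp: schur_class_def)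
  then show ?thesis using that uniq ex by metis
qed

section \<open>Multipliers between weighted Hardy spaces\<close>

text \<open>Pairing with \<open>y\<close> reduces the claim to scalar series, where uniqueness of a
  convergent power series applies.\<close>

lemma power_series_coeff_zero:
  fixes f :: "nat \<Rightarrow> 'a::complex_inner"
  assumes f: "\<And>z. z \<in> \<bbbD> \<Longrightarrow> (\<lambda>k. z ^ k *\<^sub>C f k) sums 0"
  shows "f k = 0"
proof (rule cinner_ext)
  fix y
  have s: "(\<lambda>k. cinner (f k) y * z ^ k) sums 0" if "z \<in> \<bbbD>" for z
    using bounded_linear.sums[OF cinner.bounded_linear_left f[OF that], of y]
    by (simp add: cinner_scaleC_left mult.commute)
  define F where "F = Abs_fps (\<lambda>k. cinner (f k) y)"
  have F0: "eval_fps F z = 0" if "z \<in> \<bbbD>" for z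
    using s[OF that] by (simp add: eval_fps_def F_def sums_iff)
  have "conv_radius (\<lambda>k. cinner (f k) y) \<ge> norm (1 / 2 :: complex)"
    using s[of "1 / 2"] by (intro conv_radius_geI) (auto simp: sums_iff)
  then have "fps_conv_radius F > 0"
    by (auto simp: fps_conv_radius_def F_def intro: less_le_trans[rotated])
  moreover have "\<forall>\<^sub>F z in nhds 0. eval_fps F z = eval_fps 0 z"
    using F0 by (intro eventually_nhds_in_open[THEN eventually_mono, of "\<bbbD>"]) auto
  ultimately have "F = 0" by (intro eval_fps_eqD) auto
  then have "fps_nth F k = 0" by simp
  then show "cinner (f k) y = cinner 0 y" by (simp add: F_def)
qed

text \<open>Square summability of the coordinates \<open>c j * z ^ j\<close> of a kernel vector for
  all \<open>z\<close> in the disk. It serves both \<open>c j = 1 / sqrt (\<beta> j)\<close> and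
  \<open>c j = sqrt (gamma_inv \<beta> j)\<close>.\<close>

definition disk_weight :: "(nat \<Rightarrow> real) \<Rightarrow> bool"
  where "disk_weight c \<longleftrightarrow> (\<forall>r. 0 \<le> r \<longrightarrow> r < 1 \<longrightarrow> summable (\<lambda>j. (c j)\<^sup>2 * r ^ j))"

lemma disk_weight_one: "disk_weight (\<lambda>_. 1)"
  by (simp add: disk_weight_def summable_geometric)

lemma disk_weight_mono:
  assumes "disk_weight c" "\<And>j. (d j)\<^sup>2 \<le> (c j)\<^sup>2" shows "disk_weight d"
  unfolding disk_weight_def
proof (intro allI impI)
  fix r :: real assume r: "0 \<le> r" "r < 1"
  then have "summable (\<lambda>j. (c j)\<^sup>2 * r ^ j)" using assms(1) by (simp add: disk_weight_def)
  then show "summable (\<lambda>j. (d j)\<^sup>2 * r ^ j)"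
    by (rule summable_comparison_test') (use assms(2) r in \<open>auto simp: mult_right_mono\<close>)
qed

lemma weight_sequence_pos: "weight_sequence \<beta> \<Longrightarrow> 0 < \<beta> j"
  by (simp add: weight_sequence_def)

lemma weight_sequence_one: "weight_sequence one_weight"
proof -
  have "(\<lambda>j. ereal (root j 1)) \<longlonglongrightarrow> ereal 1"
    by (rule tendsto_eventually) (auto simp: eventually_sequentially intro!: exI[of _ 1])
  then have "liminf (\<lambda>j. ereal (root j 1)) = ereal 1"
    by (intro lim_imp_Liminf) auto
  then show ?thesis by (simp add: weight_sequence_def one_ereal_def)
qed

text \<open>For \<open>s\<close> between \<open>r\<close> and 1 the liminf condition gives
  \<open>s ^ j \<le> \<beta> j\<close> eventually, so a geometric series of ratio
  \<open>r / s\<close> dominates.\<close>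

lemma disk_weight_weight_sequence:
  assumes "weight_sequence \<beta>" shows "disk_weight (\<lambda>j. 1 / sqrt (\<beta> j))"
  unfolding disk_weight_def
proof (intro allI impI)
  fix r :: real assume r: "0 \<le> r" "r < 1"
  obtain s where s: "r < s" "s < 1" using r dense by blast
  have pos: "0 < \<beta> j" for j using assms by (rule weight_sequence_pos)
  have "ereal s < liminf (\<lambda>j. ereal (root j (\<beta> j)))"
  proof (rule less_le_trans)
    show "ereal s < 1" using s by (simp add: one_ereal_def)
  qed (use assms in \<open>simp add: weight_sequence_def\<close>)
  then have "\<forall>\<^sub>F j in sequentially. ereal s < ereal (root j (\<beta> j))" by (rule less_LiminfD)
  then obtain N where N: "\<And>j. j \<ge> N \<Longrightarrow> s < root j (\<beta> j)" by (auto simp: eventually_sequentially)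
  show "summable (\<lambda>j. (1 / sqrt (\<beta> j))\<^sup>2 * r ^ j)"
  \<comment> \<open>The start \<open>Suc N\<close> excludes \<open>j = 0\<close>, where
    \<open>root j\<close> does not invert the \<open>j\<close>-th power.\<close>
  proof (rule summable_comparison_test'[of "\<lambda>j. (r / s) ^ j" "Suc N"])
    show "summable (\<lambda>j. (r / s) ^ j)" using r s by (intro summable_geometric) simp
    fix j assume j: "j \<ge> Suc N"
    then have "s ^ j \<le> root j (\<beta> j) ^ j" using N[of j] r s by (intro power_mono) auto
    also have "\<dots> = \<beta> j" using j pos[of j] by simp
    finally have "r ^ j / \<beta> j \<le> r ^ j / s ^ j" using r s pos[of j] by (intro divide_left_mono) auto
    then show "norm ((1 / sqrt (\<beta> j))\<^sup>2 * r ^ j) \<le> (r / s) ^ j"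
      using r pos[of j] by (simp add: power_divide)
  qed
qed

text \<open>In the coordinates \<open>x\<^sub>j = sqrt (\<beta> j) f\<^sub>j\<close>, which identify \<open>H2 \<beta>\<close> with \<open>ell2\<close>, the
  reproducing kernel of \<open>H2 \<beta>\<close> is \<open>kvec c\<close> with \<open>c j = 1 / sqrt (\<beta> j)\<close>.\<close>

definition kvec :: "(nat \<Rightarrow> real) \<Rightarrow> complex \<Rightarrow> 'a::complex_inner \<Rightarrow> 'a ell2"
  where "kvec c z y = Abs_ell2 (\<lambda>j. (of_real (c j) * cnj z ^ j) *\<^sub>C y)"

lemma summable_disk_weight:
  assumes "disk_weight c" "z \<in> \<bbbD>"
  shows "summable (\<lambda>j. (norm ((of_real (c j) * z ^ j) *\<^sub>C y))\<^sup>2)"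
proof -
  have "(cmod z)\<^sup>2 < 1" using assms(2) by (simp add: power_less_one_iff)
  then have "summable (\<lambda>j. (c j)\<^sup>2 * ((cmod z)\<^sup>2) ^ j)" using assms(1) by (simp add: disk_weight_def)
  from summable_mult2[OF this, of "(norm y)\<^sup>2"] show ?thesis
    by (simp add: norm_scaleC norm_mult norm_power power_mult_distrib mult.commute[of 2] flip: power_mult)
qed

lemma nth_kvec:
  assumes "disk_weight c" "z \<in> \<bbbD>"
  shows "ell2_nth (kvec c z y) j = (of_real (c j) * cnj z ^ j) *\<^sub>C y"
  unfolding kvec_def using summable_disk_weight[OF assms(1), of "cnj z" y] assms(2)
  by (simp add: ell2_nth_Abs)

lemma kvec_scaleC:
  assumes "disk_weight c" "z \<in> \<bbbD>" shows "kvec c z (a *\<^sub>C y) = a *\<^sub>C kvec c z y"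
  by (rule ell2_eqI) (simp add: nth_kvec[OF assms] nth_scaleC scaleC_scaleC mult_ac)

lemma norm_mult_lt_one: "z \<in> \<bbbD> \<Longrightarrow> w \<in> \<bbbD> \<Longrightarrow> cmod (w * cnj z) < 1"
  using mult_right_mono[of "cmod w" 1 "cmod z"] by (simp add: norm_mult)

lemma cinner_sums_ell2:
  fixes x y :: "'a::complex_inner ell2"
  shows "(\<lambda>k. cinner (ell2_nth x k) (ell2_nth y k)) sums cinner x y"
  unfolding cinner_ell2_def by (rule summable_sums[OF summable_cinner_ell2])

lemma cinner_kvec_sums:
  assumes c: "disk_weight c" and z: "z \<in> \<bbbD>"
  shows "(\<lambda>j. of_real (c j) * z ^ j * cinner (ell2_nth x j) y) sums cinner x (kvec c z y)"
  using cinner_sums_ell2[of x "kvec c z y"] by (simp add: nth_kvec[OF c z] cinner_scaleC_right)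

lemma cinner_kvec_kvec:
  assumes c: "disk_weight c" and z: "z \<in> \<bbbD>" and w: "w \<in> \<bbbD>"
  shows "cinner (kvec c z x) (kvec c w y) = (\<Sum>j. of_real ((c j)\<^sup>2) * (w * cnj z) ^ j) * cinner x y"
proof -
  have "cmod (w * cnj z) < 1" using z w by (rule norm_mult_lt_one)
  then have "summable (\<lambda>j. (c j)\<^sup>2 * cmod (w * cnj z) ^ j)" using c by (simp add: disk_weight_def)
  then have "summable (\<lambda>j. of_real ((c j)\<^sup>2) * (w * cnj z) ^ j)"
    by (intro summable_norm_cancel[of "\<lambda>j. of_real ((c j)\<^sup>2) * (w * cnj z) ^ j"]) (simp add: norm_mult norm_power)
  then have "(\<lambda>j. of_real ((c j)\<^sup>2) * (w * cnj z) ^ j * cinner x y)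
      sums ((\<Sum>j. of_real ((c j)\<^sup>2) * (w * cnj z) ^ j) * cinner x y)"
    by (intro sums_mult2 summable_sums)
  moreover have "(\<lambda>j. of_real ((c j)\<^sup>2) * (w * cnj z) ^ j * cinner x y) sums cinner (kvec c z x) (kvec c w y)"
    using cinner_kvec_sums[OF c w, of "kvec c z x" y]
    by (simp add: nth_kvec[OF c z] cinner_scaleC_left power2_eq_square power_mult_distrib mult_ac)
  ultimately show ?thesis using sums_unique2 by blast
qed

lemma cinner_kvec_one:
  assumes z: "z \<in> \<bbbD>" and w: "w \<in> \<bbbD>"
  shows "cinner (kvec (\<lambda>_. 1) z x) (kvec (\<lambda>_. 1) w y) = cinner x y / (1 - w * cnj z)"
  using suminf_geometric[OF norm_mult_lt_one[OF z w]]
  by (simp add: cinner_kvec_kvec[OF disk_weight_one z w])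

text \<open>As a function of \<open>z\<close> the inner product is a power series with coefficients
  \<open>c k * cinner (ell2_nth x k) y\<close>; as \<open>c k \<noteq> 0\<close>, they determine
  \<open>x\<close>.\<close>

lemma kvec_total:
  assumes c: "disk_weight c" "\<And>j. c j \<noteq> 0"
    and x: "\<And>z y. z \<in> \<bbbD> \<Longrightarrow> cinner x (kvec c z y) = 0"
  shows "x = 0"
proof (rule ell2_eqI)
  fix k
  have "cinner (ell2_nth x k) y = cinner 0 y" for y
  proof -
    have "of_real (c k) * cinner (ell2_nth x k) y = 0"
      using cinner_kvec_sums[OF c(1), of _ x y] x
      by (intro power_series_coeff_zero[where f = "\<lambda>k. of_real (c k) * cinner (ell2_nth x k) y"])
        (simp add: scaleC_complex_def mult_ac)
    then show ?thesis using c(2) by simp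
  qed
  then show "ell2_nth x k = ell2_nth 0 k" unfolding nth_zero by (rule cinner_ext)
qed

text \<open>The unitary identification of \<open>ell2\<close> with \<open>H2 \<beta>\<close>, from
  coordinates back to coefficients.\<close>

definition h2_coeff :: "(nat \<Rightarrow> real) \<Rightarrow> 'a::complex_inner ell2 \<Rightarrow> nat \<Rightarrow> 'a"
  where "h2_coeff \<beta> x = (\<lambda>j. (1 / sqrt (\<beta> j)) *\<^sub>R ell2_nth x j)"

lemma h2_coeff_one: "h2_coeff one_weight x = ell2_nth x"
  by (simp add: h2_coeff_def)

context
  fixes \<beta> :: "nat \<Rightarrow> real"
  assumes \<beta>: "weight_sequence \<beta>"
begin

lemma weighted_norm_h2_coeff: "\<beta> k * (norm (h2_coeff \<beta> x k))\<^sup>2 = (norm (ell2_nth x k))\<^sup>2"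
  using weight_sequence_pos[OF \<beta>, of k] by (simp add: h2_coeff_def power_divide)

lemma h2_coeff_in_H2: "h2_coeff \<beta> x \<in> H2 \<beta>"
  by (simp add: H2_def weighted_norm_h2_coeff summable_ell2)

lemma H2_norm_h2_coeff: "H2_norm \<beta> (h2_coeff \<beta> x) = norm x"
  unfolding H2_norm_def weighted_norm_h2_coeff norm_ell2_square[symmetric] by simp

lemma H2_cinner_h2_coeff: "H2_cinner \<beta> (h2_coeff \<beta> x) (h2_coeff \<beta> y) = cinner x y"
proof -
  have "complex_of_real (\<beta> k) * cinner (h2_coeff \<beta> x k) (h2_coeff \<beta> y k) = cinner (ell2_nth x k) (ell2_nth y k)" for k
  proof -
    have "complex_of_real (\<beta> k) = complex_of_real (sqrt (\<beta> k)) * complex_of_real (sqrt (\<beta> k))"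
      using weight_sequence_pos[OF \<beta>, of k] by (simp flip: of_real_mult)
    then show ?thesis using weight_sequence_pos[OF \<beta>, of k]
      by (simp add: h2_coeff_def cinner.scaleR_left cinner.scaleR_right scaleR_conv_of_real)
  qed
  then show ?thesis by (simp add: H2_cinner_def cinner_ell2_def)
qed

lemma H2_ex_h2_coeff:
  assumes "f \<in> H2 \<beta>" obtains x where "f = h2_coeff \<beta> x"
proof
  have pos: "0 < \<beta> j" for j using \<beta> by (rule weight_sequence_pos)
  have "(norm (sqrt (\<beta> k) *\<^sub>R f k))\<^sup>2 = \<beta> k * (norm (f k))\<^sup>2" for k
    using pos[of k] by (simp add: power_mult_distrib)
  then have "summable (\<lambda>k. (norm (sqrt (\<beta> k) *\<^sub>R f k))\<^sup>2)" using assms by (simp add: H2_def)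
  then show "f = h2_coeff \<beta> (Abs_ell2 (\<lambda>k. sqrt (\<beta> k) *\<^sub>R f k))"
    using pos by (auto simp: h2_coeff_def ell2_nth_Abs less_imp_neq[THEN not_sym])
qed

lemma summable_norm_h2_coeff:
  assumes z: "z \<in> \<bbbD>"
  shows "summable (\<lambda>k. norm (z ^ k *\<^sub>C h2_coeff \<beta> x k))"
proof -
  have "summable (\<lambda>k. (norm (cmod z ^ k / sqrt (\<beta> k)))\<^sup>2)"
    using summable_disk_weight[OF disk_weight_weight_sequence[OF \<beta>] z, of "1::complex"]
    by (simp add: norm_scaleC norm_mult norm_power norm_divide)
  moreover have "summable (\<lambda>k. (norm (norm (ell2_nth x k)))\<^sup>2)" by (simp add: summable_ell2)
  ultimately have "summable (\<lambda>k. norm (cmod z ^ k / sqrt (\<beta> k)) * norm (norm (ell2_nth x k)))"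
    by (rule summable_norm_product)
  then show ?thesis by (simp add: h2_coeff_def norm_scaleC norm_power)
qed

lemma ps_eval_sums:
  fixes x :: "'a::complex_hilbert ell2"
  assumes z: "z \<in> \<bbbD>"
  shows "(\<lambda>k. z ^ k *\<^sub>C h2_coeff \<beta> x k) sums ps_eval (h2_coeff \<beta> x) z"
  unfolding ps_eval_def by (rule summable_sums[OF summable_norm_cancel[OF summable_norm_h2_coeff[OF z]]])

text \<open>The reproducing property, read in \<open>ell2\<close> coordinates.\<close>

lemma cinner_ps_eval:
  fixes x :: "'a::complex_hilbert ell2"
  assumes z: "z \<in> \<bbbD>"
  shows "cinner (ps_eval (h2_coeff \<beta> x) z) y = cinner x (kvec (\<lambda>j. 1 / sqrt (\<beta> j)) z y)"
proof -
  have "(\<lambda>k. cinner (z ^ k *\<^sub>C h2_coeff \<beta> x k) y) sums cinner (ps_eval (h2_coeff \<beta> x) z) y"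
    by (rule bounded_linear.sums[OF cinner.bounded_linear_left ps_eval_sums[OF z]])
  then show ?thesis
    using cinner_kvec_sums[OF disk_weight_weight_sequence[OF \<beta>] z, of x y] sums_unique2
    by (simp add: cinner_scaleC_left h2_coeff_def cinner.scaleR_left scaleR_conv_of_real mult_ac)
      blast
qed

lemma ps_eval_inject:
  fixes x x' :: "'a::complex_hilbert ell2"
  assumes "\<And>z. z \<in> \<bbbD> \<Longrightarrow> ps_eval (h2_coeff \<beta> x) z = ps_eval (h2_coeff \<beta> x') z"
  shows "x = x'"
proof -
  have "x - x' = 0"
  proof (rule kvec_total[OF disk_weight_weight_sequence[OF \<beta>]])
    show "1 / sqrt (\<beta> j) \<noteq> 0" for j using weight_sequence_pos[OF \<beta>, of j] by simp
    show "cinner (x - x') (kvec (\<lambda>j. 1 / sqrt (\<beta> j)) z y) = 0" if "z \<in> \<bbbD>" for z y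
      unfolding cinner.diff_left by (simp add: cinner_ps_eval[OF that, symmetric] assms[OF that])
  qed
  then show ?thesis by simp
qed

end

lemma szego_eval:
  fixes x :: "'a::complex_hilbert ell2"
  assumes z: "z \<in> \<bbbD>"
  shows "cinner (ps_eval (ell2_nth x) z) y = cinner x (kvec (\<lambda>_. 1) z y)"
  using cinner_ps_eval[OF weight_sequence_one z, of x y] by (simp add: h2_coeff_one)

text \<open>\<open>W\<close> is the adjoint of the multiplication operator. The multiplier condition
  only provides some image for each function; that the chosen images depend linearly on it follows
  from their pairings with kernel vectors.\<close>

lemma multiplier_adjoint:
  fixes S :: "complex \<Rightarrow> 'u::complex_hilbert \<Rightarrow> 'y::complex_hilbert"
  assumes \<beta>: "weight_sequence \<beta>" and S: "S \<in> schur_multipliers \<beta>"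
  obtains W where "bounded_clinear W" "\<And>x. norm (W x) \<le> norm x"
    "\<And>z y. z \<in> \<bbbD> \<Longrightarrow> W (kvec (\<lambda>j. 1 / sqrt (\<beta> j)) z y) = kvec (\<lambda>_. 1) z (cadjoint (S z) y)"
proof -
  have bS: "\<And>z. z \<in> \<bbbD> \<Longrightarrow> bounded_clinear (S z)" using S by (simp add: schur_multipliers_def)
  have "\<exists>y. (\<forall>z\<in>\<bbbD>. ps_eval (h2_coeff \<beta> y) z = S z (ps_eval (ell2_nth x) z)) \<and> norm y \<le> norm x" for x
  proof -
    have "ell2_nth x \<in> H2 one_weight" by (simp add: H2_def summable_ell2)
    then obtain g where g: "g \<in> H2 \<beta>" "\<forall>z\<in>\<bbbD>. ps_eval g z = S z (ps_eval (ell2_nth x) z)"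
        "H2_norm \<beta> g \<le> H2_norm one_weight (ell2_nth x)"
      using S unfolding schur_multipliers_def by blast
    obtain y where y: "g = h2_coeff \<beta> y" using H2_ex_h2_coeff[OF \<beta> g(1)] .
    have "norm y \<le> norm x"
      using g(3) H2_norm_h2_coeff[OF \<beta>, of y] H2_norm_h2_coeff[OF weight_sequence_one, of x]
      by (simp add: y h2_coeff_one)
    then show ?thesis using g(2) y by blast
  qed
  then obtain M where M: "\<And>x z. z \<in> \<bbbD> \<Longrightarrow> ps_eval (h2_coeff \<beta> (M x)) z = S z (ps_eval (ell2_nth x) z)"
      and nM: "\<And>x. norm (M x) \<le> norm x" by metis
  have M': "cinner (M x) (kvec (\<lambda>j. 1 / sqrt (\<beta> j)) z y) = cinner x (kvec (\<lambda>_. 1) z (cadjoint (S z) y))"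
    if z: "z \<in> \<bbbD>" for x z y
    using cinner_ps_eval[OF \<beta> z, of "M x" y]
    by (simp add: M[OF z] cinner_cadjoint[OF bS[OF z]] szego_eval[OF z])
  have uniq: "v = w" if "\<And>z y. z \<in> \<bbbD> \<Longrightarrow> cinner v (kvec (\<lambda>j. 1 / sqrt (\<beta> j)) z y) = cinner w (kvec (\<lambda>j. 1 / sqrt (\<beta> j)) z y)" for v w :: "'y ell2"
    by (rule ps_eval_inject[OF \<beta>], rule cinner_ext) (simp add: cinner_ps_eval[OF \<beta>] that)
  have bM: "bounded_clinear M"
  proof (rule bounded_clinearI[of _ 1])
    show "M (x + y) = M x + M y" for x y
      by (rule uniq) (simp add: M' cinner.add_left)
    show "M (c *\<^sub>C x) = c *\<^sub>C M x" for c x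
      by (rule uniq) (simp add: M' cinner_scaleC_left)
  qed (simp add: nM)
  show ?thesis
  proof
    show "bounded_clinear (cadjoint M)" by (rule bounded_clinear_cadjoint[OF bM])
    show "norm (cadjoint M x) \<le> norm x" for x
      using norm_cadjoint_le[OF bM, of 1] nM by simp
    show "cadjoint M (kvec (\<lambda>j. 1 / sqrt (\<beta> j)) z y) = kvec (\<lambda>_. 1) z (cadjoint (S z) y)" if "z \<in> \<bbbD>" for z y
      by (rule cadjoint_eqI[OF bM]) (simp add: M'[OF that])
  qed
qed

text \<open>Pairing \<open>cadjoint W x\<close> with kernel vectors identifies it as the product of
  \<open>S\<close> and \<open>x\<close>. Its values on the disk single it out in
  \<open>H2 \<beta>\<close>, as the definite description in \<open>mult_op\<close> requires.\<close>

lemma multiplier_of_adjoint: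
  fixes S :: "complex \<Rightarrow> 'u::complex_hilbert \<Rightarrow> 'y::complex_hilbert"
  assumes \<beta>: "weight_sequence \<beta>" and S: "\<And>z. z \<in> \<bbbD> \<Longrightarrow> bounded_clinear (S z)"
    and W: "bounded_clinear W" "\<And>x. norm (W x) \<le> norm x"
    and kv: "\<And>z y. z \<in> \<bbbD> \<Longrightarrow> W (kvec (\<lambda>j. 1 / sqrt (\<beta> j)) z y) = kvec (\<lambda>_. 1) z (cadjoint (S z) y)"
  shows "S \<in> schur_multipliers \<beta>"
    and "z \<in> \<bbbD> \<Longrightarrow> ps_eval (h2_coeff \<beta> (cadjoint W x)) z = S z (ps_eval (ell2_nth x) z)"
    and "mult_op \<beta> S (ell2_nth x) = h2_coeff \<beta> (cadjoint W x)"
proof -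
  have ev: "ps_eval (h2_coeff \<beta> (cadjoint W x)) z = S z (ps_eval (ell2_nth x) z)" if z: "z \<in> \<bbbD>" for x z
    by (rule cinner_ext)
      (simp add: cinner_ps_eval[OF \<beta> z] cinner_cadjoint_left[OF W(1)] kv[OF z]
        cinner_cadjoint[OF S[OF z]] szego_eval[OF z])
  show "S \<in> schur_multipliers \<beta>"
    unfolding schur_multipliers_def
  proof (intro CollectI conjI ballI)
    fix f :: "nat \<Rightarrow> 'u" assume "f \<in> H2 one_weight"
    then obtain x where x: "f = ell2_nth x"
      using H2_ex_h2_coeff[OF weight_sequence_one] by (metis h2_coeff_one)
    have "norm (cadjoint W x) \<le> norm x" using norm_cadjoint_le[OF W(1), of 1] W(2) by simp
    then have "H2_norm \<beta> (h2_coeff \<beta> (cadjoint W x)) \<le> H2_norm one_weight f"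
      using H2_norm_h2_coeff[OF \<beta>, of "cadjoint W x"] H2_norm_h2_coeff[OF weight_sequence_one, of x] by (simp add: x h2_coeff_one)
    then show "\<exists>g\<in>H2 \<beta>. (\<forall>z\<in>\<bbbD>. ps_eval g z = S z (ps_eval f z)) \<and> H2_norm \<beta> g \<le> H2_norm one_weight f"
      using h2_coeff_in_H2[OF \<beta>] ev x by blast
  qed (rule S)
  show "ps_eval (h2_coeff \<beta> (cadjoint W x)) z = S z (ps_eval (ell2_nth x) z)" if "z \<in> \<bbbD>"
    by (rule ev[OF that])
  show "mult_op \<beta> S (ell2_nth x) = h2_coeff \<beta> (cadjoint W x)"
    unfolding mult_op_def
  proof (rule the_equality)
    show "h2_coeff \<beta> (cadjoint W x) \<in> H2 \<beta> \<and> (\<forall>z\<in>\<bbbD>. ps_eval (h2_coeff \<beta> (cadjoint W x)) z = S z (ps_eval (ell2_nth x) z))"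
      using h2_coeff_in_H2[OF \<beta>] ev by blast
    fix g assume g: "g \<in> H2 \<beta> \<and> (\<forall>z\<in>\<bbbD>. ps_eval g z = S z (ps_eval (ell2_nth x) z))"
    then obtain y where y: "g = h2_coeff \<beta> y" using H2_ex_h2_coeff[OF \<beta>] by blast
    have "y = cadjoint W x" by (rule ps_eval_inject[OF \<beta>]) (use g y ev in auto)
    then show "g = h2_coeff \<beta> (cadjoint W x)" by (simp add: y)
  qed
qed

section \<open>Monomials and the shift\<close>

definition ell2_unit :: "nat \<Rightarrow> 'a::complex_inner \<Rightarrow> 'a ell2"
  where "ell2_unit k u = Abs_ell2 (\<lambda>j. if j = k then u else 0)"

lemma nth_ell2_unit: "ell2_nth (ell2_unit k u) j = (if j = k then u else 0)"
proof -
  have "summable (\<lambda>j. (norm (if j = k then u else 0))\<^sup>2)"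
    by (rule summable_finite[of "{k}"]) auto
  then show ?thesis by (simp add: ell2_unit_def ell2_nth_Abs)
qed

lemma cinner_ell2_unit: "cinner x (ell2_unit k u) = cinner (ell2_nth x k) u"
proof -
  have "(\<lambda>j. cinner (ell2_nth x j) (ell2_nth (ell2_unit k u) j)) sums cinner (ell2_nth x k) u"
    using sums_If_finite[of "\<lambda>j. j = k" "\<lambda>j. cinner (ell2_nth x j) u"]
    by (simp add: nth_ell2_unit if_distrib[of "cinner _"] cong: if_cong)
  then show ?thesis using cinner_sums_ell2 sums_unique2 by blast
qed

lemma ps_eval_ell2_unit: "ps_eval (ell2_nth (ell2_unit k u)) z = z ^ k *\<^sub>C u"
proof -
  have "(\<Sum>j. z ^ j *\<^sub>C ell2_nth (ell2_unit k u) j) = (\<Sum>j\<in>{k}. z ^ j *\<^sub>C ell2_nth (ell2_unit k u) j)"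
    by (rule suminf_finite) (auto simp: nth_ell2_unit)
  then show ?thesis by (simp add: ps_eval_def nth_ell2_unit)
qed

lemma H2_const_eq: "H2_const u = ell2_nth (ell2_unit 0 u)"
  by (auto simp: H2_const_def nth_ell2_unit)

text \<open>Multiplication by \<open>S\<close> commutes with multiplication by \<open>z ^ k\<close>,
  so the coefficients for the monomial are those for the constant \<open>u\<close> moved up by
  \<open>k\<close>.\<close>

lemma h2_coeff_mult_unit:
  fixes S :: "complex \<Rightarrow> 'u::complex_hilbert \<Rightarrow> 'y::complex_hilbert"
  assumes \<beta>: "weight_sequence \<beta>" and S: "\<And>z. z \<in> \<bbbD> \<Longrightarrow> bounded_clinear (S z)"
    and W: "bounded_clinear W" "\<And>x. norm (W x) \<le> norm x"
    and kv: "\<And>z y. z \<in> \<bbbD> \<Longrightarrow> W (kvec (\<lambda>j. 1 / sqrt (\<beta> j)) z y) = kvec (\<lambda>_. 1) z (cadjoint (S z) y)"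
  shows "h2_coeff \<beta> (cadjoint W (ell2_unit k u)) j
    = (if j < k then 0 else h2_coeff \<beta> (cadjoint W (ell2_unit 0 u)) (j - k))"
proof -
  let ?g = "\<lambda>k. h2_coeff \<beta> (cadjoint W (ell2_unit k u))"
  let ?s = "\<lambda>j. if j < k then 0 else ?g 0 (j - k)"
  have "?g k j - ?s j = 0"
  proof (rule power_series_coeff_zero[where f = "\<lambda>j. ?g k j - ?s j"])
    fix z :: complex assume z: "z \<in> \<bbbD>"
    have ev: "ps_eval (h2_coeff \<beta> (cadjoint W x)) z = S z (ps_eval (ell2_nth x) z)" for x
      by (rule multiplier_of_adjoint(2)[OF \<beta> S W kv z])
    have "(\<lambda>j. z ^ k *\<^sub>C (z ^ j *\<^sub>C ?g 0 j)) sums (z ^ k *\<^sub>C ps_eval (?g 0) z)"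
      by (rule bounded_linear.sums[OF scaleC.bounded_linear_right ps_eval_sums[OF \<beta> z]])
    then have "(\<lambda>j. z ^ (j + k) *\<^sub>C ?s (j + k)) sums (z ^ k *\<^sub>C ps_eval (?g 0) z)"
      by (simp add: scaleC_scaleC power_add mult.commute)
    then have "(\<lambda>j. z ^ j *\<^sub>C ?s j) sums (z ^ k *\<^sub>C ps_eval (?g 0) z + (\<Sum>j<k. z ^ j *\<^sub>C ?s j))"
      by (simp only: sums_iff_shift[of "\<lambda>j. z ^ j *\<^sub>C ?s j"] add_diff_cancel)
    moreover have "(\<Sum>j<k. z ^ j *\<^sub>C ?s j) = 0" by simp
    ultimately have s: "(\<lambda>j. z ^ j *\<^sub>C ?s j) sums (z ^ k *\<^sub>C ps_eval (?g 0) z)" by simp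
    have "ps_eval (?g k) z = z ^ k *\<^sub>C ps_eval (?g 0) z"
      by (simp add: ev ps_eval_ell2_unit bounded_clinear_scaleC[OF S[OF z]])
    then show "(\<lambda>j. z ^ j *\<^sub>C (?g k j - ?s j)) sums 0"
      using sums_diff[OF ps_eval_sums[OF \<beta> z] s, of "cadjoint W (ell2_unit k u)"]
      by (simp only: scaleC.diff_right diff_self)
  qed
  then show ?thesis by simp
qed

section \<open>Contractivity of Schur functions as multipliers\<close>

text \<open>For \<open>k \<noteq> l\<close> the ratio \<open>q\<close> is an \<open>n\<close>-th
  root of unity other than 1, so the geometric sum vanishes.\<close>

lemma sum_powers_roots_unity:
  assumes "k < n" "l < n"
  shows "(\<Sum>m<n. (cis (2 * pi * real k / real n) * cnj (cis (2 * pi * real l / real n))) ^ m)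
    = (if k = l then of_nat n else 0)"
proof -
  let ?w = "\<lambda>k. cis (2 * pi * real k / real n)"
  define q where "q = ?w k * cnj (?w l)"
  have n: "n > 0" using assms by simp
  have unit: "?w j * cnj (?w j) = 1" for j using complex_norm_square[of "?w j"] by simp
  have wn: "?w j ^ n = 1" for j
  proof -
    have "?w j ^ n = cis (2 * pi * real j)" unfolding Complex.DeMoivre using n by simp
    then show ?thesis using cis_multiple_2pi[of "real j"] by simp
  qed
  show ?thesis
  proof (cases "k = l")
    case True then show ?thesis by (simp add: unit)
  next
    case False
    have "q \<noteq> 1"
    proof
      assume "q = 1"
      have "?w k = ?w k * (?w l * cnj (?w l))" by (simp only: unit mult_1_right)
      also have "\<dots> = q * ?w l" by (simp only: q_def mult_ac)
      finally have "?w k = ?w l" using \<open>q = 1\<close> by (simp only: mult_1_left)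
      moreover have "inj_on ?w {..<n}" using Complex.bij_betw_roots_unity[OF n] by (simp add: bij_betw_def)
      ultimately show False using False assms by (auto simp: inj_on_def)
    qed
    moreover have "q ^ n = 1" by (simp add: q_def power_mult_distrib wn flip: complex_cnj_power)
    ultimately have "(\<Sum>m<n. q ^ m) = 0" by (simp add: geometric_sum)
    then show ?thesis using False by (simp add: q_def)
  qed
qed

lemma discrete_parseval:
  fixes a :: "nat \<Rightarrow> 'a::complex_inner"
  shows "(\<Sum>m<n. (norm (\<Sum>k<n. (cis (2 * pi * real k / real n)) ^ m *\<^sub>C a k))\<^sup>2) = real n * (\<Sum>k<n. (norm (a k))\<^sup>2)"
proof -
  let ?w = "\<lambda>k. cis (2 * pi * real k / real n)"
  have "complex_of_real (\<Sum>m<n. (norm (\<Sum>k<n. ?w k ^ m *\<^sub>C a k))\<^sup>2)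
      = (\<Sum>m<n. \<Sum>k<n. \<Sum>l<n. (?w k * cnj (?w l)) ^ m * cinner (a k) (a l))"
    unfolding of_real_sum norm_square_sum_cinner
    by (simp add: cinner_scaleC_left cinner_scaleC_right power_mult_distrib mult_ac)
  also have "\<dots> = (\<Sum>k<n. \<Sum>m<n. \<Sum>l<n. (?w k * cnj (?w l)) ^ m * cinner (a k) (a l))"
    by (rule sum.swap)
  also have "\<dots> = (\<Sum>k<n. \<Sum>l<n. \<Sum>m<n. (?w k * cnj (?w l)) ^ m * cinner (a k) (a l))"
    by (intro sum.cong sum.swap refl)
  also have "\<dots> = (\<Sum>k<n. \<Sum>l<n. (if k = l then of_nat n else 0) * cinner (a k) (a l))"
    by (intro sum.cong refl) (simp only: sum_distrib_right[symmetric] sum_powers_roots_unity lessThan_iff)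
  also have "\<dots> = (\<Sum>k<n. of_nat n * cinner (a k) (a k))"
    by (intro sum.cong refl) (simp add: if_distrib[of "\<lambda>c. c * _"] cong: if_cong)
  also have "\<dots> = complex_of_real (real n * (\<Sum>k<n. (norm (a k))\<^sup>2))"
    by (simp add: cinner_self_eq sum_distrib_left)
  finally show ?thesis by (simp only: of_real_eq_iff)
qed

lemma L2_set_discrete_parseval:
  fixes a :: "nat \<Rightarrow> 'a::complex_inner"
  shows "L2_set (\<lambda>m. norm (\<Sum>k<n. (of_real r * cis (2 * pi * real m / real n)) ^ k *\<^sub>C a k)) {..<n}
    = sqrt (real n) * sqrt (\<Sum>k<n. (r ^ k * norm (a k))\<^sup>2)"
proof -
  have "(of_real r * cis (2 * pi * real m / real n)) ^ k *\<^sub>C a k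
      = cis (2 * pi * real k / real n) ^ m *\<^sub>C (of_real (r ^ k) *\<^sub>C a k)" for m k
    by (simp add: power_mult_distrib scaleC_scaleC Complex.DeMoivre mult_ac)
  then have "L2_set (\<lambda>m. norm (\<Sum>k<n. (of_real r * cis (2 * pi * real m / real n)) ^ k *\<^sub>C a k)) {..<n}
      = sqrt (\<Sum>m<n. (norm (\<Sum>k<n. cis (2 * pi * real k / real n) ^ m *\<^sub>C (of_real (r ^ k) *\<^sub>C a k)))\<^sup>2)"
    by (simp add: L2_set_def)
  also have "\<dots> = sqrt (real n * (\<Sum>k<n. (r ^ k * norm (a k))\<^sup>2))"
    unfolding discrete_parseval by (simp add: norm_scaleC norm_power power_mult_distrib flip: power_abs)
  finally show ?thesis by (simp add: real_sqrt_mult)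
qed

text \<open>Parseval's identity over the \<open>n\<close>-th roots of unity replaces integration over the circle of
  radius \<open>r\<close>; the series are truncated at \<open>n\<close>.\<close>

lemma power_series_norm_comparison:
  fixes g :: "nat \<Rightarrow> 'b::complex_hilbert" and x :: "nat \<Rightarrow> 'a::complex_hilbert"
  assumes g: "\<And>z. z \<in> \<bbbD> \<Longrightarrow> summable (\<lambda>k. norm (z ^ k *\<^sub>C g k))"
    and x: "\<And>z. z \<in> \<bbbD> \<Longrightarrow> summable (\<lambda>k. norm (z ^ k *\<^sub>C x k))"
    and le: "\<And>z. z \<in> \<bbbD> \<Longrightarrow> norm (ps_eval g z) \<le> norm (ps_eval x z)"
    and B: "\<And>n. (\<Sum>k<n. (norm (x k))\<^sup>2) \<le> B\<^sup>2" "0 \<le> B"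
  shows "(\<Sum>k<N. (norm (g k))\<^sup>2) \<le> B\<^sup>2"
proof -
  have *: "sqrt (\<Sum>k<N. (r ^ k * norm (g k))\<^sup>2) \<le> B" if r: "0 \<le> r" "r < 1" for r
  proof -
    have rD: "of_real r * cis t \<in> \<bbbD>" for t using r by (simp add: norm_mult)
    have sg: "summable (\<lambda>k. r ^ k * norm (g k))" and sx: "summable (\<lambda>k. r ^ k * norm (x k))"
      using g[OF rD[of 0]] x[OF rD[of 0]] r by (simp_all add: norm_scaleC norm_power)
    \<comment> \<open>The two tails beyond \<open>n\<close> at radius \<open>r\<close>: the cost of
      truncation.\<close>
    define e where "e n = (\<Sum>k. r ^ (k + n) * norm (g (k + n))) + (\<Sum>k. r ^ (k + n) * norm (x (k + n)))" for n
    have e: "e \<longlonglongrightarrow> 0"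
      unfolding e_def using tendsto_add[OF suminf_exist_split2[OF sg] suminf_exist_split2[OF sx]] by simp
    have tail: "norm (ps_eval h z - (\<Sum>k<n. z ^ k *\<^sub>C h k)) \<le> (\<Sum>k. r ^ (k + n) * norm (h (k + n)))"
      if h: "summable (\<lambda>k. norm (z ^ k *\<^sub>C h k))" and z: "cmod z = r" for h :: "nat \<Rightarrow> 'c::complex_hilbert" and z n
    proof -
      have "ps_eval h z - (\<Sum>k<n. z ^ k *\<^sub>C h k) = (\<Sum>k. z ^ (k + n) *\<^sub>C h (k + n))"
        unfolding ps_eval_def using suminf_split_initial_segment[OF summable_norm_cancel[OF h], of n] by simp
      also have "norm \<dots> \<le> (\<Sum>k. norm (z ^ (k + n) *\<^sub>C h (k + n)))"
        by (rule summable_norm) (use h in \<open>simp only: summable_iff_shift[of "\<lambda>k. norm (z ^ k *\<^sub>C h k)"]\<close>)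
      finally show ?thesis by (simp add: norm_scaleC norm_power z)
    qed
    have main: "sqrt (\<Sum>k<N. (r ^ k * norm (g k))\<^sup>2) \<le> B + e n" if n: "n \<ge> max N 1" for n
    proof -
      let ?z = "\<lambda>m. of_real r * cis (2 * pi * real m / real n)"
      have zr: "cmod (?z m) = r" for m using r by (simp add: norm_mult)
      have n0: "sqrt (real n) > 0" using n by simp
      have pw: "norm (\<Sum>k<n. ?z m ^ k *\<^sub>C g k) \<le> norm (\<Sum>k<n. ?z m ^ k *\<^sub>C x k) + e n" for m
      proof -
        have "norm (\<Sum>k<n. ?z m ^ k *\<^sub>C g k) \<le> norm (ps_eval g (?z m)) + (\<Sum>k. r ^ (k + n) * norm (g (k + n)))"
          using tail[OF g[OF rD] zr, of m n] norm_triangle_ineq3[of "ps_eval g (?z m)" "\<Sum>k<n. ?z m ^ k *\<^sub>C g k"] by linarith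
        moreover have "norm (ps_eval x (?z m)) \<le> norm (\<Sum>k<n. ?z m ^ k *\<^sub>C x k) + (\<Sum>k. r ^ (k + n) * norm (x (k + n)))"
          using tail[OF x[OF rD] zr, of m n] norm_triangle_ineq3[of "ps_eval x (?z m)" "\<Sum>k<n. ?z m ^ k *\<^sub>C x k"] by linarith
        ultimately show ?thesis using le[OF rD, of "2 * pi * real m / real n"] by (simp add: e_def)
      qed
      have "0 \<le> e n" using sg sx r by (auto simp: e_def intro!: add_nonneg_nonneg suminf_nonneg summable_ignore_initial_segment)
      \<comment> \<open>The pointwise bound at the roots of unity is summed by Minkowski's
        inequality; the common factor \<open>sqrt (real n)\<close> cancels afterwards.\<close>
      have "sqrt (real n) * sqrt (\<Sum>k<n. (r ^ k * norm (g k))\<^sup>2) \<le> L2_set (\<lambda>m. norm (\<Sum>k<n. ?z m ^ k *\<^sub>C x k) + e n) {..<n}"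
        unfolding L2_set_discrete_parseval[symmetric] by (rule L2_set_mono) (auto intro: pw)
      also have "\<dots> \<le> L2_set (\<lambda>m. norm (\<Sum>k<n. ?z m ^ k *\<^sub>C x k)) {..<n} + L2_set (\<lambda>m. e n) {..<n}"
        by (rule L2_set_triangle_ineq)
      also have "L2_set (\<lambda>m. e n) {..<n} = sqrt (real n) * e n"
        using \<open>0 \<le> e n\<close> by (simp add: L2_set_constant)
      also have "L2_set (\<lambda>m. norm (\<Sum>k<n. ?z m ^ k *\<^sub>C x k)) {..<n} = sqrt (real n) * sqrt (\<Sum>k<n. (r ^ k * norm (x k))\<^sup>2)"
        by (rule L2_set_discrete_parseval)
      finally have "sqrt (\<Sum>k<n. (r ^ k * norm (g k))\<^sup>2) \<le> sqrt (\<Sum>k<n. (r ^ k * norm (x k))\<^sup>2) + e n"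
        using n0 by (simp flip: distrib_left)
      moreover have "sqrt (\<Sum>k<n. (r ^ k * norm (x k))\<^sup>2) \<le> B"
      proof (rule real_le_lsqrt)
        have "(\<Sum>k<n. (r ^ k * norm (x k))\<^sup>2) \<le> (\<Sum>k<n. (norm (x k))\<^sup>2)"
          using r by (intro sum_mono power_mono) (auto simp: power_le_one mult_left_le_one_le)
        also note B(1)
        finally show "(\<Sum>k<n. (r ^ k * norm (x k))\<^sup>2) \<le> B\<^sup>2" .
      qed (rule B(2))
      moreover have "sqrt (\<Sum>k<N. (r ^ k * norm (g k))\<^sup>2) \<le> sqrt (\<Sum>k<n. (r ^ k * norm (g k))\<^sup>2)"
        using n by (intro real_sqrt_le_mono sum_mono2) auto
      ultimately show ?thesis by linarith
    qed
    show ?thesis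
    proof (rule tendsto_lowerbound)
      show "(\<lambda>n. B + e n) \<longlonglongrightarrow> B" using tendsto_add[OF tendsto_const[of B] e] by simp
      show "\<forall>\<^sub>F n in sequentially. sqrt (\<Sum>k<N. (r ^ k * norm (g k))\<^sup>2) \<le> B + e n"
        using main by (rule eventually_sequentiallyI)
    qed simp
  qed
  \<comment> \<open>The sum is finite, so \<open>r\<close> may tend to 1 from below.\<close>
  have "((\<lambda>r. sqrt (\<Sum>k<N. (r ^ k * norm (g k))\<^sup>2)) \<longlongrightarrow> sqrt (\<Sum>k<N. (1 ^ k * norm (g k))\<^sup>2)) (at_left 1)"
    by (intro tendsto_intros)
  moreover have "\<forall>\<^sub>F r in at_left 1. sqrt (\<Sum>k<N. (r ^ k * norm (g k))\<^sup>2) \<le> B"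
    unfolding eventually_at_left_field by (intro exI[of _ 0]) (auto intro: *)
  ultimately have "sqrt (\<Sum>k<N. (1 ^ k * norm (g k))\<^sup>2) \<le> B"
    by (intro tendsto_upperbound) auto
  then show ?thesis using B(2) by (simp add: real_sqrt_le_iff' sqrt_le_D)
qed

text \<open>The scalar Taylor coefficients \<open>a k y\<close> are conjugate linear in
  \<open>y\<close> and bounded by Cauchy's estimates on circles; Riesz representation assembles them
  into vectors \<open>g k\<close>.\<close>

lemma weakly_holomorphic_power_series:
  fixes \<phi> :: "complex \<Rightarrow> 'b::complex_hilbert"
  assumes hol: "\<And>y. (\<lambda>z. cinner (\<phi> z) y) holomorphic_on \<bbbD>"
    and bd: "\<And>r. 0 < r \<Longrightarrow> r < 1 \<Longrightarrow> \<exists>B. \<forall>z. cmod z = r \<longrightarrow> norm (\<phi> z) \<le> B"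
  obtains g where "\<And>z. z \<in> \<bbbD> \<Longrightarrow> summable (\<lambda>k. norm (z ^ k *\<^sub>C g k))" "\<And>z. z \<in> \<bbbD> \<Longrightarrow> ps_eval g z = \<phi> z"
proof -
  define a where "a k y = (deriv ^^ k) (\<lambda>z. cinner (\<phi> z) y) 0 / fact k" for k y
  have a_bd: "\<exists>B\<ge>0. \<forall>k y. cmod (a k y) \<le> B / r ^ k * norm y" if r: "0 < r" "r < 1" for r
  proof -
    obtain B where B: "\<And>z. cmod z = r \<Longrightarrow> norm (\<phi> z) \<le> B" using bd[OF r] by blast
    have "cmod (complex_of_real r) = r" using r by simp
    then have "0 \<le> B" using B norm_ge_zero order_trans by blast
    moreover have "cmod (a k y) \<le> B / r ^ k * norm y" for k y
    proof -
      have "cball 0 r \<subseteq> \<bbbD>" "ball 0 r \<subseteq> \<bbbD>" using r by auto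
      then have "(\<lambda>z. cinner (\<phi> z) y) holomorphic_on ball 0 r" "continuous_on (cball 0 r) (\<lambda>z. cinner (\<phi> z) y)"
        using hol[of y] by (auto intro: holomorphic_on_subset holomorphic_on_imp_continuous_on)
      then have "cmod ((deriv ^^ k) (\<lambda>z. cinner (\<phi> z) y) 0) \<le> fact k * (B * norm y) / r ^ k"
      proof (rule Cauchy_inequality)
        fix z assume "cmod (0 - z) = r"
        then have "norm (\<phi> z) * norm y \<le> B * norm y" using B by (intro mult_right_mono) auto
        then show "cmod (cinner (\<phi> z) y) \<le> B * norm y" using norm_cinner_le order_trans by blast
      qed (use r in auto)
      then show ?thesis by (simp add: a_def norm_divide field_simps)
    qed
    ultimately show ?thesis by blast
  qed
  have an: "(\<lambda>z. cinner (\<phi> z) y) analytic_on {0}" for y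
    unfolding analytic_at using hol[of y] by (intro exI[of _ "\<bbbD>"]) auto
  have "\<exists>g. \<forall>y. cnj (a k y) = cinner y g" for k
  proof (rule riesz_representation)
    obtain B where B: "\<And>k y. cmod (a k y) \<le> B / (1 / 2) ^ k * norm y" using a_bd[of "1 / 2"] by auto
    show "bounded_clinear (\<lambda>y. cnj (a k y))"
    proof (rule bounded_clinearI)
      show "norm (cnj (a k y)) \<le> B / (1 / 2) ^ k * norm y" for y using B by simp
      show "cnj (a k (x + y)) = cnj (a k x) + cnj (a k y)" for x y
        by (simp add: a_def cinner.add_right higher_deriv_add_at[OF an an] add_divide_distrib)
      show "cnj (a k (c *\<^sub>C y)) = c *\<^sub>C cnj (a k y)" for c y
        by (simp add: a_def cinner_scaleC_right higher_deriv_cmult'[OF an] scaleC_complex_def)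
    qed
  qed
  then obtain g where "\<And>k y. cnj (a k y) = cinner y (g k)" by metis
  then have g: "cinner (g k) y = a k y" for k y by (metis cinner_commute complex_cnj_cnj)
  have sum: "summable (\<lambda>k. norm (z ^ k *\<^sub>C g k))" if z: "z \<in> \<bbbD>" for z
  proof -
    obtain r where r: "cmod z < r" "r < 1" using z dense by auto
    then have r0: "0 < r" using norm_ge_zero le_less_trans by blast
    obtain B where B0: "0 \<le> B" and B: "\<And>k y. cmod (a k y) \<le> B / r ^ k * norm y" using a_bd[OF r0 r(2)] by blast
    have "norm (g k) \<le> B / r ^ k" for k
    proof (cases "g k = 0")
      case True
      show ?thesis using True r0 B0 by simp
    next
      case False
      have "norm (g k) * norm (g k) \<le> B / r ^ k * norm (g k)"
        using B[of k "g k"] by (simp add: g[symmetric] cinner_self_eq norm_mult power2_eq_square)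
      then show ?thesis by (rule mult_right_le_imp_le) (use False in simp)
    qed
    then have le: "norm (norm (z ^ k *\<^sub>C g k)) \<le> B * (cmod z / r) ^ k" for k
      using mult_left_mono[of "norm (g k)" "B / r ^ k" "cmod z ^ k"]
      by (simp add: norm_scaleC norm_power power_divide mult.commute)
    have "summable (\<lambda>k. B * (cmod z / r) ^ k)"
      using r r0 by (intro summable_mult summable_geometric) simp
    from summable_comparison_test'[OF this le] show ?thesis .
  qed
  have "ps_eval g z = \<phi> z" if z: "z \<in> \<bbbD>" for z
  proof (rule cinner_ext)
    fix y
    have "(\<lambda>k. z ^ k *\<^sub>C g k) sums ps_eval g z"
      unfolding ps_eval_def by (rule summable_sums[OF summable_norm_cancel[OF sum[OF z]]])
    from bounded_linear.sums[OF cinner.bounded_linear_left this, of y]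
    have "(\<lambda>k. a k y * z ^ k) sums cinner (ps_eval g z) y"
      by (simp add: cinner_scaleC_left g mult.commute)
    moreover have "(\<lambda>k. a k y * z ^ k) sums cinner (\<phi> z) y"
      using holomorphic_power_series[OF hol z, of y] by (simp add: a_def)
    ultimately show "cinner (ps_eval g z) y = cinner (\<phi> z) y" by (rule sums_unique2)
  qed
  with sum show ?thesis using that by blast
qed

lemma op_analytic_holomorphic:
  assumes F: "op_analytic F" and bc: "\<And>z. z \<in> \<bbbD> \<Longrightarrow> bounded_clinear (F z)"
  shows "(\<lambda>z. cinner (F z u) y) holomorphic_on \<bbbD>"
  unfolding holomorphic_on_open[OF open_ball]
proof
  fix z :: complex assume z: "z \<in> \<bbbD>"
  obtain F' where F': "bounded_clinear F'"
      "((\<lambda>w. onorm (\<lambda>x. inverse (w - z) *\<^sub>C (F w x - F z x) - F' x)) \<longlongrightarrow> 0) (at z)"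
    using F z unfolding op_analytic_def by blast
  let ?q = "\<lambda>w x. inverse (w - z) *\<^sub>C (F w x - F z x) - F' x"
  have "((\<lambda>w. (cinner (F w u) y - cinner (F z u) y) / (w - z) - cinner (F' u) y) \<longlongrightarrow> 0) (at z)"
  proof (rule Lim_null_comparison)
    have "\<forall>\<^sub>F w in at z. w \<in> \<bbbD>" using z by (intro eventually_at_in_open') auto
    then show "\<forall>\<^sub>F w in at z. cmod ((cinner (F w u) y - cinner (F z u) y) / (w - z) - cinner (F' u) y)
        \<le> onorm (?q w) * (norm u * norm y)"
    proof eventually_elim
      case (elim w)
      have "bounded_clinear (?q w)" by (intro bounded_clinear_intros bc elim z F'(1))
      then have "norm (?q w u) \<le> onorm (?q w) * norm u"
        by (intro onorm bounded_clinear_imp_bounded_linear)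
      have "(cinner (F w u) y - cinner (F z u) y) / (w - z) - cinner (F' u) y = cinner (?q w u) y"
        by (simp add: cinner.diff_left cinner_scaleC_left divide_inverse mult.commute)
      also have "cmod \<dots> \<le> norm (?q w u) * norm y" by (rule norm_cinner_le)
      also have "\<dots> \<le> onorm (?q w) * norm u * norm y" by (intro mult_right_mono norm_ge_zero) fact
      finally show ?case by (simp add: mult.assoc)
    qed
    show "((\<lambda>w. onorm (?q w) * (norm u * norm y)) \<longlongrightarrow> 0) (at z)"
      using tendsto_mult_right[OF F'(2), of "norm u * norm y"] by simp
  qed
  then have "((\<lambda>w. (cinner (F w u) y - cinner (F z u) y) / (w - z)) \<longlongrightarrow> cinner (F' u) y) (at z)"
    by (rule LIM_zero_cancel)
  then show "\<exists>f'. ((\<lambda>z. cinner (F z u) y) has_field_derivative f') (at z)"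
    unfolding has_field_derivative_iff by blast
qed

text \<open>The map on kernel vectors is the adjoint of multiplication by \<open>F\<close>. By
  duality it suffices to multiply the single function \<open>x\<close>, a finite sum of kernels: the
  product \<open>G\<close> has norm at most \<open>norm x\<close>, and its inner product with the
  right-hand sum is \<open>norm x\<close> squared.\<close>

theorem schur_class_kernel_contraction:
  fixes F :: "complex \<Rightarrow> 'a::complex_hilbert \<Rightarrow> 'b::complex_hilbert"
  assumes F: "F \<in> schur_class" and \<zeta>: "\<And>i. \<zeta> i \<in> \<bbbD>"
  shows "norm (\<Sum>i<n::nat. kvec (\<lambda>_. 1) (\<zeta> i) (cadjoint (F (\<zeta> i)) (w i))) \<le> norm (\<Sum>i<n. kvec (\<lambda>_. 1) (\<zeta> i) (w i))"
proof -
  have bc: "\<And>z. z \<in> \<bbbD> \<Longrightarrow> bounded_clinear (F z)" and le: "\<And>z x. z \<in> \<bbbD> \<Longrightarrow> norm (F z x) \<le> norm x"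
    using F by (auto simp: schur_class_def)
  define u where "u i = cadjoint (F (\<zeta> i)) (w i)" for i
  define x where "x = (\<Sum>i<n. kvec (\<lambda>_. 1) (\<zeta> i) (u i))"
  define \<phi> where "\<phi> z = F z (ps_eval (ell2_nth x) z)" for z
  have xe: "ps_eval (ell2_nth x) z = (\<Sum>i<n. (1 / (1 - z * cnj (\<zeta> i))) *\<^sub>C u i)" if z: "z \<in> \<bbbD>" for z
    by (rule cinner_ext)
      (simp add: szego_eval[OF z] x_def cinner.sum_left cinner_kvec_one[OF \<zeta> z] cinner_scaleC_left)
  have nz: "1 - z * cnj (\<zeta> i) \<noteq> 0" if "z \<in> \<bbbD>" for z i
    using norm_mult_lt_one[OF \<zeta> that] by (metis eq_iff_diff_eq_0 less_irrefl norm_one)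
  have "(\<lambda>z. cinner (\<phi> z) y) holomorphic_on \<bbbD>" for y
  proof -
    have "(\<lambda>z. \<Sum>i<n. 1 / (1 - z * cnj (\<zeta> i)) * cinner (F z (u i)) y) holomorphic_on \<bbbD>"
      using F by (intro holomorphic_intros op_analytic_holomorphic bc nz) (auto simp: schur_class_def)
    then show ?thesis
      by (rule holomorphic_transform)
        (simp add: \<phi>_def xe bounded_clinear_simps[OF bc] cinner.sum_left cinner_scaleC_left)
  qed
  moreover have "\<exists>B. \<forall>z. cmod z = r \<longrightarrow> norm (\<phi> z) \<le> B" if r: "0 < r" "r < 1" for r
  proof (intro exI allI impI)
    fix z assume z: "cmod z = r"
    then have zD: "z \<in> \<bbbD>" using r by simp
    have "norm (\<phi> z) \<le> norm (ps_eval (ell2_nth x) z)" unfolding \<phi>_def by (rule le[OF zD])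
    also have "\<dots> \<le> (\<Sum>i<n. norm ((1 / (1 - z * cnj (\<zeta> i))) *\<^sub>C u i))" unfolding xe[OF zD] by (rule norm_sum)
    also have "\<dots> \<le> (\<Sum>i<n. 1 / (1 - r) * norm (u i))"
    proof (intro sum_mono)
      fix i
      have "cmod (z * cnj (\<zeta> i)) \<le> r" using \<zeta>[of i] z r by (simp add: norm_mult mult_left_le)
      then have "1 - r \<le> cmod (1 - z * cnj (\<zeta> i))" using norm_triangle_ineq2[of 1 "z * cnj (\<zeta> i)"] by simp
      then have "1 / cmod (1 - z * cnj (\<zeta> i)) \<le> 1 / (1 - r)" using r by (intro divide_left_mono mult_pos_pos) auto
      then show "norm ((1 / (1 - z * cnj (\<zeta> i))) *\<^sub>C u i) \<le> 1 / (1 - r) * norm (u i)"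
        unfolding norm_scaleC norm_divide norm_one by (rule mult_right_mono) simp
    qed
    finally show "norm (\<phi> z) \<le> (\<Sum>i<n. 1 / (1 - r) * norm (u i))" .
  qed
  ultimately obtain g where g: "\<And>z. z \<in> \<bbbD> \<Longrightarrow> summable (\<lambda>k. norm (z ^ k *\<^sub>C g k))"
      "\<And>z. z \<in> \<bbbD> \<Longrightarrow> ps_eval g z = \<phi> z"
    using weakly_holomorphic_power_series[of \<phi>] by blast
  have sx: "summable (\<lambda>k. norm (z ^ k *\<^sub>C ell2_nth x k))" if "z \<in> \<bbbD>" for z
    using summable_norm_h2_coeff[OF weight_sequence_one that, of x] by (simp add: h2_coeff_one)
  have gb: "(\<Sum>k<N. (norm (g k))\<^sup>2) \<le> (norm x)\<^sup>2" for N
    by (rule power_series_norm_comparison[OF g(1) sx])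
      (simp_all add: g(2) \<phi>_def le sum_nth_le_norm_ell2)
  have sg: "summable (\<lambda>k. (norm (g k))\<^sup>2)"
    using gb[of "Suc _"] by (intro bounded_imp_summable[of _ "(norm x)\<^sup>2"]) (auto simp: lessThan_Suc_atMost)
  define G where "G = Abs_ell2 g"
  have G: "ell2_nth G = g" by (simp add: G_def ell2_nth_Abs sg)
  have "(norm G)\<^sup>2 \<le> (norm x)\<^sup>2"
    using suminf_le_const[OF sg gb] by (simp add: norm_ell2_square[of G] G)
  then have nG: "norm G \<le> norm x" by (rule power2_le_imp_le) simp
  have "cinner x x = (\<Sum>i<n. cinner x (kvec (\<lambda>_. 1) (\<zeta> i) (u i)))"
    by (simp add: x_def cinner.sum_right)
  also have "\<dots> = (\<Sum>i<n. cinner G (kvec (\<lambda>_. 1) (\<zeta> i) (w i)))"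
    by (simp add: szego_eval[OF \<zeta>, symmetric] u_def cinner_cadjoint[OF bc[OF \<zeta>], symmetric] G g(2)[OF \<zeta>] \<phi>_def)
  also have "\<dots> = cinner G (\<Sum>i<n. kvec (\<lambda>_. 1) (\<zeta> i) (w i))" by (simp add: cinner.sum_right)
  finally have "(norm x)\<^sup>2 = cmod (cinner G (\<Sum>i<n. kvec (\<lambda>_. 1) (\<zeta> i) (w i)))"
    by (metis cinner_self_eq norm_of_real abs_power2)
  also have "\<dots> \<le> norm G * norm (\<Sum>i<n. kvec (\<lambda>_. 1) (\<zeta> i) (w i))" by (rule norm_cinner_le)
  also have "\<dots> \<le> norm x * norm (\<Sum>i<n. kvec (\<lambda>_. 1) (\<zeta> i) (w i))" by (intro mult_right_mono nG) simp
  finally have "norm x \<le> norm (\<Sum>i<n. kvec (\<lambda>_. 1) (\<zeta> i) (w i))"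
    by (cases "x = 0") (auto simp: power2_eq_square)
  then show ?thesis by (simp add: x_def u_def)
qed

section \<open>Observability operators and the coefficient matrix function\<close>

text \<open>The observability operator in the \<open>ell2\<close> coordinates of
  \<open>H2 \<beta>\<close>.\<close>

definition obs_vec :: "(nat \<Rightarrow> real) \<Rightarrow> ('x::complex_inner \<Rightarrow> 'y::complex_inner) \<Rightarrow> ('x \<Rightarrow> 'x) \<Rightarrow> 'x \<Rightarrow> 'y ell2"
  where "obs_vec \<beta> E T x = Abs_ell2 (\<lambda>j. (1 / sqrt (\<beta> j)) *\<^sub>R E ((T ^^ j) x))"

lemma eq_scaleC_if_inverse: "c \<noteq> 0 \<Longrightarrow> inverse c *\<^sub>C x = y \<Longrightarrow> x = c *\<^sub>C y"
  by (auto simp: scaleC_scaleC)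

lemma bounded_clinear_funpow:
  fixes T :: "'a::complex_inner \<Rightarrow> 'a"
  assumes "bounded_clinear T" shows "bounded_clinear (T ^^ k)"
proof (induction k)
  case (Suc k) then show ?case using bounded_clinear_compose[OF assms Suc] by (simp add: o_def)
qed (simp add: bounded_clinear_ident id_def)

lemma of_real_inverse_sqrt_mult:
  "0 < b \<Longrightarrow> complex_of_real (1 / sqrt b) * complex_of_real (1 / sqrt b) = of_real (inverse b)"
  by (simp add: field_simps flip: of_real_mult)

text \<open>\<open>gamma_inv \<beta> j\<close> is a difference of consecutive reciprocals of
  \<open>\<beta>\<close>. The series of \<open>t\<close> is moved up by one place; the 0 inserted at
  index 0 agrees with \<open>gamma_inv \<beta> 0 = 1 = inverse (\<beta> 0)\<close>.\<close>

lemma gamma_inv_telescoping: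
  fixes c :: "nat \<Rightarrow> complex"
  assumes "weight_sequence \<beta>" "(\<lambda>j. of_real (inverse (\<beta> j)) * c j) sums s"
    "(\<lambda>j. of_real (inverse (\<beta> j)) * c (Suc j)) sums t"
  shows "(\<lambda>j. of_real (gamma_inv \<beta> j) * c j) sums (s - t)"
proof -
  let ?b = "\<lambda>j. if j = 0 then 0 else of_real (inverse (\<beta> (j - 1))) * c j"
  have "(\<lambda>j. ?b (Suc j)) sums t" using assms(3) by simp
  then have "?b sums t" by (subst (asm) sums_Suc_iff) simp
  then have "(\<lambda>j. of_real (inverse (\<beta> j)) * c j - ?b j) sums (s - t)"
    by (rule sums_diff[OF assms(2)])
  also have "(\<lambda>j. of_real (inverse (\<beta> j)) * c j - ?b j) = (\<lambda>j. of_real (gamma_inv \<beta> j) * c j)"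
    using assms(1) by (auto simp: gamma_inv_def weight_sequence_def algebra_simps)
  finally show ?thesis .
qed

section \<open>Observability operators as operators into \<open>ell2\<close>\<close>

locale stable_pair =
  fixes \<beta> :: "nat \<Rightarrow> real" and E :: "'x::complex_hilbert \<Rightarrow> 'y::complex_hilbert" and T :: "'x \<Rightarrow> 'x"
  assumes wt: "weight_sequence \<beta>" and T: "bounded_clinear T" and E: "bounded_clinear E"
    and stable: "output_stable \<beta> E T"
begin

lemma nth_obs_vec: "ell2_nth (obs_vec \<beta> E T x) j = (1 / sqrt (\<beta> j)) *\<^sub>R E ((T ^^ j) x)"
proof -
  have "obs \<beta> E T x \<in> H2 \<beta>" using stable by (simp add: output_stable_def)
  moreover have "\<beta> k * (norm (obs \<beta> E T x k))\<^sup>2 = (norm ((1 / sqrt (\<beta> k)) *\<^sub>R E ((T ^^ k) x)))\<^sup>2" for k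
    using weight_sequence_pos[OF wt, of k]
    by (simp add: obs_def power_mult_distrib power_divide field_simps power2_eq_square)
  ultimately show ?thesis by (simp add: obs_vec_def ell2_nth_Abs H2_def)
qed

lemma obs_eq: "obs \<beta> E T x = h2_coeff \<beta> (obs_vec \<beta> E T x)"
proof
  fix j
  have "1 / sqrt (\<beta> j) * (1 / sqrt (\<beta> j)) = inverse (\<beta> j)"
    using weight_sequence_pos[OF wt, of j] by (simp add: field_simps)
  then show "obs \<beta> E T x j = h2_coeff \<beta> (obs_vec \<beta> E T x) j"
    by (simp add: h2_coeff_def nth_obs_vec obs_def)
qed

lemma bounded_clinear_obs_vec: "bounded_clinear (obs_vec \<beta> E T)"
proof -
  obtain c where c: "\<And>x. H2_norm \<beta> (obs \<beta> E T x) \<le> c * norm x"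
    using stable by (auto simp: output_stable_def)
  show ?thesis
  proof (rule bounded_clinearI)
    show "norm (obs_vec \<beta> E T x) \<le> c * norm x" for x
      using c[of x] by (simp add: obs_eq H2_norm_h2_coeff[OF wt])
    show "obs_vec \<beta> E T (x + y) = obs_vec \<beta> E T x + obs_vec \<beta> E T y" for x y
      by (rule ell2_eqI) (simp add: nth_obs_vec nth_plus bounded_clinear_simps[OF E]
          bounded_clinear_simps[OF bounded_clinear_funpow[OF T]] scaleR_add_right)
    show "obs_vec \<beta> E T (a *\<^sub>C x) = a *\<^sub>C obs_vec \<beta> E T x" for a x
      by (rule ell2_eqI) (simp add: nth_obs_vec nth_scaleC bounded_clinear_simps[OF E]
          bounded_clinear_simps[OF bounded_clinear_funpow[OF T]] scaleR_scaleC scaleC_scaleC mult.commute)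
  qed
qed

lemma H2_adjoint_obs: "H2_adjoint \<beta> (obs \<beta> E T) (h2_coeff \<beta> y) = cadjoint (obs_vec \<beta> E T) y"
  unfolding H2_adjoint_def obs_eq H2_cinner_h2_coeff[OF wt]
  by (rule the_equality) (auto simp: cinner_cadjoint[OF bounded_clinear_obs_vec] intro: cinner_ext_right)

lemma gramian_eq: "gramian \<beta> E T x = cadjoint (obs_vec \<beta> E T) (obs_vec \<beta> E T x)"
  unfolding gramian_def by (simp add: obs_eq H2_adjoint_obs)

lemma cinner_obs_vec_kvec_sums:
  assumes z: "z \<in> \<bbbD>"
  shows "(\<lambda>j. of_real (inverse (\<beta> j)) * (z ^ j * cinner (E ((T ^^ j) x)) y))
    sums cinner (obs_vec \<beta> E T x) (kvec (\<lambda>j. 1 / sqrt (\<beta> j)) z y)"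
proof -
  have "of_real (1 / sqrt (\<beta> j)) * z ^ j * cinner (ell2_nth (obs_vec \<beta> E T x) j) y
      = of_real (inverse (\<beta> j)) * (z ^ j * cinner (E ((T ^^ j) x)) y)" for j
    unfolding of_real_inverse_sqrt_mult[OF weight_sequence_pos[OF wt], symmetric]
    by (simp only: nth_obs_vec cinner.scaleR_left scaleR_conv_of_real mult_ac)
  then show ?thesis
    using cinner_kvec_sums[OF disk_weight_weight_sequence[OF wt] z, of "obs_vec \<beta> E T x" y] by (simp only:)
qed

text \<open>At \<open>z\<close> the observability series of \<open>x\<close> and of
  \<open>z *\<^sub>C T x\<close> telescope, which replaces the weights
  \<open>inverse (\<beta> j)\<close> by \<open>gamma_inv \<beta> j\<close>.\<close>

lemma cinner_obs_vec_diff_sums: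
  assumes z: "z \<in> \<bbbD>"
  shows "(\<lambda>j. of_real (gamma_inv \<beta> j) * (z ^ j * cinner (E ((T ^^ j) x)) y))
    sums cinner (obs_vec \<beta> E T (x - z *\<^sub>C T x)) (kvec (\<lambda>j. 1 / sqrt (\<beta> j)) z y)"
proof -
  let ?k = "kvec (\<lambda>j. 1 / sqrt (\<beta> j)) z y"
  have "(\<lambda>j. z * (of_real (inverse (\<beta> j)) * (z ^ j * cinner (E ((T ^^ j) (T x))) y)))
      sums (z * cinner (obs_vec \<beta> E T (T x)) ?k)"
    by (rule sums_mult[OF cinner_obs_vec_kvec_sums[OF z]])
  then have "(\<lambda>j. of_real (inverse (\<beta> j)) * (z ^ Suc j * cinner (E ((T ^^ Suc j) x)) y))
      sums (z * cinner (obs_vec \<beta> E T (T x)) ?k)"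
    by (simp add: funpow_swap1 mult_ac)
  from gamma_inv_telescoping[OF wt cinner_obs_vec_kvec_sums[OF z] this] show ?thesis
    by (simp add: bounded_clinear_simps[OF bounded_clinear_obs_vec] cinner.diff_left cinner_scaleC_left)
qed

end

text \<open>The setting of the theorem with \<open>J\<close> and \<open>\<Theta>\<close> unfolded.
  Injectivity of \<open>D\<close> at a point is kept apart; it is an explicit assumption where the
  inverse of \<open>D\<close> is constructed.\<close>

locale interpolation_data =
  fixes \<beta> :: "nat \<Rightarrow> real"
    and T :: "'x::complex_hilbert \<Rightarrow> 'x"
    and E :: "'x \<Rightarrow> 'y::complex_hilbert"
    and N :: "'x \<Rightarrow> 'u::complex_hilbert"
    and P :: "'x \<Rightarrow> 'x"
    and A :: "complex \<Rightarrow> 'y ell2 \<Rightarrow> 'y ell2"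
    and B :: "complex \<Rightarrow> 'u \<Rightarrow> 'y ell2"
    and C :: "complex \<Rightarrow> 'y ell2 \<Rightarrow> 'u"
    and D :: "complex \<Rightarrow> 'u \<Rightarrow> 'u"
  assumes wt: "weight_sequence \<beta>" and dec: "decseq \<beta>"
    and T: "bounded_clinear T" and E: "bounded_clinear E" and N: "bounded_clinear N"
    and osE: "output_stable \<beta> E T" and osN: "output_stable one_weight N T"
    and P_def: "P = (\<lambda>x. gramian \<beta> E T x - gramian one_weight N T x)"
    and sp: "strictly_positive P"
    and ABCD: "\<And>z. z \<in> \<bbbD> \<Longrightarrow> bounded_clinear (A z) \<and> bounded_clinear (B z)
                      \<and> bounded_clinear (C z) \<and> bounded_clinear (D z)"
    and kernel: "\<And>z \<zeta> v. z \<in> \<bbbD> \<Longrightarrow> \<zeta> \<in> \<bbbD> \<Longrightarrow>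
       inverse (1 - z * cnj \<zeta>) *\<^sub>C (signature_op v - block_op (A z) (B z) (C z) (D z)
          (signature_op (cadjoint (block_op (A \<zeta>) (B \<zeta>) (C \<zeta>) (D \<zeta>)) v)))
       = (col_op (obs_tilde \<beta> E T) N
          \<circ> inv (\<lambda>x. x - z *\<^sub>C T x)
          \<circ> inv P
          \<circ> inv (\<lambda>x. x - cnj \<zeta> *\<^sub>C cadjoint T x)
          \<circ> row_op (cadjoint (obs_tilde \<beta> E T)) (cadjoint N)) v"
begin

sublocale E: stable_pair \<beta> E T by unfold_locales (rule wt T E osE)+
sublocale N: stable_pair one_weight N T by unfold_locales (rule weight_sequence_one T N osN)+

abbreviation Ob where "Ob \<equiv> obs_vec \<beta> E T"
abbreviation On where "On \<equiv> obs_vec one_weight N T"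
abbreviation Ot where "Ot \<equiv> obs_tilde \<beta> E T"
abbreviation \<kappa> where "\<kappa> \<equiv> kvec (\<lambda>j. 1 / sqrt (\<beta> j)) :: complex \<Rightarrow> 'y \<Rightarrow> 'y ell2"
abbreviation \<kappa>1 where "\<kappa>1 \<equiv> kvec (\<lambda>_. 1)"
abbreviation \<psi> where "\<psi> \<equiv> kvec (\<lambda>j. sqrt (gamma_inv \<beta> j)) :: complex \<Rightarrow> 'y \<Rightarrow> 'y ell2"
abbreviation R where "R z \<equiv> inv (\<lambda>x. x - z *\<^sub>C T x)"

lemmas Ob = E.bounded_clinear_obs_vec
lemmas On = N.bounded_clinear_obs_vec

lemma A: "z \<in> \<bbbD> \<Longrightarrow> bounded_clinear (A z)" and B: "z \<in> \<bbbD> \<Longrightarrow> bounded_clinear (B z)"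
  and C: "z \<in> \<bbbD> \<Longrightarrow> bounded_clinear (C z)" and D: "z \<in> \<bbbD> \<Longrightarrow> bounded_clinear (D z)"
  using ABCD by auto

lemma \<beta>_pos: "0 < \<beta> j" by (rule weight_sequence_pos[OF wt])

lemma gamma_inv_nonneg: "0 \<le> gamma_inv \<beta> j"
proof (cases j)
  case (Suc i)
  have "\<beta> j \<le> \<beta> i" using dec Suc by (simp add: decseq_Suc_iff)
  then show ?thesis using \<beta>_pos[of j] Suc by (simp add: gamma_inv_def le_imp_inverse_le)
qed (simp add: gamma_inv_def)

lemma gamma_inv_le: "gamma_inv \<beta> j \<le> inverse (\<beta> j)"
  using less_imp_le[OF \<beta>_pos[of "j - 1"]] wt by (auto simp: gamma_inv_def weight_sequence_def)

lemma disk_weight_gamma: "disk_weight (\<lambda>j. sqrt (gamma_inv \<beta> j))"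
proof (rule disk_weight_mono[OF disk_weight_weight_sequence[OF wt]])
  show "(sqrt (gamma_inv \<beta> j))\<^sup>2 \<le> (1 / sqrt (\<beta> j))\<^sup>2" for j
    using gamma_inv_nonneg[of j] gamma_inv_le[of j] \<beta>_pos[of j] by (simp add: power_divide inverse_eq_divide)
qed

lemma of_real_sqrt_gamma: "complex_of_real (sqrt (gamma_inv \<beta> j)) * complex_of_real (sqrt (gamma_inv \<beta> j)) = of_real (gamma_inv \<beta> j)"
  using gamma_inv_nonneg[of j] by (simp flip: of_real_mult)

text \<open>Since \<open>gamma_inv \<beta> j \<le> inverse (\<beta> j)\<close>, the sequence is
  dominated by \<open>Ob x\<close>. So output stability puts it in \<open>ell2\<close>, and
  \<open>Abs_ell2\<close> in \<open>obs_tilde\<close> is meaningful.\<close>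

lemma nth_Ot: "ell2_nth (Ot x) j = sqrt (gamma_inv \<beta> j) *\<^sub>R E ((T ^^ j) x)"
  and norm_Ot_le: "norm (Ot x) \<le> norm (Ob x)"
proof -
  have le: "(norm (sqrt (gamma_inv \<beta> j) *\<^sub>R E ((T ^^ j) x)))\<^sup>2 \<le> (norm (ell2_nth (Ob x) j))\<^sup>2" for j
    using gamma_inv_nonneg[of j] gamma_inv_le[of j] \<beta>_pos[of j]
    by (simp add: E.nth_obs_vec power_mult_distrib power_divide inverse_eq_divide)
      (metis mult_right_mono mult_1 times_divide_eq_left zero_le_power2)
  have s: "summable (\<lambda>j. (norm (sqrt (gamma_inv \<beta> j) *\<^sub>R E ((T ^^ j) x)))\<^sup>2)"
    by (rule summable_comparison_test'[OF summable_ell2[of "Ob x"], where N = 0]) (use le in simp)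
  show nth: "ell2_nth (Ot x) j = sqrt (gamma_inv \<beta> j) *\<^sub>R E ((T ^^ j) x)" for j
    unfolding obs_tilde_def using s by (simp add: ell2_nth_Abs)
  have "(norm (Ot x))\<^sup>2 \<le> (norm (Ob x))\<^sup>2"
    unfolding norm_ell2_square nth by (rule suminf_le[OF le s summable_ell2])
  then show "norm (Ot x) \<le> norm (Ob x)" by (rule power2_le_imp_le) simp
qed

lemma Ot: "bounded_clinear Ot"
proof -
  obtain K where K: "\<And>x. norm (Ob x) \<le> K * norm x" using bounded_clinear_bound[OF Ob] by blast
  show ?thesis
  proof (rule bounded_clinearI)
    show "norm (Ot x) \<le> K * norm x" for x using norm_Ot_le[of x] K[of x] by linarith
    show "Ot (x + y) = Ot x + Ot y" for x y
      by (rule ell2_eqI) (simp add: nth_Ot nth_plus bounded_clinear_simps[OF E]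
          bounded_clinear_simps[OF bounded_clinear_funpow[OF T]] scaleR_add_right)
    show "Ot (a *\<^sub>C x) = a *\<^sub>C Ot x" for a x
      by (rule ell2_eqI) (simp add: nth_Ot nth_scaleC bounded_clinear_simps[OF E]
          bounded_clinear_simps[OF bounded_clinear_funpow[OF T]] scaleR_scaleC scaleC_scaleC mult.commute)
  qed
qed

text \<open>In other words, \<open>Psi \<beta> z\<close> applied to \<open>Ot x\<close> is the value
  at \<open>z\<close> of the observability function of \<open>(I - z T) x\<close>.\<close>

lemma cinner_Ot_psi:
  assumes z: "z \<in> \<bbbD>"
  shows "cinner (Ob (x - z *\<^sub>C T x)) (\<kappa> z y) = cinner (Ot x) (\<psi> z y)"
proof (rule sums_unique2[OF E.cinner_obs_vec_diff_sums[OF z]])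
  have "of_real (sqrt (gamma_inv \<beta> j)) * z ^ j * cinner (ell2_nth (Ot x) j) y
      = of_real (gamma_inv \<beta> j) * (z ^ j * cinner (E ((T ^^ j) x)) y)" for j
    unfolding of_real_sqrt_gamma[symmetric]
    by (simp only: nth_Ot cinner.scaleR_left scaleR_conv_of_real mult_ac)
  then show "(\<lambda>j. of_real (gamma_inv \<beta> j) * (z ^ j * cinner (E ((T ^^ j) x)) y)) sums cinner (Ot x) (\<psi> z y)"
    using cinner_kvec_sums[OF disk_weight_gamma z, of "Ot x" y] by (simp only:)
qed

text \<open>For weight one \<open>gamma_inv\<close> vanishes except at index 0, so the telescoped
  series reduces to \<open>N x\<close>.\<close>

lemma cinner_N_szego:
  assumes z: "z \<in> \<bbbD>"
  shows "cinner (On (x - z *\<^sub>C T x)) (\<kappa>1 z u) = cinner (N x) u"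
proof -
  have "(\<lambda>j. of_real (gamma_inv one_weight j) * (z ^ j * cinner (N ((T ^^ j) x)) u))
      = (\<lambda>j. if j = 0 then cinner (N ((T ^^ j) x)) u else 0)"
    by (auto simp: gamma_inv_def)
  then have "(\<lambda>j. of_real (gamma_inv one_weight j) * (z ^ j * cinner (N ((T ^^ j) x)) u)) sums cinner (N x) u"
    using sums_single[of 0 "\<lambda>j. cinner (N ((T ^^ j) x)) u"] by simp
  then show ?thesis using sums_unique2[OF N.cinner_obs_vec_diff_sums[OF z]] by simp
qed

text \<open>As \<open>\<psi> z\<close> is the adjoint of \<open>Psi \<beta> z\<close>, this is the
  factorization \<open>\<Psi>(z) \<Psi>(\<zeta>)^* = (1 - z cnj \<zeta>) k(z, \<zeta>)\<close> of
  the weighted kernel \<open>k\<close>. It reconciles the weight with the denominator in the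
  identity for \<open>\<Theta>\<close>.\<close>

lemma cinner_psi_psi:
  assumes z: "z \<in> \<bbbD>" and \<zeta>: "\<zeta> \<in> \<bbbD>"
  shows "cinner (\<psi> \<zeta> y) (\<psi> z y') = (1 - z * cnj \<zeta>) * cinner (\<kappa> \<zeta> y) (\<kappa> z y')"
proof -
  let ?c = "\<lambda>j. (z * cnj \<zeta>) ^ j * cinner y y'"
  have c: "(\<lambda>j. of_real (inverse (\<beta> j)) * ?c j) sums cinner (\<kappa> \<zeta> y) (\<kappa> z y')"
  proof -
    have "of_real (1 / sqrt (\<beta> j)) * z ^ j * cinner (ell2_nth (\<kappa> \<zeta> y) j) y' = of_real (inverse (\<beta> j)) * ?c j" for j
      unfolding of_real_inverse_sqrt_mult[OF \<beta>_pos, symmetric]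
      by (simp only: nth_kvec[OF disk_weight_weight_sequence[OF wt] \<zeta>] cinner_scaleC_left power_mult_distrib mult_ac)
    then show ?thesis using cinner_kvec_sums[OF disk_weight_weight_sequence[OF wt] z, of "\<kappa> \<zeta> y" y'] by (simp only:)
  qed
  have "(\<lambda>j. of_real (inverse (\<beta> j)) * ?c (Suc j)) sums ((z * cnj \<zeta>) * cinner (\<kappa> \<zeta> y) (\<kappa> z y'))"
    using sums_mult[OF c, of "z * cnj \<zeta>"] by (simp add: mult_ac)
  from gamma_inv_telescoping[OF wt c this]
  have 1: "(\<lambda>j. of_real (gamma_inv \<beta> j) * ?c j) sums ((1 - z * cnj \<zeta>) * cinner (\<kappa> \<zeta> y) (\<kappa> z y'))"
    by (simp add: algebra_simps)
  have "of_real (sqrt (gamma_inv \<beta> j)) * z ^ j * cinner (ell2_nth (\<psi> \<zeta> y) j) y' = of_real (gamma_inv \<beta> j) * ?c j" for j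
    unfolding of_real_sqrt_gamma[symmetric]
    by (simp only: nth_kvec[OF disk_weight_gamma \<zeta>] cinner_scaleC_left power_mult_distrib mult_ac)
  then have "(\<lambda>j. of_real (gamma_inv \<beta> j) * ?c j) sums cinner (\<psi> \<zeta> y) (\<psi> z y')"
    using cinner_kvec_sums[OF disk_weight_gamma z, of "\<psi> \<zeta> y" y'] by (simp only:)
  with 1 show ?thesis by (rule sums_unique2[symmetric])
qed

lemma cinner_Psi:
  assumes z: "z \<in> \<bbbD>"
  shows "cinner (Psi \<beta> z w) y = cinner w (\<psi> z y)"
proof -
  have "summable (\<lambda>k. (norm (sqrt (gamma_inv \<beta> k) * cmod z ^ k))\<^sup>2)"
    using summable_disk_weight[OF disk_weight_gamma z, of "1::complex"]
    by (simp add: norm_scaleC norm_mult norm_power gamma_inv_nonneg)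
  moreover have "summable (\<lambda>k. (norm (norm (ell2_nth w k)))\<^sup>2)" by (simp add: summable_ell2)
  ultimately have "summable (\<lambda>k. norm (sqrt (gamma_inv \<beta> k) * cmod z ^ k) * norm (norm (ell2_nth w k)))"
    by (rule summable_norm_product)
  then have "summable (\<lambda>j. norm ((of_real (sqrt (gamma_inv \<beta> j)) * z ^ j) *\<^sub>C ell2_nth w j))"
    by (simp add: norm_scaleC norm_mult norm_power abs_mult)
  then have "(\<lambda>j. (of_real (sqrt (gamma_inv \<beta> j)) * z ^ j) *\<^sub>C ell2_nth w j) sums Psi \<beta> z w"
    unfolding Psi_def by (intro summable_sums) (rule summable_norm_cancel)
  from bounded_linear.sums[OF cinner.bounded_linear_left this, of y]
  show ?thesis using cinner_kvec_sums[OF disk_weight_gamma z, of w y] sums_unique2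
    by (simp add: cinner_scaleC_left) blast
qed

lemma Psi: assumes z: "z \<in> \<bbbD>" shows "bounded_clinear (Psi \<beta> z :: 'y ell2 \<Rightarrow> 'y)"
proof -
  define s where "s = cmod (\<Sum>j. of_real ((sqrt (gamma_inv \<beta> j))\<^sup>2) * (z * cnj z) ^ j)"
  have npsi: "norm (\<psi> z y) = sqrt s * norm y" for y
  proof -
    have "(norm (\<psi> z y))\<^sup>2 = cmod (cinner (\<psi> z y) (\<psi> z y))" by (simp add: cinner_self_eq norm_power)
    also have "\<dots> = s * (norm y)\<^sup>2"
      by (simp only: cinner_kvec_kvec[OF disk_weight_gamma z z] s_def norm_mult cinner_self_eq[of y]
          norm_of_real abs_power2)
    finally have "(norm (\<psi> z y))\<^sup>2 = (sqrt s * norm y)\<^sup>2" by (simp add: power_mult_distrib s_def)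
    then show ?thesis by (rule power2_eq_imp_eq) (simp_all add: s_def)
  qed
  show ?thesis
  proof (rule bounded_clinearI[of _ "sqrt s"])
    show "Psi \<beta> z (x + y) = Psi \<beta> z x + Psi \<beta> z y" for x y :: "'y ell2"
      by (rule cinner_ext) (simp add: cinner.add_left cinner_Psi[OF z])
    show "Psi \<beta> z (c *\<^sub>C x) = c *\<^sub>C Psi \<beta> z x" for c and x :: "'y ell2"
      by (rule cinner_ext) (simp add: cinner_scaleC_left cinner_Psi[OF z])
    show "norm (Psi \<beta> z w) \<le> sqrt s * norm w" for w :: "'y ell2"
    proof -
      have "(norm (Psi \<beta> z w))\<^sup>2 = cmod (cinner w (\<psi> z (Psi \<beta> z w)))"
        by (simp add: cinner_Psi[OF z, symmetric] cinner_self_eq norm_power)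
      also have "\<dots> \<le> norm w * norm (\<psi> z (Psi \<beta> z w))" by (rule norm_cinner_le)
      finally have "norm (Psi \<beta> z w) * norm (Psi \<beta> z w) \<le> norm (Psi \<beta> z w) * (sqrt s * norm w)"
        by (simp add: npsi power2_eq_square mult_ac)
      then show ?thesis by (cases "norm (Psi \<beta> z w) = 0") (auto simp: s_def)
    qed
  qed
qed

section \<open>The inverse of \<open>P\<close> and the resolvent of \<open>T\<close>\<close>

definition Pi where "Pi = inv P"

lemma P_eq: "P x = cadjoint Ob (Ob x) - cadjoint On (On x)"
  by (simp add: P_def E.gramian_eq N.gramian_eq)

lemma cinner_P: "cinner (P x) y = cinner (Ob x) (Ob y) - cinner (On x) (On y)"
  by (simp add: P_eq cinner.diff_left cinner_cadjoint_left[OF Ob] cinner_cadjoint_left[OF On])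

lemma Pi: "bounded_clinear Pi" "P (Pi x) = x" "Pi (P x) = x"
  using boundedly_invertible_inv[of P] sp by (auto simp: Pi_def strictly_positive_def)

lemma cinner_P_commute: "cinner (P x) y = cinner x (P y)"
  by (metis cinner_P cinner_commute complex_cnj_diff)

lemma cinner_Pi_commute: "cinner (Pi x) y = cinner x (Pi y)"
  using cinner_P_commute[of "Pi x" "Pi y"] by (simp add: Pi(2))

lemma Pi_nonneg: "0 \<le> Re (cinner (Pi x) x)"
proof -
  have "0 \<le> Re (cinner (P (Pi x)) (Pi x))" using sp by (simp add: strictly_positive_def)
  then show ?thesis by (simp add: Pi(2) cinner_Pi_commute)
qed

text \<open>\<open>P\<close> is invertible and dominated by \<open>Ob^* Ob\<close>. With
  \<open>G\<close> a square root of \<open>Pi\<close>, the vector \<open>G (P x)\<close> has squared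
  norm \<open>cinner (P x) x\<close>, at most that of \<open>Ob x\<close>, and \<open>G\<close> maps
  it to \<open>x\<close>.\<close>

lemma obs_vec_bounded_below: obtains K where "\<And>x. norm x \<le> K * norm (Ob x)" "0 \<le> K"
proof -
  obtain G where G: "bounded_clinear G" "\<And>x y. cinner (G x) y = cinner x (G y)" "\<And>x. G (G x) = Pi x"
    using positive_operator_sqrt[OF Pi(1) cinner_Pi_commute Pi_nonneg] by blast
  obtain K where K: "K > 0" "\<And>x. norm (G x) \<le> K * norm x" using bounded_clinear_bound[OF G(1)] by blast
  have "norm x \<le> K * norm (Ob x)" for x
  proof -
    have "(norm (G (P x)))\<^sup>2 = Re (cinner (G (P x)) (G (P x)))" by (simp add: cinner_self_eq)
    also have "\<dots> = Re (cinner x (P x))" by (simp add: G(2)[symmetric] G(3) Pi(3))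
    also have "\<dots> = (norm (Ob x))\<^sup>2 - (norm (On x))\<^sup>2"
      by (simp add: cinner_P_commute[symmetric] cinner_P cinner_self_eq)
    also have "\<dots> \<le> (norm (Ob x))\<^sup>2" by simp
    finally have "norm (G (P x)) \<le> norm (Ob x)" by (rule power2_le_imp_le) simp
    moreover have "norm x \<le> K * norm (G (P x))" using K(2)[of "G (P x)"] by (simp add: G(3) Pi(3))
    ultimately show ?thesis using K(1) by (meson less_imp_le mult_left_mono order_trans)
  qed
  then show ?thesis using that K(1) by force
qed

text \<open>The coordinates of \<open>Ob (T x)\<close> are those of \<open>Ob x\<close> moved down
  by one, with the factor \<open>1 / sqrt (\<beta> k)\<close> in place of
  \<open>1 / sqrt (\<beta> (Suc k))\<close>, which is at least as large.\<close>

lemma norm_Ob_T_le: "norm (Ob (T x)) \<le> norm (Ob x)"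
proof (rule power2_le_imp_le)
  have s: "summable (\<lambda>k. (norm (ell2_nth (Ob x) (Suc k)))\<^sup>2)"
    using summable_ell2[of "Ob x"] by (subst summable_Suc_iff)
  have "(norm (Ob (T x)))\<^sup>2 \<le> (\<Sum>k. (norm (ell2_nth (Ob x) (Suc k)))\<^sup>2)"
    unfolding norm_ell2_square
  proof (rule suminf_le[OF _ summable_ell2 s])
    fix k
    have "\<beta> (Suc k) \<le> \<beta> k" using dec by (simp add: decseq_Suc_iff)
    then have "1 / \<beta> k \<le> 1 / \<beta> (Suc k)" using \<beta>_pos by (simp add: frac_le)
    then show "(norm (ell2_nth (Ob (T x)) k))\<^sup>2 \<le> (norm (ell2_nth (Ob x) (Suc k)))\<^sup>2"
      using \<beta>_pos[of k] \<beta>_pos[of "Suc k"] mult_right_mono[of "1 / \<beta> k" "1 / \<beta> (Suc k)" "(norm (E (T ((T ^^ k) x))))\<^sup>2"]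
      by (simp add: E.nth_obs_vec power_mult_distrib power_divide funpow_swap1)
  qed
  also have "\<dots> \<le> (norm (Ob x))\<^sup>2"
    unfolding norm_ell2_square suminf_split_head[OF summable_ell2] by simp
  finally show "(norm (Ob (T x)))\<^sup>2 \<le> (norm (Ob x))\<^sup>2" .
qed simp

text \<open>\<open>T\<close> is power bounded: \<open>norm (Ob x)\<close> is a norm equivalent to \<open>norm x\<close> in which \<open>T\<close> is a
  contraction.\<close>

lemma R:
  assumes z: "z \<in> \<bbbD>"
  shows "bounded_clinear (R z)" "R z x - z *\<^sub>C T (R z x) = x" "R z (x - z *\<^sub>C T x) = x"
proof -
  obtain K where K: "\<And>x. norm x \<le> K * norm (Ob x)" "0 \<le> K" using obs_vec_bounded_below by blast
  obtain L where L: "L > 0" "\<And>x. norm (Ob x) \<le> L * norm x" using bounded_clinear_bound[OF Ob] by blast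
  have ObT: "norm (Ob ((T ^^ k) x)) \<le> norm (Ob x)" for k x
    by (induction k) (auto intro: order_trans[OF norm_Ob_T_le])
  have zT: "bounded_clinear (\<lambda>x. z *\<^sub>C T x)" by (intro bounded_clinear_intros T)
  have pow: "((\<lambda>x. z *\<^sub>C T x) ^^ k) x = z ^ k *\<^sub>C (T ^^ k) x" for k x
    by (induction k) (simp_all add: bounded_clinear_scaleC[OF T] scaleC_scaleC)
  have pw: "norm (((\<lambda>x. z *\<^sub>C T x) ^^ k) x) \<le> K * L * cmod z ^ k * norm x" for k x
  proof -
    have "norm ((T ^^ k) x) \<le> K * norm (Ob x)"
      using K(1)[of "(T ^^ k) x"] mult_left_mono[OF ObT[of k x] K(2)] by linarith
    also have "\<dots> \<le> K * (L * norm x)" by (rule mult_left_mono[OF L(2) K(2)])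
    finally have "cmod z ^ k * norm ((T ^^ k) x) \<le> cmod z ^ k * (K * (L * norm x))"
      by (rule mult_left_mono) simp
    then show ?thesis by (simp add: pow norm_scaleC norm_power mult_ac)
  qed
  have "cmod z < 1" using z by simp
  from neumann_series[OF zT norm_ge_zero this pw]
  obtain Q where Q: "bounded_clinear Q" "\<And>x. Q x - z *\<^sub>C T (Q x) = x" "\<And>x. Q (x - z *\<^sub>C T x) = x"
    by metis
  have "R z = Q" by (rule inv_equality) (simp_all add: Q)
  then show "bounded_clinear (R z)" "R z x - z *\<^sub>C T (R z x) = x" "R z (x - z *\<^sub>C T x) = x"
    using Q by auto
qed

lemma R_adjoint:
  assumes z: "z \<in> \<bbbD>"
  shows "inv (\<lambda>x. x - cnj z *\<^sub>C cadjoint T x) = cadjoint (R z)"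
proof (rule inv_equality)
  fix x
  show "cadjoint (R z) (x - cnj z *\<^sub>C cadjoint T x) = x"
  proof (rule cadjoint_eqI[OF R(1)[OF z]])
    fix y
    have "cinner (R z y) (x - cnj z *\<^sub>C cadjoint T x) = cinner (R z y - z *\<^sub>C T (R z y)) x"
      by (simp add: cinner.diff_left cinner.diff_right cinner_scaleC_left cinner_scaleC_right cinner_cadjoint[OF T])
    then show "cinner (R z y) (x - cnj z *\<^sub>C cadjoint T x) = cinner y x" by (simp add: R(2)[OF z])
  qed
  show "cadjoint (R z) x - cnj z *\<^sub>C cadjoint T (cadjoint (R z) x) = x"
  proof (rule cinner_ext_right)
    fix y
    have "cinner y (cadjoint (R z) x - cnj z *\<^sub>C cadjoint T (cadjoint (R z) x)) = cinner (R z (y - z *\<^sub>C T y)) x"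
      by (simp only: cinner.diff_right cinner_scaleC_right cinner_cadjoint[OF T, symmetric]
          cinner_cadjoint[OF R(1)[OF z], symmetric] bounded_clinear_simps[OF R(1)[OF z]] cinner.diff_left
          cinner_scaleC_left complex_cnj_cnj)
    then show "cinner y (cadjoint (R z) x - cnj z *\<^sub>C cadjoint T (cadjoint (R z) x)) = cinner y x"
      by (simp add: R(3)[OF z])
  qed
qed

text \<open>What stands to the right of \<open>inv P\<close> in the kernel identity, applied to the
  pair \<open>(y, u)\<close>.\<close>

definition \<Phi> where "\<Phi> \<zeta> y u = cadjoint (R \<zeta>) (cadjoint Ot y + cadjoint N u)"

lemma adjoint_Ob_kappa:
  assumes z: "z \<in> \<bbbD>"
  shows "cadjoint Ob (\<kappa> z y) = cadjoint (R z) (cadjoint Ot (\<psi> z y))"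
proof (rule cadjoint_eqI[OF Ob])
  fix x
  have "cinner (Ob x) (\<kappa> z y) = cinner (Ob (R z x - z *\<^sub>C T (R z x))) (\<kappa> z y)"
    unfolding R(2)[OF z] ..
  also have "\<dots> = cinner (Ot (R z x)) (\<psi> z y)" by (rule cinner_Ot_psi[OF z])
  finally show "cinner (Ob x) (\<kappa> z y) = cinner x (cadjoint (R z) (cadjoint Ot (\<psi> z y)))"
    by (simp only: cinner_cadjoint[OF Ot] cinner_cadjoint[OF R(1)[OF z]])
qed

lemma adjoint_On_kappa:
  assumes z: "z \<in> \<bbbD>"
  shows "cadjoint On (\<kappa>1 z u) = cadjoint (R z) (cadjoint N u)"
proof (rule cadjoint_eqI[OF On])
  fix x
  have "cinner (On x) (\<kappa>1 z u) = cinner (On (R z x - z *\<^sub>C T (R z x))) (\<kappa>1 z u)"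
    unfolding R(2)[OF z] ..
  also have "\<dots> = cinner (N (R z x)) u" by (rule cinner_N_szego[OF z])
  finally show "cinner (On x) (\<kappa>1 z u) = cinner x (cadjoint (R z) (cadjoint N u))"
    by (simp only: cinner_cadjoint[OF N] cinner_cadjoint[OF R(1)[OF z]])
qed

text \<open>With \<open>u = cadjoint (S z) y\<close> this is \<open>F^*\<close> of the overview at
  the kernel vector \<open>\<kappa> z y\<close>.\<close>

lemma Phi_eq:
  assumes z: "z \<in> \<bbbD>"
  shows "\<Phi> z (\<psi> z y) (- u) = cadjoint Ob (\<kappa> z y) - cadjoint On (\<kappa>1 z u)"
  by (simp add: \<Phi>_def adjoint_Ob_kappa[OF z] adjoint_On_kappa[OF z]
      bounded_clinear_simps[OF bounded_clinear_cadjoint[OF R(1)[OF z]]]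
      bounded_clinear_simps[OF bounded_clinear_cadjoint[OF N]])

text \<open>Sesquilinear form of the identity for \<open>\<Theta>\<close>. Pairs
  \<open>(0, u)\<close> will control \<open>D\<close>; pairs
  \<open>(\<psi> z y, - cadjoint (S z) y)\<close> will relate \<open>Ua\<close> and
  \<open>Va\<close>.\<close>

lemma kernel_identity:
  assumes z: "z \<in> \<bbbD>" and \<zeta>: "\<zeta> \<in> \<bbbD>"
  shows "cinner y y' - cinner u u'
      - cinner (cadjoint (A \<zeta>) y + cadjoint (C \<zeta>) u) (cadjoint (A z) y' + cadjoint (C z) u')
      + cinner (cadjoint (B \<zeta>) y + cadjoint (D \<zeta>) u) (cadjoint (B z) y' + cadjoint (D z) u')
    = (1 - z * cnj \<zeta>) * cinner (Pi (\<Phi> \<zeta> y u)) (\<Phi> z y' u')"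
proof -
  define \<Theta> where "\<Theta> z = block_op (A z) (B z) (C z) (D z)" for z
  have app: "\<Theta> z (a, b) = (A z a + B z b, C z a + D z b)" for z a b
    by (simp add: \<Theta>_def block_op_def)
  have bT: "bounded_clinear (\<Theta> z)" if "z \<in> \<bbbD>" for z
  proof -
    have "\<Theta> z = (\<lambda>v. (A z (fst v) + B z (snd v), C z (fst v) + D z (snd v)))"
      by (auto simp: app)
    then show ?thesis
      by (simp only:) (intro bounded_clinear_Pair bounded_clinear_plus
          bounded_clinear_compose[OF A[OF that] bounded_clinear_fst] bounded_clinear_compose[OF B[OF that] bounded_clinear_snd]
          bounded_clinear_compose[OF C[OF that] bounded_clinear_fst] bounded_clinear_compose[OF D[OF that] bounded_clinear_snd])
  qed
  have adj: "cadjoint (\<Theta> z) (y, u) = (cadjoint (A z) y + cadjoint (C z) u, cadjoint (B z) y + cadjoint (D z) u)"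
    if "z \<in> \<bbbD>" for z y u
    by (rule cadjoint_eqI[OF bT[OF that]])
      (auto simp: app cinner_prod_def cinner.add_left cinner.add_right cinner_cadjoint[OF A[OF that]]
        cinner_cadjoint[OF B[OF that]] cinner_cadjoint[OF C[OF that]] cinner_cadjoint[OF D[OF that]])
  have nz: "1 - z * cnj \<zeta> \<noteq> 0"
    using norm_mult_lt_one[OF \<zeta> z] by (metis eq_iff_diff_eq_0 less_irrefl norm_one)
  let ?L = "signature_op (y, u) - \<Theta> z (signature_op (cadjoint (\<Theta> \<zeta>) (y, u)))"
  have "inverse (1 - z * cnj \<zeta>) *\<^sub>C ?L = (Ot (R z (Pi (\<Phi> \<zeta> y u))), N (R z (Pi (\<Phi> \<zeta> y u))))"
    using kernel[OF z \<zeta>, of "(y, u)"] unfolding \<Theta>_def[symmetric] R_adjoint[OF \<zeta>] Pi_def[symmetric]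
    by (simp add: col_op_def row_op_def \<Phi>_def)
  then have L: "?L = (1 - z * cnj \<zeta>) *\<^sub>C (Ot (R z (Pi (\<Phi> \<zeta> y u))), N (R z (Pi (\<Phi> \<zeta> y u))))"
    by (rule eq_scaleC_if_inverse[OF nz])
  have "cinner ?L (y', u') = (1 - z * cnj \<zeta>) * cinner (Ot (R z (Pi (\<Phi> \<zeta> y u))), N (R z (Pi (\<Phi> \<zeta> y u)))) (y', u')"
    unfolding L cinner_scaleC_left ..
  also have "cinner (Ot (R z (Pi (\<Phi> \<zeta> y u))), N (R z (Pi (\<Phi> \<zeta> y u)))) (y', u') = cinner (Pi (\<Phi> \<zeta> y u)) (\<Phi> z y' u')"
    by (simp add: cinner_prod_def \<Phi>_def cinner_cadjoint[OF Ot] cinner_cadjoint[OF N]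
        cinner_cadjoint[OF R(1)[OF z]] cinner.add_right bounded_clinear_simps[OF bounded_clinear_cadjoint[OF R(1)[OF z]]])
  also have "cinner ?L (y', u') = cinner y y' - cinner u u'
      - cinner (cadjoint (A \<zeta>) y + cadjoint (C \<zeta>) u) (cadjoint (A z) y' + cadjoint (C z) u')
      + cinner (cadjoint (B \<zeta>) y + cadjoint (D \<zeta>) u) (cadjoint (B z) y' + cadjoint (D z) u')"
    unfolding cinner.diff_left cinner_cadjoint[OF bT[OF z]] adj[OF z] adj[OF \<zeta>]
    by (simp add: signature_op_def cinner_prod_def cinner.minus_left cinner.diff_left cinner.add_left)
  finally show ?thesis .
qed

end

section \<open>Invertibility of the denominator\<close>

lemma finite_dimensional_surj_imp_inj:
  fixes f :: "'a::real_vector \<Rightarrow> 'a" and F :: "'a set"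
  assumes "finite F" "span F = UNIV" "linear f" "surj f" shows "inj f"
proof -
  \<comment> \<open>A maximal independent subset of \<open>F\<close> serves as the basis; spans are
    over the reals.\<close>
  obtain B where B: "B \<subseteq> F" "independent B" "F \<subseteq> span B"
    using maximal_independent_subset[of F] by blast
  then have "span B = UNIV" using assms(2) span_mono[of F "span B"] by (auto simp: span_span)
  then interpret fd: finite_dimensional_vector_space "scaleR :: real \<Rightarrow> 'a \<Rightarrow> 'a" B
    using B finite_subset[OF B(1) assms(1)]
    by unfold_locales (simp_all add: dependent_raw_def span_raw_def algebra_simps)
  show ?thesis using fd.linear_surj_imp_inj[of f] assms(3,4) by (simp add: Real_Vector_Spaces.linear_def)
qed

context interpolation_data
begin

lemma Phi_scaleC: "\<zeta> \<in> \<bbbD> \<Longrightarrow> \<Phi> \<zeta> (c *\<^sub>C y) (c *\<^sub>C u) = c *\<^sub>C \<Phi> \<zeta> y u"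
  by (simp add: \<Phi>_def bounded_clinear_simps[OF bounded_clinear_cadjoint[OF Ot]]
      bounded_clinear_simps[OF bounded_clinear_cadjoint[OF N]] scaleC_add_right[symmetric]
      bounded_clinear_scaleC[OF bounded_clinear_cadjoint[OF R(1)]])

text \<open>At pairs \<open>(0, u)\<close> the identity says that \<open>D D^* - C C^* - I\<close>
  is \<open>1 - z cnj \<zeta>\<close> times a positive kernel. A lurking isometry turns this into a
  contraction, analytic in \<open>cnj z\<close>, that sends \<open>D(z)^* u\<close> to
  \<open>(C(z)^* u, u)\<close>; it is the source of continuity for the left inverses of
  \<open>cadjoint (D z)\<close>.\<close>

lemma D_adjoint_left_inverse:
  obtains F where "F \<in> schur_class" "\<And>z u. z \<in> \<bbbD> \<Longrightarrow> F (cnj z) (cadjoint (D z) u) = (cadjoint (C z) u, u)"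
proof -
  obtain G where G: "bounded_clinear G" "\<And>x y. cinner (G x) y = cinner x (G y)" "\<And>x. G (G x) = Pi x"
    using positive_operator_sqrt[OF Pi(1) cinner_Pi_commute Pi_nonneg] by blast
  define p where "p \<zeta> u = (cnj \<zeta> *\<^sub>C G (\<Phi> \<zeta> 0 u), cadjoint (D \<zeta>) u)" for \<zeta> u
  define q where "q \<zeta> u = (G (\<Phi> \<zeta> 0 u), (cadjoint (C \<zeta>) u, u))" for \<zeta> u
  have Phi: "\<Phi> \<zeta> 0 (c *\<^sub>C u) = c *\<^sub>C \<Phi> \<zeta> 0 u" if "\<zeta> \<in> \<bbbD>" for \<zeta> c u
    using Phi_scaleC[OF that, of c 0 u] by simp
  have hp: "p \<zeta> (c *\<^sub>C u) = c *\<^sub>C p \<zeta> u" if "\<zeta> \<in> \<bbbD>" for \<zeta> c u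
    by (simp add: p_def scaleC_prod_def Phi[OF that] bounded_clinear_scaleC[OF G(1)] scaleC_scaleC mult.commute
        bounded_clinear_scaleC[OF bounded_clinear_cadjoint[OF D[OF that]]])
  have hq: "q \<zeta> (c *\<^sub>C u) = c *\<^sub>C q \<zeta> u" if "\<zeta> \<in> \<bbbD>" for \<zeta> c u
    by (simp add: q_def scaleC_prod_def Phi[OF that] bounded_clinear_scaleC[OF G(1)]
        bounded_clinear_scaleC[OF bounded_clinear_cadjoint[OF C[OF that]]])
  have gram: "cinner (q \<zeta> u) (q z u') = cinner (p \<zeta> u) (p z u')" if \<zeta>: "\<zeta> \<in> \<bbbD>" and z: "z \<in> \<bbbD>" for \<zeta> z u u'
  proof -
    let ?g = "cinner (Pi (\<Phi> \<zeta> 0 u)) (\<Phi> z 0 u')"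
    have "cinner (G (\<Phi> \<zeta> 0 u)) (G (\<Phi> z 0 u')) = ?g" by (simp add: G(2)[symmetric] G(3))
    moreover have "- cinner u u' - cinner (cadjoint (C \<zeta>) u) (cadjoint (C z) u')
        + cinner (cadjoint (D \<zeta>) u) (cadjoint (D z) u') = (1 - z * cnj \<zeta>) * ?g"
      using kernel_identity[OF z \<zeta>, of 0 0 u u']
      by (simp add: bounded_clinear_zero[OF bounded_clinear_cadjoint[OF A[OF z]]]
          bounded_clinear_zero[OF bounded_clinear_cadjoint[OF A[OF \<zeta>]]]
          bounded_clinear_zero[OF bounded_clinear_cadjoint[OF B[OF z]]]
          bounded_clinear_zero[OF bounded_clinear_cadjoint[OF B[OF \<zeta>]]])
    ultimately show ?thesis
      by (simp add: p_def q_def cinner_prod_def cinner_scaleC_left cinner_scaleC_right algebra_simps)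
  qed
  obtain L where L: "bounded_clinear L" "\<And>v. norm (L v) \<le> norm v" "\<And>\<zeta> u. \<zeta> \<in> \<bbbD> \<Longrightarrow> L (p \<zeta> u) = q \<zeta> u"
    using lurking_isometry[of "\<bbbD>" p q, OF hp hq gram] by metis
  obtain F where F: "F \<in> schur_class" "\<And>z h u y. z \<in> \<bbbD> \<Longrightarrow> L (z *\<^sub>C h, u) = (h, y) \<Longrightarrow> y = F z u"
    using transfer_function[OF L(1,2)] by metis
  \<comment> \<open>The state enters \<open>p\<close> with the factor \<open>cnj \<zeta>\<close>, so
    the transfer function is evaluated at \<open>cnj z\<close>.\<close>
  have "F (cnj z) (cadjoint (D z) u) = (cadjoint (C z) u, u)" if "z \<in> \<bbbD>" for z u
    using F(2)[of "cnj z" "G (\<Phi> z 0 u)" "cadjoint (D z) u" "(cadjoint (C z) u, u)"] L(3)[OF that, of u] that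
    by (simp add: p_def q_def)
  then show ?thesis using that F(1) by blast
qed

text \<open>The adjoint of a left inverse of \<open>cadjoint (D z)\<close> is a right inverse of
  \<open>D z\<close>.\<close>

lemma D_surj: assumes z: "z \<in> \<bbbD>" shows "surj (D z)"
proof -
  obtain F where F: "F \<in> schur_class" "\<And>z u. z \<in> \<bbbD> \<Longrightarrow> F (cnj z) (cadjoint (D z) u) = (cadjoint (C z) u, u)"
    using D_adjoint_left_inverse by blast
  define s where "s u = snd (F (cnj z) u)" for u
  have s: "bounded_clinear s" unfolding s_def
    using F(1) z by (intro bounded_clinear_intros) (auto simp: schur_class_def)
  have "D z (cadjoint s u) = u" for u
    by (rule cinner_ext) (simp add: cinner_cadjoint[OF D[OF z]] cinner_cadjoint_left[OF s], simp add: s_def F(2)[OF z])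
  then show ?thesis by (metis surjI)
qed

text \<open>Injectivity of the left inverses \<open>s z\<close> of \<open>cadjoint (D z)\<close> is an open and closed condition
  on \<open>z\<close>: \<open>s z\<close> depends continuously on \<open>z\<close> in norm and a left-invertible operator near an
  invertible one is invertible.\<close>

lemma D_inverse:
  assumes z0: "z0 \<in> \<bbbD>" "inj (D z0)" and z: "z \<in> \<bbbD>"
  obtains s where "bounded_clinear s" "\<And>u. s (cadjoint (D z) u) = u" "\<And>u. cadjoint (D z) (s u) = u"
    "\<And>u. (norm (cadjoint (C z) (s u)))\<^sup>2 + (norm (s u))\<^sup>2 \<le> (norm u)\<^sup>2"
proof -
  obtain F where F: "F \<in> schur_class" "\<And>z u. z \<in> \<bbbD> \<Longrightarrow> F (cnj z) (cadjoint (D z) u) = (cadjoint (C z) u, u)"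
    using D_adjoint_left_inverse by blast
  have Fb: "bounded_clinear (F z)" "norm (F z u) \<le> norm u" if "z \<in> \<bbbD>" for z u
    using F(1) that by (auto simp: schur_class_def)
  define s where "s z u = snd (F (cnj z) u)" for z u
  have s: "bounded_clinear (s z)" if "z \<in> \<bbbD>" for z
    unfolding s_def using that by (intro bounded_clinear_intros Fb(1)) simp
  have sD: "s z (cadjoint (D z) u) = u" if "z \<in> \<bbbD>" for z u
    by (simp add: s_def F(2)[OF that])
  have injI: "inj (s z)" if "z \<in> \<bbbD>" "\<And>u. s z u = 0 \<Longrightarrow> u = 0" for z
    using that linear_injective_0[OF bounded_linear.linear[OF bounded_clinear_imp_bounded_linear[OF s[OF that(1)]]]] by blast
  have loc: "\<exists>d>0. \<forall>w\<in>\<bbbD>. dist w z < d \<longrightarrow> (inj (s w) \<longleftrightarrow> inj (s z))" if z: "z \<in> \<bbbD>" for z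
  proof -
    let ?D = "cadjoint (D z)"
    have Dz: "bounded_clinear ?D" by (rule bounded_clinear_cadjoint[OF D[OF z]])
    obtain K where K: "K > 0" "\<And>u. norm (?D u) \<le> K * norm u" using bounded_clinear_bound[OF Dz] by blast
    \<comment> \<open>The tolerance \<open>1 / (2 * K)\<close> times the bound \<open>K\<close> of
      \<open>?D\<close> makes the perturbations below at most \<open>1 / 2\<close>.\<close>
    have e: "1 / (2 * K) > 0" using K(1) by simp
    have cz: "cnj z \<in> \<bbbD>" using z by simp
    have "op_analytic F" using F(1) by (simp add: schur_class_def)
    from op_analyticD_continuous[OF this Fb(1) cz e]
    obtain d where d: "d > 0" "\<And>w u. w \<in> \<bbbD> \<Longrightarrow> dist w (cnj z) < d \<Longrightarrow> norm (F w u - F (cnj z) u) \<le> 1 / (2 * K) * norm u"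
      by blast
    have near: "norm (s w u - s z u) \<le> 1 / (2 * K) * norm u" if "w \<in> \<bbbD>" "dist w z < d" for w u
    proof -
      have "dist (cnj w) (cnj z) = dist w z" by (simp add: dist_norm flip: complex_cnj_diff)
      then have "norm (F (cnj w) u - F (cnj z) u) \<le> 1 / (2 * K) * norm u" using d(2)[of "cnj w" u] that by simp
      moreover have "norm (snd (F (cnj w) u - F (cnj z) u)) \<le> norm (F (cnj w) u - F (cnj z) u)"
        by (metis norm_snd_le prod.collapse)
      ultimately show ?thesis by (simp add: s_def)
    qed
    have "inj (s w) \<longleftrightarrow> inj (s z)" if w: "w \<in> \<bbbD>" "dist w z < d" for w
    proof
      assume inj: "inj (s z)"
      show "inj (s w)"
      proof (rule injI[OF w(1)])
        fix u assume u: "s w u = 0"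
        \<comment> \<open>Injectivity turns the left inverse \<open>s z\<close> of \<open>?D\<close>
          into a two-sided one.\<close>
        have "?D (s z u) = u" using inj sD[OF z, of "s z u"] by (simp add: inj_eq)
        then have "norm u \<le> K * norm (s z u)" using K(2)[of "s z u"] by simp
        also have "\<dots> \<le> K * (1 / (2 * K) * norm u)"
          using near[OF w, of u] u K(1) by (intro mult_left_mono) auto
        also have "\<dots> = norm u / 2" using K(1) by simp
        finally show "u = 0" by simp
      qed
    next
      assume inj: "inj (s w)"
      \<comment> \<open>\<open>I - M\<close> is \<open>s w \<circ> ?D\<close>, inverted by the
        Neumann series. With \<open>s w\<close> injective this makes \<open>?D\<close> onto, hence
        its left inverse \<open>s z\<close> injective.\<close>
      define M where "M u = s z (?D u) - s w (?D u)" for u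
      have M: "bounded_clinear M"
        unfolding M_def by (intro bounded_clinear_minus_fun bounded_clinear_compose[OF s[OF z] Dz]
            bounded_clinear_compose[OF s[OF w(1)] Dz])
      have half: "0 \<le> (1 / 2 :: real)" "(1 / 2 :: real) < 1" by simp_all
      have nM: "norm (M u) \<le> 1 / 2 * norm u" for u
      proof -
        have "norm (M u) \<le> 1 / (2 * K) * norm (?D u)"
          using near[OF w, of "?D u"] by (simp add: M_def norm_minus_commute)
        also have "\<dots> \<le> 1 / (2 * K) * (K * norm u)" using e K(2)[of u] by (intro mult_left_mono) auto
        also have "\<dots> = 1 / 2 * norm u" using K(1) by simp
        finally show ?thesis .
      qed
      from neumann_series_contraction[OF M half nM]
      obtain V where V: "bounded_clinear V" "\<And>u. V u - M (V u) = u" by metis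
      show "inj (s z)"
      proof (rule injI[OF z])
        fix u assume u: "s z u = 0"
        have "s w (?D (V (s w u))) = s w u" using V(2)[of "s w u"] by (simp add: M_def sD[OF z])
        then have "?D (V (s w u)) = u" using inj by (simp add: inj_eq)
        moreover from this have "V (s w u) = 0" using u sD[OF z, of "V (s w u)"] by simp
        ultimately show "u = 0" using bounded_clinear_zero[OF Dz] by simp
      qed
    qed
    then show ?thesis using d(1) by blast
  qed
  \<comment> \<open>\<open>D z0\<close> is injective, so its right inverse
    \<open>cadjoint (s z0)\<close> is also a left inverse; being onto, it forces \<open>s z0\<close>
    to be injective.\<close>
  have "inj (s z0)"
  proof (rule injI[OF z0(1)])
    fix u assume u: "s z0 u = 0"
    have inv: "D z0 (cadjoint (s z0) u) = u" for u
      by (rule cinner_ext) (simp add: cinner_cadjoint[OF D[OF z0(1)]] cinner_cadjoint_left[OF s[OF z0(1)]] sD[OF z0(1)])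
    have "cadjoint (s z0) (D z0 v) = v" for v using z0(2) inv[of "D z0 v"] by (simp add: inj_eq)
    then have "cinner u v = cinner 0 v" for v
      using u cinner_cadjoint[OF s[OF z0(1)], of u "D z0 v"] by simp
    then show "u = 0" by (rule cinner_ext)
  qed
  then have inj: "inj (s z)"
  proof (rule connected_induction_simple[of "\<bbbD>" z0 z "\<lambda>z. inj (s z)", rotated 3])
    fix a assume a: "a \<in> \<bbbD>"
    obtain d where d: "d > 0" "\<forall>w\<in>\<bbbD>. dist w a < d \<longrightarrow> (inj (s w) \<longleftrightarrow> inj (s a))" using loc[OF a] by blast
    show "\<exists>T. openin (top_of_set \<bbbD>) T \<and> a \<in> T \<and> (\<forall>x\<in>T. \<forall>y\<in>T. inj (s x) \<longrightarrow> inj (s y))"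
    proof (intro exI conjI)
      show "openin (top_of_set \<bbbD>) (\<bbbD> \<inter> ball a d)" by (simp add: openin_open_Int)
      show "a \<in> \<bbbD> \<inter> ball a d" using a d(1) by simp
      have "inj (s x) \<longleftrightarrow> inj (s a)" if "x \<in> \<bbbD> \<inter> ball a d" for x
        using d(2)[rule_format, of x] that by (simp add: dist_commute)
      then show "\<forall>x\<in>\<bbbD> \<inter> ball a d. \<forall>y\<in>\<bbbD> \<inter> ball a d. inj (s x) \<longrightarrow> inj (s y)" by blast
    qed
  qed (use z0 z in auto)
  have Ds: "cadjoint (D z) (s z u) = u" for u using inj sD[OF z, of "s z u"] by (simp add: inj_eq)
  have "(norm (cadjoint (C z) (s z u)))\<^sup>2 + (norm (s z u))\<^sup>2 \<le> (norm u)\<^sup>2" for u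
  proof -
    have "norm (cadjoint (C z) (s z u), s z u) \<le> norm u"
      using Fb(2)[of "cnj z" u] F(2)[OF z, of "s z u"] z by (simp add: Ds)
    then have "(norm (cadjoint (C z) (s z u), s z u))\<^sup>2 \<le> (norm u)\<^sup>2" by (intro power_mono) auto
    then show ?thesis by (simp add: norm_Pair)
  qed
  then show ?thesis using that[of "s z"] s[OF z] sD[OF z] Ds by blast
qed

text \<open>\<open>C e + D = D (I + D^(-1) C e)\<close>. As \<open>cadjoint (D z)\<close> is
  bounded, its inverse \<open>s\<close> is bounded below, and the estimate in
  \<open>D_inverse\<close> makes \<open>D^(-1) C\<close> a strict contraction; the Neumann series
  inverts the second factor.\<close>

lemma denominator_invertible:
  assumes z0: "z0 \<in> \<bbbD>" "inj (D z0)" and z: "z \<in> \<bbbD>" and e: "bounded_clinear e" "\<And>u. norm (e u) \<le> norm u"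
  shows "boundedly_invertible (\<lambda>u. C z (e u) + D z u)"
proof -
  obtain s where s: "bounded_clinear s" "\<And>u. s (cadjoint (D z) u) = u" "\<And>u. cadjoint (D z) (s u) = u"
    "\<And>u. (norm (cadjoint (C z) (s u)))\<^sup>2 + (norm (s u))\<^sup>2 \<le> (norm u)\<^sup>2"
    using D_inverse[OF z0 z] by blast
  note Dz = bounded_clinear_cadjoint[OF D[OF z]] and Cz = bounded_clinear_cadjoint[OF C[OF z]]
  define t where "t = cadjoint s"
  have t: "bounded_clinear t" unfolding t_def by (rule bounded_clinear_cadjoint[OF s(1)])
  have Dt: "D z (t u) = u" for u
    by (rule cinner_ext) (simp add: t_def cinner_cadjoint[OF D[OF z]] cinner_cadjoint_left[OF s(1)] s(2))
  have tD: "t (D z u) = u" for u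
    unfolding t_def by (rule cadjoint_eqI[OF s(1)]) (simp add: cinner_cadjoint_left[OF D[OF z], symmetric] s(3))
  obtain K0 where K0: "K0 > 0" "\<And>u. norm (cadjoint (D z) u) \<le> K0 * norm u" using bounded_clinear_bound[OF Dz] by blast
  \<comment> \<open>\<open>K \<ge> 1\<close> keeps the radicand in \<open>c\<close> nonnegative.
    That radicand comes from \<open>norm u \<le> K * norm (s u)\<close>, inserted into the estimate
    for \<open>cadjoint (C z) (s u)\<close>.\<close>
  define K where "K = max K0 1"
  have K: "K \<ge> 1" "norm (cadjoint (D z) u) \<le> K * norm u" for u
    using K0(2)[of u] by (auto simp: K_def intro: order_trans[OF _ mult_right_mono])
  define c where "c = sqrt (1 - 1 / K\<^sup>2)"
  have K2: "1 / K\<^sup>2 \<le> 1" "1 / K\<^sup>2 > 0" using K(1) by (auto simp: power_le_one_iff one_le_power)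
  have c: "0 \<le> c" "c < 1" using K2 by (auto simp: c_def)
  have Cs: "norm (cadjoint (C z) (s u)) \<le> c * norm u" for u
  proof (rule power2_le_imp_le)
    have "(norm u)\<^sup>2 \<le> (K * norm (s u))\<^sup>2" using K(2)[of "s u"] by (intro power_mono) (simp_all add: s(3))
    then have "(norm u)\<^sup>2 / K\<^sup>2 \<le> (norm (s u))\<^sup>2" using K(1) by (simp add: power_mult_distrib divide_le_eq mult.commute)
    then have "(norm (cadjoint (C z) (s u)))\<^sup>2 \<le> (1 - 1 / K\<^sup>2) * (norm u)\<^sup>2"
      using s(4)[of u] by (simp add: algebra_simps)
    also have "\<dots> = (c * norm u)\<^sup>2" using K2 by (simp add: c_def power_mult_distrib)
    finally show "(norm (cadjoint (C z) (s u)))\<^sup>2 \<le> (c * norm u)\<^sup>2" .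
  qed (use c in simp)
  have tC: "norm (t (C z w)) \<le> c * norm w" for w
  proof -
    have "cadjoint (\<lambda>u. cadjoint (C z) (s u)) w = t (C z w)"
      by (rule cadjoint_eqI[OF bounded_clinear_compose[OF Cz s(1)]])
        (simp add: cinner_cadjoint_left[OF C[OF z]] t_def cinner_cadjoint[OF s(1)])
    then show ?thesis using norm_cadjoint_le[OF bounded_clinear_compose[OF Cz s(1)] c(1) Cs, of w] by simp
  qed
  define M where "M u = - t (C z (e u))" for u
  have "M = (\<lambda>u. 0 - t (C z (e u)))" by (auto simp: M_def)
  then have M: "bounded_clinear M"
    using bounded_clinear_minus_fun[OF bounded_clinear_zero_fun bounded_clinear_compose[OF t bounded_clinear_compose[OF C[OF z] e(1)]]]
    by simp
  have "norm (M u) \<le> c * norm u" for u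
    using tC[of "e u"] mult_left_mono[OF e(2)[of u] c(1)] by (simp add: M_def)
  then obtain V where V: "bounded_clinear V" "\<And>u. V u - M (V u) = u" "\<And>u. V (u - M u) = u"
    using neumann_series_contraction[OF M c] by metis
  have bc: "bounded_clinear (\<lambda>u. C z (e u) + D z u)"
    by (intro bounded_clinear_plus bounded_clinear_compose[OF C[OF z] e(1)] D[OF z])
  have "V (t (C z (e u) + D z u)) = u" for u
    using V(3)[of u] by (simp add: M_def bounded_clinear_add[OF t] tD add.commute)
  moreover have "C z (e (V (t v))) + D z (V (t v)) = v" for v
  proof -
    have "D z (V (t v) + t (C z (e (V (t v))))) = D z (t v)" using V(2)[of "t v"] by (simp add: M_def)
    then show ?thesis by (simp add: bounded_clinear_add[OF D[OF z]] Dt add.commute)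
  qed
  ultimately show ?thesis unfolding boundedly_invertible_def
    using bc bounded_clinear_compose[OF V(1) t]
    by (intro conjI exI[of _ "\<lambda>v. V (t v)"]) (auto simp: fun_eq_iff)
qed

section \<open>Interpolation\<close>

text \<open>\<open>Ua\<close> and \<open>Va\<close> are the adjoints of \<open>\<Psi> A - S C\<close> and \<open>S D - \<Psi> B\<close>; the linear fractional
  formula for \<open>S\<close> with parameter \<open>\<E>\<close> reads \<open>S D - \<Psi> B = (\<Psi> A - S C) \<E>\<close>.\<close>

definition Ua where "Ua S z y = cadjoint (A z) (\<psi> z y) - cadjoint (C z) (cadjoint (S z) y)"
definition Va where "Va S z y = cadjoint (D z) (cadjoint (S z) y) - cadjoint (B z) (\<psi> z y)"

text \<open>The kernel identity at the pairs \<open>\<psi> z y\<close>,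
  \<open>- cadjoint (S z) y\<close>: the first column of \<open>\<Theta>\<close> produces
  \<open>Ua\<close>, the second \<open>- Va\<close>, whose sign is lost in the inner
  product.\<close>

lemma Ua_Va_identity:
  assumes S: "\<And>z. z \<in> \<bbbD> \<Longrightarrow> bounded_clinear (S z)" and z: "z \<in> \<bbbD>" and \<zeta>: "\<zeta> \<in> \<bbbD>"
  shows "cinner (Ua S \<zeta> y) (Ua S z y') - cinner (Va S \<zeta> y) (Va S z y')
    = (1 - z * cnj \<zeta>) * (cinner (\<kappa> \<zeta> y) (\<kappa> z y')
      - cinner (\<kappa>1 \<zeta> (cadjoint (S \<zeta>) y)) (\<kappa>1 z (cadjoint (S z) y'))
      - cinner (Pi (cadjoint Ob (\<kappa> \<zeta> y) - cadjoint On (\<kappa>1 \<zeta> (cadjoint (S \<zeta>) y))))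
          (cadjoint Ob (\<kappa> z y') - cadjoint On (\<kappa>1 z (cadjoint (S z) y'))))"
proof -
  have nz: "1 - z * cnj \<zeta> \<noteq> 0"
    using norm_mult_lt_one[OF \<zeta> z] by (metis eq_iff_diff_eq_0 less_irrefl norm_one)
  have C': "cadjoint (C z) (- u) = - cadjoint (C z) u" "cadjoint (D z) (- u) = - cadjoint (D z) u" if "z \<in> \<bbbD>" for z u
    using that by (simp_all add: bounded_clinear_minus[OF bounded_clinear_cadjoint[OF C]] bounded_clinear_minus[OF bounded_clinear_cadjoint[OF D]])
  have VV: "cinner (Va S \<zeta> y) (Va S z y') = cinner (cadjoint (B \<zeta>) (\<psi> \<zeta> y) + cadjoint (D \<zeta>) (- cadjoint (S \<zeta>) y))
      (cadjoint (B z) (\<psi> z y') + cadjoint (D z) (- cadjoint (S z) y'))"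
  proof -
    have "Va S z y = - (cadjoint (B z) (\<psi> z y) + cadjoint (D z) (- cadjoint (S z) y))" if "z \<in> \<bbbD>" for z y
      by (simp add: Va_def C'(2)[OF that])
    then show ?thesis using z \<zeta> by (simp only: cinner.minus_left cinner.minus_right minus_minus)
  qed
  have UU: "cinner (Ua S \<zeta> y) (Ua S z y') = cinner (cadjoint (A \<zeta>) (\<psi> \<zeta> y) + cadjoint (C \<zeta>) (- cadjoint (S \<zeta>) y))
      (cadjoint (A z) (\<psi> z y') + cadjoint (C z) (- cadjoint (S z) y'))"
    by (simp add: Ua_def C'(1)[OF z] C'(1)[OF \<zeta>])
  have SS: "cinner (- cadjoint (S \<zeta>) y) (- cadjoint (S z) y') = (1 - z * cnj \<zeta>) * cinner (\<kappa>1 \<zeta> (cadjoint (S \<zeta>) y)) (\<kappa>1 z (cadjoint (S z) y'))"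
    using nz by (simp add: cinner_kvec_one[OF \<zeta> z] cinner.minus_left cinner.minus_right)
  show ?thesis
    using kernel_identity[OF z \<zeta>, of "\<psi> \<zeta> y" "\<psi> z y'" "- cadjoint (S \<zeta>) y" "- cadjoint (S z) y'"]
    unfolding UU[symmetric] VV[symmetric] SS cinner_psi_psi[OF z \<zeta>] Phi_eq[OF z] Phi_eq[OF \<zeta>]
    by (simp add: algebra_simps)
qed

lemma cinner_Ua:
  assumes S: "bounded_clinear (S z)" and z: "z \<in> \<bbbD>"
  shows "cinner w (Ua S z y) = cinner (Psi \<beta> z (A z w) - S z (C z w)) y"
  by (simp add: Ua_def cinner.diff_right cinner.diff_left cinner_cadjoint[OF A[OF z], symmetric] cinner_Psi[OF z]
      cinner_cadjoint[OF C[OF z], symmetric] cinner_cadjoint[OF S, symmetric])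

lemma cinner_Va:
  assumes S: "bounded_clinear (S z)" and z: "z \<in> \<bbbD>"
  shows "cinner u (Va S z y) = cinner (S z (D z u) - Psi \<beta> z (B z u)) y"
  by (simp add: Va_def cinner.diff_right cinner.diff_left cinner_cadjoint[OF B[OF z], symmetric] cinner_Psi[OF z]
      cinner_cadjoint[OF D[OF z], symmetric] cinner_cadjoint[OF S, symmetric])

text \<open>The linear fractional formula with the denominator multiplied out, tested against
  \<open>y\<close>; \<open>w\<close> plays the role of \<open>\<E>(z) u\<close>.\<close>

lemma linear_fractional_iff:
  assumes S: "bounded_clinear (S z)" and z: "z \<in> \<bbbD>"
  shows "S z (C z w + D z u) = Psi \<beta> z (A z w + B z u) \<longleftrightarrow> (\<forall>y. cinner u (Va S z y) = cinner w (Ua S z y))"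
proof -
  have "S z (C z w + D z u) = Psi \<beta> z (A z w + B z u)
      \<longleftrightarrow> S z (D z u) - Psi \<beta> z (B z u) = Psi \<beta> z (A z w) - S z (C z w)"
    by (auto simp: bounded_clinear_add[OF S] bounded_clinear_add[OF Psi[OF z]] algebra_simps)
  also have "\<dots> \<longleftrightarrow> (\<forall>y. cinner (S z (D z u) - Psi \<beta> z (B z u)) y = cinner (Psi \<beta> z (A z w) - S z (C z w)) y)"
    by (metis cinner_ext)
  finally show ?thesis by (simp add: cinner_Ua[of S z, OF S z] cinner_Va[of S z, OF S z])
qed

lemma cinner_Ob_sums: "(\<lambda>j. cinner (E ((T ^^ j) x)) (h2_coeff \<beta> y j)) sums cinner (Ob x) y"
  using cinner_sums_ell2[of "Ob x" y]
  by (simp add: E.nth_obs_vec h2_coeff_def cinner.scaleR_left cinner.scaleR_right)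

text \<open>The condition speaks of constants only. As multiplication by \<open>S\<close> commutes
  with the shift, coefficient \<open>k\<close> of \<open>W (Ob x)\<close> is coefficient 0 of
  \<open>W (Ob ((T ^^ k) x))\<close>, so agreement at constants spreads to all coefficients.\<close>

lemma interpolation_condition_iff:
  assumes S: "\<And>z. z \<in> \<bbbD> \<Longrightarrow> bounded_clinear (S z)"
    and W: "bounded_clinear W" "\<And>x. norm (W x) \<le> norm x"
    and kv: "\<And>z y. z \<in> \<bbbD> \<Longrightarrow> W (\<kappa> z y) = \<kappa>1 z (cadjoint (S z) y)"
  shows "(\<forall>u. H2_adjoint \<beta> (obs \<beta> E T) (mult_op \<beta> S (H2_const u)) = cadjoint N u) \<longleftrightarrow> (\<forall>x. W (Ob x) = On x)"
proof -
  have eq: "H2_adjoint \<beta> (obs \<beta> E T) (mult_op \<beta> S (H2_const u)) = cadjoint Ob (cadjoint W (ell2_unit 0 u))" for u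
  proof -
    have "mult_op \<beta> S (ell2_nth (ell2_unit 0 u)) = h2_coeff \<beta> (cadjoint W (ell2_unit 0 u))"
      by (rule multiplier_of_adjoint(3)[OF wt S W kv])
    then show ?thesis by (simp only: H2_const_eq E.H2_adjoint_obs)
  qed
  have coef: "cinner (ell2_nth (W (Ob x)) k) u = cinner (Ob x) (cadjoint W (ell2_unit k u))" for x k u
    by (simp add: cinner_ell2_unit[symmetric] cinner_cadjoint[OF W(1)])
  have shift: "cinner (Ob x) (cadjoint W (ell2_unit k u)) = cinner (Ob ((T ^^ k) x)) (cadjoint W (ell2_unit 0 u))" for x k u
  proof -
    let ?f = "\<lambda>j. cinner (E ((T ^^ j) x)) (h2_coeff \<beta> (cadjoint W (ell2_unit k u)) j)"
    have hc: "h2_coeff \<beta> (cadjoint W (ell2_unit k u)) j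
        = (if j < k then 0 else h2_coeff \<beta> (cadjoint W (ell2_unit 0 u)) (j - k))" for j
      by (rule h2_coeff_mult_unit[OF wt S W kv])
    have "(\<lambda>j. ?f (j + k)) sums cinner (Ob ((T ^^ k) x)) (cadjoint W (ell2_unit 0 u))"
      using cinner_Ob_sums[of "(T ^^ k) x" "cadjoint W (ell2_unit 0 u)"] by (simp add: hc funpow_add)
    then have "?f sums (cinner (Ob ((T ^^ k) x)) (cadjoint W (ell2_unit 0 u)) + (\<Sum>j<k. ?f j))"
      by (simp only: sums_iff_shift[of ?f] add_diff_cancel)
    moreover have "(\<Sum>j<k. ?f j) = 0" by (simp add: hc)
    ultimately show ?thesis using cinner_Ob_sums[of x "cadjoint W (ell2_unit k u)"] sums_unique2 by fastforce
  qed
  show ?thesis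
  proof
    assume "\<forall>u. H2_adjoint \<beta> (obs \<beta> E T) (mult_op \<beta> S (H2_const u)) = cadjoint N u"
    then have adj: "cadjoint Ob (cadjoint W (ell2_unit 0 u)) = cadjoint N u" for u by (simp add: eq)
    have "ell2_nth (W (Ob x)) k = ell2_nth (On x) k" for x k
    proof (rule cinner_ext)
      fix u
      have "cinner (ell2_nth (W (Ob x)) k) u = cinner ((T ^^ k) x) (cadjoint N u)"
        unfolding coef shift[of x k u] adj[symmetric] by (rule cinner_cadjoint[OF Ob])
      then show "cinner (ell2_nth (W (Ob x)) k) u = cinner (ell2_nth (On x) k) u"
        by (simp add: cinner_cadjoint[OF N, symmetric] N.nth_obs_vec)
    qed
    then show "\<forall>x. W (Ob x) = On x" by (auto intro: ell2_eqI)
  next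
    assume W_Ob: "\<forall>x. W (Ob x) = On x"
    have "cinner x (cadjoint Ob (cadjoint W (ell2_unit 0 u))) = cinner x (cadjoint N u)" for x u
      using coef[of x 0 u] W_Ob by (simp add: cinner_cadjoint[OF Ob, symmetric] cinner_cadjoint[OF N, symmetric] N.nth_obs_vec)
    then show "\<forall>u. H2_adjoint \<beta> (obs \<beta> E T) (mult_op \<beta> S (H2_const u)) = cadjoint N u"
      unfolding eq using cinner_ext_right by blast
  qed
qed

text \<open>\<open>W\<close> is the adjoint of the multiplication operator by \<open>S\<close>. Since \<open>W Ob = On\<close>, the kernel
  \<open>U U\<^sup>* - V V\<^sup>*\<close> divided by \<open>1 - z cnj \<zeta>\<close> is compressed from
  \<open>Q - Q Ob P\<^sup>-\<^sup>1 Ob\<^sup>* Q\<close> with \<open>Q = I - W\<^sup>* W\<close>, and this operator is \<open>H\<^sup>* H\<close> for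
  \<open>H = Q\<^sup>1\<^sup>/\<^sup>2 (I - Ob P\<^sup>-\<^sup>1 Ob\<^sup>* Q)\<close>. The factorization \<open>V = U \<E>\<close> then follows by a lurking isometry.\<close>

lemma schur_parameter_exists:
  assumes S: "\<And>z. z \<in> \<bbbD> \<Longrightarrow> bounded_clinear (S z)"
    and W: "bounded_clinear W" "\<And>x. norm (W x) \<le> norm x"
    and kv: "\<And>z y. z \<in> \<bbbD> \<Longrightarrow> W (\<kappa> z y) = \<kappa>1 z (cadjoint (S z) y)"
    and W_Ob: "\<And>x. W (Ob x) = On x"
  obtains F where "F \<in> schur_class" "\<And>z u. z \<in> \<bbbD> \<Longrightarrow> S z (C z (F z u) + D z u) = Psi \<beta> z (A z (F z u) + B z u)"
proof -
  define Q where "Q h = h - cadjoint W (W h)" for h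
  note W' = bounded_clinear_cadjoint[OF W(1)] and Ob' = bounded_clinear_cadjoint[OF Ob]
  have Q: "bounded_clinear Q"
    unfolding Q_def by (intro bounded_clinear_intros bounded_clinear_compose[OF W' W(1)])
  have Qc: "cinner (Q a) b = cinner a b - cinner (W a) (W b)" for a b
    by (simp add: Q_def cinner.diff_left cinner_cadjoint_left[OF W(1)])
  have Qs: "cinner (Q a) b = cinner a (Q b)" for a b
    by (simp add: Q_def cinner.diff_left cinner.diff_right cinner_cadjoint_left[OF W(1)] cinner_cadjoint[OF W(1), symmetric])
  have "0 \<le> Re (cinner (Q a) a)" for a
    using power_mono[OF W(2) norm_ge_zero, of a 2] by (simp add: Qc cinner_self_eq)
  then obtain G where G: "bounded_clinear G" "\<And>x y. cinner (G x) y = cinner x (G y)" "\<And>x. G (G x) = Q x"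
    using positive_operator_sqrt[OF Q Qs] by blast
  \<comment> \<open>This is \<open>F^*\<close> of the overview; its form with \<open>Q\<close> rests
    on \<open>W Ob = On\<close>.\<close>
  define f where "f h = cadjoint Ob (Q h)" for h
  have f_eq: "f h = cadjoint Ob h - cadjoint On (W h)" for h
  proof -
    have "cadjoint Ob (cadjoint W (W h)) = cadjoint On (W h)"
      by (rule cadjoint_eqI[OF Ob])
        (simp add: cinner_cadjoint[OF W(1), symmetric] W_Ob cinner_cadjoint[OF On])
    then show ?thesis by (simp add: f_def Q_def bounded_clinear_diff[OF Ob'])
  qed
  \<comment> \<open>\<open>Ob^* Q Ob = P\<close>, which makes the last of the four terms in
    \<open>HH\<close> cancel a cross term.\<close>
  have ObQOb: "cinner (Q (Ob x)) (Ob y) = cinner (P x) y" for x y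
    by (simp add: Qc W_Ob cinner_P)
  define H where "H h = G (h - Ob (Pi (f h)))" for h
  have f_sc: "f (c *\<^sub>C h) = c *\<^sub>C f h" for c h
    by (simp add: f_def bounded_clinear_scaleC[OF Q] bounded_clinear_scaleC[OF Ob'])
  have H_sc: "H (c *\<^sub>C h) = c *\<^sub>C H h" for c h
    by (simp add: H_def f_sc bounded_clinear_scaleC[OF Pi(1)] bounded_clinear_scaleC[OF Ob]
        bounded_clinear_scaleC[OF G(1)] flip: scaleC.diff_right)
  have HH: "cinner (H a) (H b) = cinner a b - cinner (W a) (W b) - cinner (Pi (f a)) (f b)" for a b
  proof -
    have "cinner (H a) (H b) = cinner (Q (a - Ob (Pi (f a)))) (b - Ob (Pi (f b)))"
      by (simp add: H_def G(2)[symmetric] G(3))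
    also have "\<dots> = cinner (Q a) b - cinner (Q a) (Ob (Pi (f b))) - cinner (Q (Ob (Pi (f a)))) b
        + cinner (Q (Ob (Pi (f a)))) (Ob (Pi (f b)))"
      by (simp add: bounded_clinear_diff[OF Q] cinner.diff_left cinner.diff_right)
    also have "cinner (Q a) (Ob (Pi (f b))) = cinner (f a) (Pi (f b))"
      by (simp add: f_def cinner_cadjoint_left[OF Ob])
    also have "cinner (Q (Ob (Pi (f a)))) b = cinner (Pi (f a)) (f b)"
      unfolding Qs by (simp add: f_def cinner_cadjoint[OF Ob])
    also have "cinner (Q (Ob (Pi (f a)))) (Ob (Pi (f b))) = cinner (f a) (Pi (f b))"
      unfolding ObQOb Pi(2) ..
    finally show ?thesis by (simp add: Qc)
  qed
  define p where "p z y = (cnj z *\<^sub>C H (\<kappa> z y), Ua S z y)" for z y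
  define q where "q z y = (H (\<kappa> z y), Va S z y)" for z y
  note dw = disk_weight_weight_sequence[OF wt]
  have hp: "p z (c *\<^sub>C y) = c *\<^sub>C p z y" if z: "z \<in> \<bbbD>" for z c y
    by (simp add: p_def Ua_def scaleC_prod_def kvec_scaleC[OF dw z] kvec_scaleC[OF disk_weight_gamma z] H_sc scaleC_scaleC mult.commute
        bounded_clinear_scaleC[OF bounded_clinear_cadjoint[OF A[OF z]]] bounded_clinear_scaleC[OF bounded_clinear_cadjoint[OF C[OF z]]]
        bounded_clinear_scaleC[OF bounded_clinear_cadjoint[OF S[OF z]]] scaleC.diff_right)
  have hq: "q z (c *\<^sub>C y) = c *\<^sub>C q z y" if z: "z \<in> \<bbbD>" for z c y
    by (simp add: q_def Va_def scaleC_prod_def kvec_scaleC[OF dw z] kvec_scaleC[OF disk_weight_gamma z] H_sc scaleC_scaleC mult.commute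
        bounded_clinear_scaleC[OF bounded_clinear_cadjoint[OF B[OF z]]] bounded_clinear_scaleC[OF bounded_clinear_cadjoint[OF D[OF z]]]
        bounded_clinear_scaleC[OF bounded_clinear_cadjoint[OF S[OF z]]] scaleC.diff_right)
  have gram: "cinner (q \<zeta> y) (q z y') = cinner (p \<zeta> y) (p z y')" if \<zeta>: "\<zeta> \<in> \<bbbD>" and z: "z \<in> \<bbbD>" for \<zeta> z y y'
    using Ua_Va_identity[of S, OF S z \<zeta>, of y y']
    unfolding kv[OF z, symmetric] kv[OF \<zeta>, symmetric] f_eq[symmetric] HH[symmetric]
    by (simp add: p_def q_def cinner_prod_def cinner_scaleC_left cinner_scaleC_right algebra_simps)
  obtain L where L: "bounded_clinear L" "\<And>v. norm (L v) \<le> norm v" "\<And>z y. z \<in> \<bbbD> \<Longrightarrow> L (p z y) = q z y"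
    using lurking_isometry[of "\<bbbD>" p q, OF hp hq gram] by metis
  \<comment> \<open>\<open>p\<close> and \<open>q\<close> involve \<open>cnj z\<close> and the
    adjoints of \<open>U\<close> and \<open>V\<close>; passing to the adjoint of \<open>L\<close>
    gives a parameter analytic in \<open>z\<close>.\<close>
  have "norm (cadjoint L v) \<le> norm v" for v using norm_cadjoint_le[OF L(1), of 1] L(2) by simp
  then obtain F where F: "F \<in> schur_class" "\<And>z u. z \<in> \<bbbD> \<Longrightarrow> \<exists>h. cadjoint L (z *\<^sub>C h, u) = (h, F z u)"
    using transfer_function[OF bounded_clinear_cadjoint[OF L(1)]] by metis
  have "cinner u (Va S z y) = cinner (F z u) (Ua S z y)" if z: "z \<in> \<bbbD>" for z u y
  proof -
    obtain h where h: "cadjoint L (z *\<^sub>C h, u) = (h, F z u)" using F(2)[OF z] by blast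
    have "cinner (cadjoint L (z *\<^sub>C h, u)) (p z y) = cinner (z *\<^sub>C h, u) (q z y)"
      by (simp add: cinner_cadjoint_left[OF L(1)] L(3)[OF z])
    then show ?thesis
      by (simp add: h p_def q_def cinner_prod_def cinner_scaleC_left cinner_scaleC_right)
  qed
  then have "S z (C z (F z u) + D z u) = Psi \<beta> z (A z (F z u) + B z u)" if "z \<in> \<bbbD>" for z u
    using linear_fractional_iff[of S z, OF S[OF that] that] that by blast
  then show ?thesis using that F(1) by blast
qed

text \<open>One inequality on finite sums of kernels is used twice: without its nonnegative
  \<open>Pi\<close> term it defines \<open>W\<close>, and in full, extended to all of
  \<open>ell2\<close> by density, it forces \<open>W Ob = On\<close>.\<close>

lemma schur_parameter_interpolates:
  assumes S: "\<And>z. z \<in> \<bbbD> \<Longrightarrow> bounded_clinear (S z)" and F: "F \<in> schur_class"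
    and SF: "\<And>z u. z \<in> \<bbbD> \<Longrightarrow> S z (C z (F z u) + D z u) = Psi \<beta> z (A z (F z u) + B z u)"
  obtains W where "bounded_clinear W" "\<And>x. norm (W x) \<le> norm x"
    "\<And>z y. z \<in> \<bbbD> \<Longrightarrow> W (\<kappa> z y) = \<kappa>1 z (cadjoint (S z) y)" "\<And>x. W (Ob x) = On x"
proof -
  note Ob' = bounded_clinear_cadjoint[OF Ob] and On' = bounded_clinear_cadjoint[OF On]
  note dw = disk_weight_weight_sequence[OF wt]
  have Fb: "bounded_clinear (F z)" if "z \<in> \<bbbD>" for z using F that by (simp add: schur_class_def)
  have VU: "Va S z y = cadjoint (F z) (Ua S z y)" if z: "z \<in> \<bbbD>" for z y
  proof (rule cinner_ext_right)
    show "cinner u (Va S z y) = cinner u (cadjoint (F z) (Ua S z y))" for u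
      using linear_fractional_iff[of S z "F z u" u, OF S[OF z] z] SF[OF z]
      by (simp add: cinner_cadjoint[OF Fb[OF z], symmetric])
  qed
  have ineq: "(norm (\<Sum>i<n. \<kappa>1 (\<zeta> i) (cadjoint (S (\<zeta> i)) (y i))))\<^sup>2
      + Re (cinner (Pi (cadjoint Ob (\<Sum>i<n. \<kappa> (\<zeta> i) (y i)) - cadjoint On (\<Sum>i<n. \<kappa>1 (\<zeta> i) (cadjoint (S (\<zeta> i)) (y i)))))
          (cadjoint Ob (\<Sum>i<n. \<kappa> (\<zeta> i) (y i)) - cadjoint On (\<Sum>i<n. \<kappa>1 (\<zeta> i) (cadjoint (S (\<zeta> i)) (y i)))))
      \<le> (norm (\<Sum>i<n. \<kappa> (\<zeta> i) (y i)))\<^sup>2"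
    if \<zeta>: "\<And>i. \<zeta> i \<in> \<bbbD>" for n :: nat and \<zeta> :: "nat \<Rightarrow> complex" and y :: "nat \<Rightarrow> 'y"
  proof -
    define h where "h i = \<kappa> (\<zeta> i) (y i)" for i
    define g where "g i = \<kappa>1 (\<zeta> i) (cadjoint (S (\<zeta> i)) (y i))" for i
    define f where "f i = cadjoint Ob (h i) - cadjoint On (g i)" for i
    have f: "cadjoint Ob (\<Sum>i<n. h i) - cadjoint On (\<Sum>i<n. g i) = (\<Sum>i<n. f i)"
      by (simp add: f_def bounded_clinear_sum[OF Ob'] bounded_clinear_sum[OF On'] sum_subtractf)
    have pair: "cinner (\<kappa>1 (\<zeta> i) (Ua S (\<zeta> i) (y i))) (\<kappa>1 (\<zeta> j) (Ua S (\<zeta> j) (y j)))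
        - cinner (\<kappa>1 (\<zeta> i) (Va S (\<zeta> i) (y i))) (\<kappa>1 (\<zeta> j) (Va S (\<zeta> j) (y j)))
        = cinner (h i) (h j) - cinner (g i) (g j) - cinner (Pi (f i)) (f j)" for i j
    proof -
      have nz: "1 - \<zeta> j * cnj (\<zeta> i) \<noteq> 0"
        using norm_mult_lt_one[OF \<zeta> \<zeta>, of j i] by (metis eq_iff_diff_eq_0 less_irrefl norm_one)
      have "cinner (Ua S (\<zeta> i) (y i)) (Ua S (\<zeta> j) (y j)) - cinner (Va S (\<zeta> i) (y i)) (Va S (\<zeta> j) (y j))
          = (1 - \<zeta> j * cnj (\<zeta> i)) * (cinner (h i) (h j) - cinner (g i) (g j) - cinner (Pi (f i)) (f j))"
        unfolding h_def g_def f_def by (rule Ua_Va_identity[OF S \<zeta> \<zeta>])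
      then show ?thesis
        using nz unfolding cinner_kvec_one[OF \<zeta> \<zeta>] diff_divide_distrib[symmetric] by simp
    qed
    have "(norm (\<Sum>i<n. \<kappa>1 (\<zeta> i) (Va S (\<zeta> i) (y i))))\<^sup>2 \<le> (norm (\<Sum>i<n. \<kappa>1 (\<zeta> i) (Ua S (\<zeta> i) (y i))))\<^sup>2"
      using schur_class_kernel_contraction[OF F \<zeta>, where n = n and w = "\<lambda>i. Ua S (\<zeta> i) (y i)"]
      by (intro power_mono) (simp_all add: VU[OF \<zeta>])
    moreover have "complex_of_real ((norm (\<Sum>i<n. \<kappa>1 (\<zeta> i) (Ua S (\<zeta> i) (y i))))\<^sup>2) - complex_of_real ((norm (\<Sum>i<n. \<kappa>1 (\<zeta> i) (Va S (\<zeta> i) (y i))))\<^sup>2)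
        = complex_of_real ((norm (\<Sum>i<n. h i))\<^sup>2) - complex_of_real ((norm (\<Sum>i<n. g i))\<^sup>2) - cinner (Pi (\<Sum>i<n. f i)) (\<Sum>i<n. f i)"
    proof -
      have "cinner (Pi (\<Sum>i<n. f i)) (\<Sum>i<n. f i) = (\<Sum>i<n. \<Sum>j<n. cinner (Pi (f i)) (f j))"
        unfolding bounded_clinear_sum[OF Pi(1)] cinner.sum_left cinner.sum_right by (rule sum.swap)
      then show ?thesis
        unfolding norm_square_sum_cinner by (simp only: sum_subtractf[symmetric] pair)
    qed
    from arg_cong[OF this, of Re]
    have "(norm (\<Sum>i<n. \<kappa>1 (\<zeta> i) (Ua S (\<zeta> i) (y i))))\<^sup>2 - (norm (\<Sum>i<n. \<kappa>1 (\<zeta> i) (Va S (\<zeta> i) (y i))))\<^sup>2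
        = (norm (\<Sum>i<n. h i))\<^sup>2 - (norm (\<Sum>i<n. g i))\<^sup>2 - Re (cinner (Pi (\<Sum>i<n. f i)) (\<Sum>i<n. f i))"
      by simp
    ultimately show ?thesis
      unfolding h_def[symmetric] g_def[symmetric] f by linarith
  qed
  have le: "norm (\<Sum>i<n. \<kappa>1 (\<zeta> i) (cadjoint (S (\<zeta> i)) (y i))) \<le> norm (\<Sum>i<n. \<kappa> (\<zeta> i) (y i))"
    if \<zeta>: "\<And>i. \<zeta> i \<in> \<bbbD>" for n :: nat and \<zeta> :: "nat \<Rightarrow> complex" and y :: "nat \<Rightarrow> 'y"
    by (rule power2_le_imp_le[OF order_trans[OF _ ineq[OF \<zeta>]]]) (simp_all add: Pi_nonneg)
  have hp: "\<kappa> z (c *\<^sub>C y) = c *\<^sub>C \<kappa> z y" if z: "z \<in> \<bbbD>" for z c y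
    by (rule kvec_scaleC[OF dw z])
  have hq: "\<kappa>1 z (cadjoint (S z) (c *\<^sub>C y)) = c *\<^sub>C \<kappa>1 z (cadjoint (S z) y)" if z: "z \<in> \<bbbD>" for z c y
    by (simp add: kvec_scaleC[OF disk_weight_one z] bounded_clinear_scaleC[OF bounded_clinear_cadjoint[OF S[OF z]]])
  obtain W where W: "bounded_clinear W" "\<And>x. norm (W x) \<le> norm x"
      "\<And>z y. z \<in> \<bbbD> \<Longrightarrow> W (\<kappa> z y) = \<kappa>1 z (cadjoint (S z) y)"
    using contraction_extension_family[of "\<bbbD>" \<kappa> "\<lambda>z y. \<kappa>1 z (cadjoint (S z) y)", OF hp hq le] by metis
  define f where "f h = cadjoint Ob h - cadjoint On (W h)" for h
  have f: "bounded_clinear f"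
    unfolding f_def by (intro bounded_clinear_minus_fun Ob' bounded_clinear_compose[OF On' W(1)])
  define M where "M = {sum h {..<n} | h n. \<forall>k<n::nat. h k \<in> {\<kappa> z y | z y. z \<in> \<bbbD>}}"
  have M: "csubspace M"
    unfolding M_def by (rule csubspace_finite_sums) (use hp[symmetric] in blast)
  have clM: "closure M = UNIV"
  proof (rule closure_eq_UNIV_if_orthogonal_zero[OF M])
    fix x assume x: "\<And>v. v \<in> M \<Longrightarrow> cinner x v = 0"
    have "\<kappa> z y \<in> M" if "z \<in> \<bbbD>" for z y
    proof -
      have "\<kappa> z y = sum (\<lambda>_. \<kappa> z y) {..<1::nat}" by simp
      then show ?thesis unfolding M_def using that by blast
    qed
    then show "x = 0"
      by (intro kvec_total[OF dw]) (use x \<beta>_pos less_irrefl in \<open>auto simp: less_imp_neq[THEN not_sym]\<close>)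
  qed
  have "M \<subseteq> {h. (norm (W h))\<^sup>2 + Re (cinner (Pi (f h)) (f h)) \<le> (norm h)\<^sup>2}"
  proof
    fix v assume "v \<in> M"
    then obtain h n where h: "v = sum h {..<n::nat}" "\<forall>k<n. h k \<in> {\<kappa> z y | z y. z \<in> \<bbbD>}" unfolding M_def by blast
    \<comment> \<open>Indices beyond \<open>n\<close> get the dummy point 0, since
      \<open>ineq\<close> wants every \<open>\<zeta> k\<close> in the disk.\<close>
    have "\<forall>k. \<exists>z y. z \<in> \<bbbD> \<and> (k < n \<longrightarrow> h k = \<kappa> z y)"
    proof
      fix k show "\<exists>z y. z \<in> \<bbbD> \<and> (k < n \<longrightarrow> h k = \<kappa> z y)"
      proof (cases "k < n")
        case True then show ?thesis using h(2) by blast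
      next
        case False then show ?thesis by (intro exI[of _ 0]) simp
      qed
    qed
    then obtain \<zeta> y where zy: "\<And>k. \<zeta> k \<in> \<bbbD>" "\<And>k. k < n \<Longrightarrow> h k = \<kappa> (\<zeta> k) (y k)" by metis
    have v: "v = (\<Sum>k<n. \<kappa> (\<zeta> k) (y k))" using h(1) zy(2) by simp
    have Wv: "W v = (\<Sum>k<n. \<kappa>1 (\<zeta> k) (cadjoint (S (\<zeta> k)) (y k)))"
      by (simp add: v bounded_clinear_sum[OF W(1)] W(3)[OF zy(1)])
    show "v \<in> {h. (norm (W h))\<^sup>2 + Re (cinner (Pi (f h)) (f h)) \<le> (norm h)\<^sup>2}"
      using ineq[where \<zeta> = \<zeta> and n = n and y = y, OF zy(1)] unfolding Wv[symmetric] v[symmetric] f_def[symmetric] by simp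
  qed
  moreover have "closed {h. (norm (W h))\<^sup>2 + Re (cinner (Pi (f h)) (f h)) \<le> (norm h)\<^sup>2}"
  proof (rule closed_Collect_le)
    note cont = linear_continuous_on[OF bounded_clinear_imp_bounded_linear]
    show "continuous_on UNIV (\<lambda>h. (norm (W h))\<^sup>2 + Re (cinner (Pi (f h)) (f h)))"
      by (intro continuous_intros cinner.continuous_on cont[OF W(1)] cont[OF f] cont[OF bounded_clinear_compose[OF Pi(1) f]])
  qed (intro continuous_intros)
  ultimately have all: "(norm (W h))\<^sup>2 + Re (cinner (Pi (f h)) (f h)) \<le> (norm h)\<^sup>2" for h
    using closure_minimal clM by blast
  txt \<open>At \<open>h = Ob x\<close> the inequality says that \<open>d = W (Ob x) - On x\<close> vanishes.\<close>
  have "W (Ob x) = On x" for x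
  proof -
    define d where "d = W (Ob x) - On x"
    define e where "e = cadjoint On d"
    have Wx: "W (Ob x) = On x + d" by (simp add: d_def)
    have fx: "f (Ob x) = P x - e"
      by (simp add: f_def P_eq Wx e_def bounded_clinear_add[OF On'])
    have ex: "cinner e x = cinner d (On x)" by (simp add: e_def cinner_cadjoint_left[OF On])
    have xe: "cinner x e = cinner (On x) d" by (simp add: e_def cinner_cadjoint[OF On])
    have "cinner (Pi (f (Ob x))) (f (Ob x)) = cinner (P x) x - cinner x e - cinner e x + cinner (Pi e) e"
    proof -
      have "cinner (Pi e) (P x) = cinner e x" by (simp add: cinner_Pi_commute Pi(3))
      then show ?thesis
        by (simp add: fx bounded_clinear_diff[OF Pi(1)] Pi(3) cinner.diff_left cinner.diff_right cinner_P_commute)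
    qed
    moreover have "complex_of_real ((norm (W (Ob x)))\<^sup>2) = cinner (On x) (On x) + cinner (On x) d + cinner d (On x) + complex_of_real ((norm d)\<^sup>2)"
      unfolding cinner_self_eq[symmetric] Wx by (simp add: cinner.add_left cinner.add_right)
    moreover have "complex_of_real ((norm (Ob x))\<^sup>2) = cinner (P x) x + cinner (On x) (On x)"
      unfolding cinner_self_eq[symmetric] cinner_P by simp
    \<comment> \<open>The cross terms of \<open>f (Ob x) = P x - e\<close> cancel those of
      \<open>W (Ob x) = On x + d\<close>; what remains is \<open>norm d\<close> squared and a
      nonnegative term.\<close>
    ultimately have "complex_of_real ((norm (W (Ob x)))\<^sup>2) + cinner (Pi (f (Ob x))) (f (Ob x))
        = complex_of_real ((norm (Ob x))\<^sup>2) + complex_of_real ((norm d)\<^sup>2) + cinner (Pi e) e"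
      unfolding xe ex by simp
    from arg_cong[OF this, of Re]
    have "(norm (W (Ob x)))\<^sup>2 + Re (cinner (Pi (f (Ob x))) (f (Ob x))) = (norm (Ob x))\<^sup>2 + (norm d)\<^sup>2 + Re (cinner (Pi e) e)"
      by simp
    then have "(norm d)\<^sup>2 \<le> 0" using all[of "Ob x"] Pi_nonneg[of e] by linarith
    then show ?thesis by (simp add: d_def)
  qed
  then show ?thesis using that W by blast
qed

end

text \<open>\<open>inv\<close> is a total operator, so the first conjunct is what gives the formula
  its meaning. The formula is imposed on the values of \<open>S\<close> in the disk.\<close>

theorem theorem3p8:
  fixes \<beta> :: "nat \<Rightarrow> real"
    and T :: "'x::complex_hilbert \<Rightarrow> 'x"
    and E :: "'x \<Rightarrow> 'y::complex_hilbert"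
    and N :: "'x \<Rightarrow> 'u::complex_hilbert"
    and P :: "'x \<Rightarrow> 'x"
    and A :: "complex \<Rightarrow> 'y ell2 \<Rightarrow> 'y ell2"
    and B :: "complex \<Rightarrow> 'u \<Rightarrow> 'y ell2"
    and C :: "complex \<Rightarrow> 'y ell2 \<Rightarrow> 'u"
    and D :: "complex \<Rightarrow> 'u \<Rightarrow> 'u"
    and J :: "'y ell2 \<times> 'u \<Rightarrow> 'y ell2 \<times> 'u"
    and \<Theta> :: "complex \<Rightarrow> 'y ell2 \<times> 'u \<Rightarrow> 'y ell2 \<times> 'u"
  assumes "weight_sequence \<beta>" and "decseq \<beta>"
    and "bounded_clinear T" and "bounded_clinear E" and "bounded_clinear N"
    and "output_stable \<beta> E T" and "output_stable one_weight N T"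
    and P_def: "P = (\<lambda>x. gramian \<beta> E T x - gramian one_weight N T x)"
    and "strictly_positive P"
    and J_def: "J = signature_op"
    and "\<And>z. z \<in> \<bbbD> \<Longrightarrow> bounded_clinear (A z) \<and> bounded_clinear (B z)
                      \<and> bounded_clinear (C z) \<and> bounded_clinear (D z)"
    and Theta_def: "\<And>z. \<Theta> z = block_op (A z) (B z) (C z) (D z)"
    and "\<And>z \<zeta> v. z \<in> \<bbbD> \<Longrightarrow> \<zeta> \<in> \<bbbD> \<Longrightarrow>
       inverse (1 - z * cnj \<zeta>) *\<^sub>C (J v - \<Theta> z (J (cadjoint (\<Theta> \<zeta>) v)))
       = (col_op (obs_tilde \<beta> E T) N
          \<circ> inv (\<lambda>x. x - z *\<^sub>C T x)
          \<circ> inv P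
          \<circ> inv (\<lambda>x. x - cnj \<zeta> *\<^sub>C cadjoint T x)
          \<circ> row_op (cadjoint (obs_tilde \<beta> E T)) (cadjoint N)) v"
    \<comment> \<open>Automatic if the space \<open>'u\<close> is finite dimensional. In general the identity above yields
        only surjectivity of \<open>D z\<close>, while the inverse below at the zero parameter is that of \<open>D z\<close>.\<close>
    and "(\<nexists>F :: 'u set. finite F \<and> span F = UNIV) \<Longrightarrow> \<exists>z\<in>\<bbbD>. inj (D z)"
  shows "(\<forall>\<E>\<in>schur_class. \<forall>z\<in>\<bbbD>. boundedly_invertible (\<lambda>u. C z (\<E> z u) + D z u))
    \<and> (\<forall>S :: complex \<Rightarrow> 'u \<Rightarrow> 'y.
        S \<in> schur_multipliers \<beta>
          \<and> (\<forall>u. H2_adjoint \<beta> (obs \<beta> E T) (mult_op \<beta> S (H2_const u)) = cadjoint N u)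
        \<longleftrightarrow> (\<exists>\<E>\<in>schur_class. \<forall>z\<in>\<bbbD>.
              S z = Psi \<beta> z \<circ> (\<lambda>u. A z (\<E> z u) + B z u) \<circ> inv (\<lambda>u. C z (\<E> z u) + D z u)))"
proof -
  interpret interpolation_data \<beta> T E N P A B C D
    using assms(1-9,11) assms(13)[unfolded J_def Theta_def] by unfold_locales auto
  \<comment> \<open>In finite dimension the point 0 serves, because \<open>D 0\<close> is
    onto.\<close>
  obtain z0 where z0: "z0 \<in> \<bbbD>" "inj (D z0)"
  proof (cases "\<exists>F :: 'u set. finite F \<and> span F = UNIV")
    case True
    then obtain F :: "'u set" where "finite F" "span F = UNIV" by blast
    moreover have "(0::complex) \<in> \<bbbD>" by simp
    ultimately have "inj (D 0)"
      using finite_dimensional_surj_imp_inj[of F "D 0"] D_surj[of 0] D[of 0]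
        bounded_clinear_imp_bounded_linear bounded_linear.linear by blast
    then show ?thesis using that[of 0] by simp
  next
    case False then show ?thesis using assms(14) that by blast
  qed
  have inv: "boundedly_invertible (\<lambda>u. C z (\<E> z u) + D z u)" if "\<E> \<in> schur_class" "z \<in> \<bbbD>" for \<E> z
    using that by (intro denominator_invertible[OF z0]) (auto simp: schur_class_def)
  have iff: "S \<in> schur_multipliers \<beta>
          \<and> (\<forall>u. H2_adjoint \<beta> (obs \<beta> E T) (mult_op \<beta> S (H2_const u)) = cadjoint N u)
        \<longleftrightarrow> (\<exists>\<E>\<in>schur_class. \<forall>z\<in>\<bbbD>.
              S z = Psi \<beta> z \<circ> (\<lambda>u. A z (\<E> z u) + B z u) \<circ> inv (\<lambda>u. C z (\<E> z u) + D z u))"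
    (is "?interp \<longleftrightarrow> ?param") for S :: "complex \<Rightarrow> 'u \<Rightarrow> 'y"
  proof
    assume S: ?interp
    then have bS: "\<And>z. z \<in> \<bbbD> \<Longrightarrow> bounded_clinear (S z)" by (simp add: schur_multipliers_def)
    obtain W where W: "bounded_clinear W" "\<And>x. norm (W x) \<le> norm x"
        "\<And>z y. z \<in> \<bbbD> \<Longrightarrow> W (\<kappa> z y) = \<kappa>1 z (cadjoint (S z) y)"
      using multiplier_adjoint[OF wt, of S] S by metis
    have "W (Ob x) = On x" for x
      using interpolation_condition_iff[of S W, OF bS W] S by blast
    then obtain F where F: "F \<in> schur_class"
        "\<And>z u. z \<in> \<bbbD> \<Longrightarrow> S z (C z (F z u) + D z u) = Psi \<beta> z (A z (F z u) + B z u)"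
      using schur_parameter_exists[of S W, OF bS W] by metis
    have "S z = Psi \<beta> z \<circ> (\<lambda>u. A z (F z u) + B z u) \<circ> inv (\<lambda>u. C z (F z u) + D z u)" if z: "z \<in> \<bbbD>" for z
    proof
      fix v
      let ?u = "inv (\<lambda>u. C z (F z u) + D z u) v"
      have "S z v = S z (C z (F z ?u) + D z ?u)"
        by (simp only: boundedly_invertible_inv(3)[OF inv[OF F(1) z]])
      then show "S z v = (Psi \<beta> z \<circ> (\<lambda>u. A z (F z u) + B z u) \<circ> inv (\<lambda>u. C z (F z u) + D z u)) v"
        by (simp add: F(2)[OF z])
    qed
    then show ?param using F(1) by blast
  next
    assume ?param
    then obtain F where F: "F \<in> schur_class"
        "\<And>z. z \<in> \<bbbD> \<Longrightarrow> S z = Psi \<beta> z \<circ> (\<lambda>u. A z (F z u) + B z u) \<circ> inv (\<lambda>u. C z (F z u) + D z u)"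
      by blast
    have Fb: "bounded_clinear (F z)" if "z \<in> \<bbbD>" for z using F(1) that by (simp add: schur_class_def)
    have bS: "bounded_clinear (S z)" if z: "z \<in> \<bbbD>" for z
      unfolding F(2)[OF z] o_def
      by (intro bounded_clinear_compose[OF Psi[OF z]] bounded_clinear_plus
          bounded_clinear_compose[OF A[OF z]] bounded_clinear_compose[OF B[OF z]]
          bounded_clinear_compose[OF Fb[OF z]] boundedly_invertible_inv(1)[OF inv[OF F(1) z]])
    have SF: "S z (C z (F z u) + D z u) = Psi \<beta> z (A z (F z u) + B z u)" if z: "z \<in> \<bbbD>" for z u
      using boundedly_invertible_inv(2)[OF inv[OF F(1) z], of u] by (simp add: F(2)[OF z])
    obtain W where W: "bounded_clinear W" "\<And>x. norm (W x) \<le> norm x"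
        "\<And>z y. z \<in> \<bbbD> \<Longrightarrow> W (\<kappa> z y) = \<kappa>1 z (cadjoint (S z) y)" and W_Ob: "\<And>x. W (Ob x) = On x"
      using schur_parameter_interpolates[of S F, OF bS F(1) SF] by metis
    show ?interp
      using multiplier_of_adjoint(1)[OF wt bS W] interpolation_condition_iff[of S W, OF bS W] W_Ob by blast
  qed
  show ?thesis using inv iff by blast
qed

end
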